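(* Let $\overline{E}=(E,\|\cdot\|)$ be a normed $\mathbb{Z}$-module of rank $n\ge 1$. Then $$- n \log n + \log\left(1 - \tfrac{1}{2\pi}\right) - \pi \;\leq\; \widehat{h}^0(\overline{E}) - \widehat{h}^1(\overline{E}) - \widehat{\deg}(\overline{E}) \;\leq\; n \log n + \pi - \log\left(1 - \tfrac{1}{2\pi}\right).$$
   Context: A normed $\mathbb{Z}$-module $\overline{E}=(E,\|\cdot\|)$ is a finitely generated $\mathbb{Z}$-module $E$ (torsion is allowed) together with a norm $\|\cdot\|$ on the $\mathbb{C}$-vector space $E_{\mathbb C}=E\otimes_{\mathbb Z}\mathbb{C}$. For $m\in E$, $\|m\|$ denotes the norm of the image of $m$ in $E_{\mathbb C}$. Put $E_{\mathbb R}=E\otimes_{\mathbb Z}\mathbb{R}$; the rank of $E$ is $n=\dim_{\mathbb R}E_{\mathbb R}$. Let $E_{\mathrm{tors}}$ be the torsion submodule of $E$ and $B(E,\|\cdot\|)=\{m\in E_{\mathbb R}\mid \|m\|\le 1\}$. Define $$\widehat{\chi}(\overline{E})=\log \# E_{\mathrm{tors}}-\log\left(\frac{\mathrm{vol}(E_{\mathbb R}/(E/E_{\mathrm{tors}}))}{\mathrm{vol}(B(E,\|\cdot\|))}\right),$$ where $\mathrm{vol}$ is taken with respect to any Haar measure on $E_{\mathbb R}$ (the value does not depend on the choice), $\mathrm{vol}(E_{\mathbb R}/(E/E_{\mathrm{tors}}))$ being the covolume of the lattice $E/E_{\mathrm{tors}}$ in $E_{\mathbb R}$. The arithmetic degree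 is $$\widehat{\deg}(\overline{E})=\widehat{\chi}(\overline{E})+\log\left(\Gamma(\tfrac{n}{2}+1)\,\pi^{-n/2}\right).$$ Define $\widehat{h}^0(\overline{E})=\log\#\{m\in E\mid \|m\|\le 1\}$ and $\widehat{h}^1(\overline{E})=\widehat{h}^0(\overline{E}^\vee)$, where $\overline{E}^\vee$ is $E^\vee=\mathrm{Hom}_{\mathbb Z}(E,\mathbb{Z})$ with the dual norm $\|f\|^\vee=\sup_{m\in E_{\mathbb R}\setminus\{0\}}|f(m)|/\|m\|$. *)

theory Defs
  imports
    "HOL-Analysis.Analysis"
    "HOL-Library.Poly_Mapping"
    "HOL-Computational_Algebra.Group_Closure"
begin

section \<open>Finitely generated abelian groups and their duals\<close>

definition finitely_generated :: "'a::ab_group_add itself \<Rightarrow> bool" where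
  "finitely_generated _ \<longleftrightarrow> (\<exists>S :: 'a set. finite S \<and> group_closure S = UNIV)"

text \<open>The sum of \<open>n\<close> copies of \<open>x\<close> is the \<open>n\<close>-fold multiple of \<open>x\<close>.\<close>

definition torsion :: "'a::ab_group_add set" where
  "torsion = {x. \<exists>n>0. (\<Sum>i<n::nat. x) = 0}"

typedef (overloaded) 'a zdual = "{f :: 'a::ab_group_add \<Rightarrow> int. \<forall>x y. f (x + y) = f x + f y}"
  morphisms apply_dual Abs_zdual
  by (rule exI[of _ "\<lambda>_. 0"]) simp

setup_lifting type_definition_zdual

instantiation zdual :: (ab_group_add) ab_group_add
begin

lift_definition zero_zdual :: "'a zdual" is "\<lambda>_. 0" by simp
lift_definition plus_zdual :: "'a zdual \<Rightarrow> 'a zdual \<Rightarrow> 'a zdual" is "\<lambda>f g x. f x + g x" by simp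
lift_definition minus_zdual :: "'a zdual \<Rightarrow> 'a zdual \<Rightarrow> 'a zdual" is "\<lambda>f g x. f x - g x" by simp
lift_definition uminus_zdual :: "'a zdual \<Rightarrow> 'a zdual" is "\<lambda>f x. - f x" by simp

instance
  by standard (transfer; simp add: algebra_simps)+

end

lemma apply_dual_add: "apply_dual f (x + y) = apply_dual f x + apply_dual f y"
  by transfer simp

section \<open>Extension of scalars\<close>

text \<open>
  The tensor product of an abelian group with a commutative ring over the integers is the free
  abelian group on pairs \<open>(x, a)\<close> modulo biadditivity. (Compatibility with the action
  of the integers is a consequence of biadditivity.)
\<close>

definition tensor_relators :: "('a::ab_group_add \<times> 'k::comm_ring_1 \<Rightarrow>\<^sub>0 int) set" where
  "tensor_relators =
     {frag_of (x + y, a) - frag_of (x, a) - frag_of (y, a) | x y a. True} \<union>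
     {frag_of (x, a + b) - frag_of (x, a) - frag_of (x, b) | x a b. True}"

definition tensor_rel ::
  "('a::ab_group_add \<times> 'k::comm_ring_1 \<Rightarrow>\<^sub>0 int) \<Rightarrow> ('a \<times> 'k \<Rightarrow>\<^sub>0 int) \<Rightarrow> bool" where
  "tensor_rel u v \<longleftrightarrow> u - v \<in> group_closure tensor_relators"

lemma tensor_rel_equivp:
  "equivp (tensor_rel :: ('a::ab_group_add \<times> 'k::comm_ring_1 \<Rightarrow>\<^sub>0 int) \<Rightarrow> _)"
proof (rule equivpI)
  let ?R = "tensor_rel :: ('a \<times> 'k \<Rightarrow>\<^sub>0 int) \<Rightarrow> _"
  show "reflp ?R"
    by (rule reflpI) (simp add: tensor_rel_def)
  show "symp ?R"
    by (rule sympI) (metis tensor_rel_def minus_diff_eq group_closure_minus_iff)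
  show "transp ?R"
  proof (rule transpI)
    fix u v w :: "'a \<times> 'k \<Rightarrow>\<^sub>0 int"
    assume "tensor_rel u v" "tensor_rel v w"
    then have "(u - v) + (v - w) \<in> group_closure tensor_relators"
      unfolding tensor_rel_def by (rule group_closure_add)
    then show "tensor_rel u w"
      by (simp add: tensor_rel_def)
  qed
qed

quotient_type (overloaded) ('a, 'k) tensor =
  "'a::ab_group_add \<times> 'k::comm_ring_1 \<Rightarrow>\<^sub>0 int" / tensor_rel
  by (rule tensor_rel_equivp)

lemma tensor_relators_left:
  "frag_of (x + y, a) - frag_of (x, a) - frag_of (y, a) \<in> group_closure tensor_relators"
  by (rule group_closure.base) (unfold tensor_relators_def, blast)

lemma tensor_relators_right:
  "frag_of (x, a + b) - frag_of (x, a) - frag_of (x, b) \<in> group_closure tensor_relators"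
  by (rule group_closure.base) (unfold tensor_relators_def, blast)

instantiation tensor :: (ab_group_add, comm_ring_1) ab_group_add
begin

lift_definition zero_tensor :: "('a, 'b) tensor" is 0 .

lift_definition plus_tensor :: "('a, 'b) tensor \<Rightarrow> ('a, 'b) tensor \<Rightarrow> ('a, 'b) tensor" is "(+)"
  unfolding tensor_rel_def by (metis add_diff_add group_closure_add)

lift_definition uminus_tensor :: "('a, 'b) tensor \<Rightarrow> ('a, 'b) tensor" is uminus
  unfolding tensor_rel_def by (metis minus_diff_minus group_closure_minus_iff)

lift_definition minus_tensor :: "('a, 'b) tensor \<Rightarrow> ('a, 'b) tensor \<Rightarrow> ('a, 'b) tensor" is "(-)"
proof -
  fix u u' v v' :: "'a \<times> 'b \<Rightarrow>\<^sub>0 int"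
  assume "tensor_rel u u'" "tensor_rel v v'"
  then have "(u - u') - (v - v') \<in> group_closure tensor_relators"
    unfolding tensor_rel_def by (rule group_closure.diff)
  then show "tensor_rel (u - v) (u' - v')"
    unfolding tensor_rel_def by (simp add: algebra_simps)
qed

instance
  by standard (transfer; simp add: tensor_rel_def)+

end

lift_definition pure :: "'a::ab_group_add \<Rightarrow> 'k::comm_ring_1 \<Rightarrow> ('a, 'k) tensor"
  is "\<lambda>x a. frag_of (x, a)" .

lemma pure_add_left: "pure (x + y) a = pure x a + pure y a"
  by transfer (simp add: tensor_rel_def diff_diff_add[symmetric] tensor_relators_left)

lemma pure_add_right: "pure x (a + b) = pure x a + pure x b"
  by transfer (simp add: tensor_rel_def diff_diff_add[symmetric] tensor_relators_right)

lemma pure_diff_left: "pure (x - y) a = pure x a - pure y a"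
  by (metis pure_add_left add_diff_cancel diff_add_cancel)

lemma pure_zero_left [simp]: "pure 0 a = 0"
  using pure_diff_left[of 0 0 a] by simp

lemma group_closure_tensor_relators_mono:
  assumes "u \<in> group_closure tensor_relators"
    and diff: "\<And>u v. F (u - v) = F u - (F v :: 'c::ab_group_add)"
    and left: "\<And>x y a. F (frag_of (x + y, a)) - F (frag_of (x, a)) - F (frag_of (y, a)) \<in> group_closure R"
    and right: "\<And>x a b. F (frag_of (x, a + b)) - F (frag_of (x, a)) - F (frag_of (x, b)) \<in> group_closure R"
  shows "F u \<in> group_closure R"
  using assms(1)
proof induction
  case (base s)
  have "F 0 = 0"
    using diff[of 0 0] by simp
  with base show ?case
    using left right by (auto simp: tensor_relators_def diff)
next
  case (diff s t)
  then show ?case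
    by (simp add: assms(2) group_closure.diff)
qed

lemma tensor_rel_frag_extend:
  assumes "\<And>a b. h (a + b) = h a + h b" and "tensor_rel u v"
  shows "tensor_rel (frag_extend (\<lambda>(x, a). frag_of (x, h a)) u)
                    (frag_extend (\<lambda>(x, a). frag_of (x, h a)) v)"
  using assms(2) unfolding tensor_rel_def frag_extend_diff[symmetric]
  by (rule group_closure_tensor_relators_mono)
     (simp_all add: frag_extend_diff assms(1) tensor_relators_left tensor_relators_right)

lift_definition tensor_scale ::
  "'k \<Rightarrow> ('a::ab_group_add, 'k::comm_ring_1) tensor \<Rightarrow> ('a, 'k) tensor"
  is "\<lambda>c. frag_extend (\<lambda>(x, a). frag_of (x, c * a))"
  by (rule tensor_rel_frag_extend) (simp_all add: distrib_left)

lift_definition complexify :: "('a::ab_group_add, real) tensor \<Rightarrow> ('a, complex) tensor"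
  is "frag_extend (\<lambda>(x, a). frag_of (x, complex_of_real a))"
  by (rule tensor_rel_frag_extend) simp_all

lemma tensor_scale_add_right: "tensor_scale c (s + t) = tensor_scale c s + tensor_scale c t"
  by transfer (simp add: frag_extend_add tensor_rel_def)

lemma tensor_scale_diff_right: "tensor_scale c (s - t) = tensor_scale c s - tensor_scale c t"
  by transfer (simp add: frag_extend_diff tensor_rel_def)

lemma tensor_scale_pure [simp]: "tensor_scale c (pure x a) = pure x (c * a)"
  by transfer (simp add: tensor_rel_def)

lemma complexify_add: "complexify (s + t) = complexify s + complexify t"
  by transfer (simp add: frag_extend_add tensor_rel_def)

lemma complexify_diff: "complexify (s - t) = complexify s - complexify t"
  by transfer (simp add: frag_extend_diff tensor_rel_def)

lemma complexify_pure [simp]: "complexify (pure x a) = pure x (complex_of_real a)"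
  by transfer (simp add: tensor_rel_def)

lemma tensor_induct [case_names zero pure diff]:
  assumes "P 0" and "\<And>x a. P (pure x a)" and "\<And>s t. P s \<Longrightarrow> P t \<Longrightarrow> P (s - t)"
  shows "P t"
proof -
  obtain u where u: "t = abs_tensor u"
    by (rule tensor.abs_induct[of "\<lambda>t. \<exists>u. t = abs_tensor u" t, THEN exE]) blast+
  have "Poly_Mapping.keys u \<subseteq> UNIV"
    by simp
  then have "P (abs_tensor u)"
  proof (induction u rule: frag_induction)
    case zero
    then show ?case using assms(1) by (simp add: zero_tensor_def)
  next
    case (one p)
    then show ?case using assms(2)[of "fst p" "snd p"] by (simp add: pure.abs_eq)
  next
    case (diff u v)
    then show ?case using assms(3) by (metis minus_tensor.abs_eq)
  qed
  then show ?thesis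
    using u by simp
qed

interpretation tensor_module:
  module "tensor_scale :: 'k \<Rightarrow> ('a::ab_group_add, 'k::comm_ring_1) tensor \<Rightarrow> _"
proof
  fix c d :: 'k and s t :: "('a, 'k) tensor"
  show "tensor_scale c (s + t) = tensor_scale c s + tensor_scale c t"
    by (rule tensor_scale_add_right)
  have z: "tensor_scale c 0 = (0 :: ('a, 'k) tensor)" for c
    using tensor_scale_diff_right[of c 0 0] by simp
  show "tensor_scale (c + d) t = tensor_scale c t + tensor_scale d t"
    by (induction t rule: tensor_induct)
       (simp_all add: z tensor_scale_diff_right distrib_right pure_add_right)
  show "tensor_scale c (tensor_scale d t) = tensor_scale (c * d) t"
    by (induction t rule: tensor_induct)
       (simp_all add: z tensor_scale_diff_right mult.assoc)
  show "tensor_scale 1 t = t"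
    by (induction t rule: tensor_induct) (simp_all add: z tensor_scale_diff_right)
qed

instantiation tensor :: (ab_group_add, "{comm_ring_1, real_algebra_1}") real_vector
begin

definition scaleR_tensor :: "real \<Rightarrow> ('a, 'b) tensor \<Rightarrow> ('a, 'b) tensor" where
  "scaleR_tensor r = tensor_scale (of_real r)"

instance
  by standard (simp_all add: scaleR_tensor_def tensor_module.scale_right_distrib
      tensor_module.scale_left_distrib)

end

text \<open>
  The evaluation pairing between the scalar extensions of the dual and of the group itself,
  characterised by \<open>pairing (pure f a) (pure x b) = a * b * of_int (apply_dual f x)\<close>.
\<close>

definition frag_eval :: "('b \<Rightarrow> 'k::comm_ring_1) \<Rightarrow> ('b \<Rightarrow>\<^sub>0 int) \<Rightarrow> 'k" where
  "frag_eval f u = (\<Sum>p\<in>Poly_Mapping.keys u. of_int (Poly_Mapping.lookup u p) * f p)"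

lemma frag_eval_superset:
  assumes "finite K" "Poly_Mapping.keys u \<subseteq> K"
  shows "frag_eval f u = (\<Sum>p\<in>K. of_int (Poly_Mapping.lookup u p) * f p)"
  unfolding frag_eval_def using assms
  by (intro sum.mono_neutral_left) (auto simp: in_keys_iff)

lemma frag_eval_diff: "frag_eval f (u - v) = frag_eval f u - frag_eval f v"
proof -
  let ?K = "Poly_Mapping.keys u \<union> Poly_Mapping.keys v"
  have "Poly_Mapping.keys (u - v) \<subseteq> ?K"
    by (rule keys_diff)
  then show ?thesis
    by (simp add: frag_eval_superset[of ?K] lookup_minus left_diff_distrib sum_subtractf)
qed

lemma frag_eval_of [simp]: "frag_eval f (frag_of p) = f p"
  by (simp add: frag_eval_def)

lemma frag_eval_diff_fun: "frag_eval (\<lambda>p. f p - g p) u = frag_eval f u - frag_eval g u"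
  by (simp add: frag_eval_def right_diff_distrib sum_subtractf)

lemma frag_eval_cong_tensor_rel:
  assumes "tensor_rel u v"
    and "\<And>x y a. f (x + y, a) = f (x, a) + f (y, a)"
    and "\<And>x a b. f (x, a + b) = f (x, a) + f (x, b)"
  shows "frag_eval f u = frag_eval f v"
proof -
  have "frag_eval f (u - v) \<in> group_closure {}"
    using assms(1) unfolding tensor_rel_def
    by (rule group_closure_tensor_relators_mono) (simp_all add: frag_eval_diff assms)
  then show ?thesis
    by (simp add: frag_eval_diff)
qed

lemma frag_eval_add_fun: "frag_eval (\<lambda>p. f p + g p) u = frag_eval f u + frag_eval g u"
  by (simp add: frag_eval_def distrib_left sum.distrib)

lift_definition pairing ::
  "('a::ab_group_add zdual, 'k::comm_ring_1) tensor \<Rightarrow> ('a, 'k) tensor \<Rightarrow> 'k"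
  is "\<lambda>u v. frag_eval (\<lambda>(f, a). frag_eval (\<lambda>(x, b). a * b * of_int (apply_dual f x)) v) u"
proof -
  fix u u' :: "'a zdual \<times> 'k \<Rightarrow>\<^sub>0 int" and v v' :: "'a \<times> 'k \<Rightarrow>\<^sub>0 int"
  assume uu: "tensor_rel u u'" and vv: "tensor_rel v v'"
  let ?g = "\<lambda>v (f, a). frag_eval (\<lambda>(x, b). a * b * of_int (apply_dual f x)) v"
  have "?g v = ?g v'"
    by (rule ext, clarify, rule frag_eval_cong_tensor_rel[OF vv])
       (simp_all add: apply_dual_add algebra_simps)
  moreover have "frag_eval (?g v) u = frag_eval (?g v) u'"
    by (rule frag_eval_cong_tensor_rel[OF uu])
       (simp_all add: frag_eval_add_fun[symmetric] plus_zdual.rep_eq algebra_simps case_prod_unfold)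
  ultimately show "frag_eval (?g v) u = frag_eval (?g v') u'"
    by simp
qed

lemma pairing_pure [simp]: "pairing (pure f a) (pure x b) = a * b * of_int (apply_dual f x)"
  by transfer simp

lemma pairing_diff_left: "pairing (s - t) m = pairing s m - pairing t m"
  by transfer (simp add: frag_eval_diff)

lemma pairing_diff_right: "pairing s (m - m') = pairing s m - pairing s m'"
  by transfer (simp add: frag_eval_diff frag_eval_diff_fun[symmetric] case_prod_unfold)

section \<open>Normed modules\<close>

definition complex_norm :: "(('a::ab_group_add, complex) tensor \<Rightarrow> real) \<Rightarrow> bool" where
  "complex_norm N \<longleftrightarrow>
     (\<forall>x. 0 \<le> N x) \<and> (\<forall>x. N x = 0 \<longleftrightarrow> x = 0) \<and>
     (\<forall>x y. N (x + y) \<le> N x + N y) \<and>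
     (\<forall>c x. N (tensor_scale c x) = cmod c * N x)"

definition normed_Z_module :: "(('a::ab_group_add, complex) tensor \<Rightarrow> real) \<Rightarrow> bool" where
  "normed_Z_module N \<longleftrightarrow> finitely_generated TYPE('a) \<and> complex_norm N"

definition module_rank :: "'a::ab_group_add itself \<Rightarrow> nat" where
  "module_rank _ = dim (UNIV :: ('a, real) tensor set)"

definition unit_ball :: "(('a::ab_group_add, complex) tensor \<Rightarrow> real) \<Rightarrow> ('a, real) tensor set" where
  "unit_ball N = {m. N (complexify m) \<le> 1}"

text \<open>The topology of \<open>E\<^sub>\<real>\<close>, a finite-dimensional space on which all norms are equivalent.\<close>

definition norm_topology ::
  "(('a::ab_group_add, complex) tensor \<Rightarrow> real) \<Rightarrow> ('a, real) tensor topology" where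
  "norm_topology N = Metric_space.mtopology UNIV (\<lambda>x y. N (complexify (x - y)))"

text \<open>
  Regularity is not required explicitly: it is automatic on a finite-dimensional real vector space.
\<close>

definition haar_measure ::
  "(('a::ab_group_add, complex) tensor \<Rightarrow> real) \<Rightarrow> ('a, real) tensor measure \<Rightarrow> bool" where
  "haar_measure N \<mu> \<longleftrightarrow>
     space \<mu> = UNIV \<and>
     sets \<mu> = sigma_sets UNIV {U. openin (norm_topology N) U} \<and>
     (\<forall>v. \<forall>A\<in>sets \<mu>. emeasure \<mu> ((+) v ` A) = emeasure \<mu> A) \<and>
     (\<forall>K. compactin (norm_topology N) K \<longrightarrow> emeasure \<mu> K < \<infinity>) \<and>
     (\<forall>U. openin (norm_topology N) U \<and> U \<noteq> {} \<longrightarrow> emeasure \<mu> U > 0)"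

text \<open>
  The kernel of \<open>m \<mapsto> m \<otimes> 1\<close> is the torsion subgroup, so its image is the
  lattice \<open>E / E\<^sub>t\<^sub>o\<^sub>r\<^sub>s\<close> in \<open>E\<^sub>\<real>\<close>.
\<close>

definition integral_lattice :: "('a::ab_group_add, real) tensor set" where
  "integral_lattice = range (\<lambda>m. pure m 1)"

definition fundamental_domain ::
  "('a::ab_group_add, real) tensor measure \<Rightarrow> ('a, real) tensor set \<Rightarrow> bool" where
  "fundamental_domain \<mu> D \<longleftrightarrow> D \<in> sets \<mu> \<and> (\<forall>x. \<exists>!l. l \<in> integral_lattice \<and> x + l \<in> D)"

text \<open>
  The volume of the quotient by the lattice is the measure of a measurable fundamental domain;
  by translation invariance, it does not depend on the fundamental domain.
\<close>

definition covolume :: "('a::ab_group_add, real) tensor measure \<Rightarrow> real" where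
  "covolume \<mu> = measure \<mu> (SOME D. fundamental_domain \<mu> D)"

definition chi_hat ::
  "('a::ab_group_add, real) tensor measure \<Rightarrow> (('a, complex) tensor \<Rightarrow> real) \<Rightarrow> real" where
  "chi_hat \<mu> N =
     ln (real (card (torsion :: 'a set))) - ln (covolume \<mu> / measure \<mu> (unit_ball N))"

definition deg_hat ::
  "('a::ab_group_add, real) tensor measure \<Rightarrow> (('a, complex) tensor \<Rightarrow> real) \<Rightarrow> real" where
  "deg_hat \<mu> N =
     chi_hat \<mu> N +
     ln (Gamma (real (module_rank TYPE('a)) / 2 + 1) * pi powr (- (real (module_rank TYPE('a)) / 2)))"

definition h0_hat :: "(('a::ab_group_add, complex) tensor \<Rightarrow> real) \<Rightarrow> real" where
  "h0_hat N = ln (real (card {m :: 'a. N (pure m 1) \<le> 1}))"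

text \<open>
  The dual norm on \<open>E\<^sup>\<or> \<otimes> \<complex>\<close>; as in the case of integral functionals,
  the supremum ranges over the real vectors only.
\<close>

definition dual_norm ::
  "(('a::ab_group_add, complex) tensor \<Rightarrow> real) \<Rightarrow> ('a zdual, complex) tensor \<Rightarrow> real" where
  "dual_norm N \<phi> =
     (SUP m \<in> UNIV - {0 :: ('a, real) tensor}.
        cmod (pairing \<phi> (complexify m)) / N (complexify m))"

definition h1_hat :: "(('a::ab_group_add, complex) tensor \<Rightarrow> real) \<Rightarrow> real" where
  "h1_hat N = h0_hat (dual_norm N)"

end

theory Submission
  imports Defs
begin

text \<open>
  Identify \<open>E\<close> modulo torsion with \<open>\<int>\<^sup>n\<close>, and let \<open>K\<close> be the unit ball, \<open>P\<close> its polar and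
  \<open>V\<close> the volume of the Euclidean unit ball. The quantity to be bounded is the logarithm of
  \<open>V * #(\<int>\<^sup>n \<inter> K) / (#(\<int>\<^sup>n \<inter> P) * vol K)\<close>. If \<open>S - S \<subseteq> K\<close>, then the periodisation of the indicator of
  \<open>S\<close> is at most \<open>#(\<int>\<^sup>n \<inter> K)\<close>, and Bessel's inequality on the torus for the characters \<open>y \<in> \<int>\<^sup>n \<inter> P\<close>
  gives \<open>#(\<int>\<^sup>n \<inter> K) \<ge> vol S * \<beta>\<^sup>2 * #(\<int>\<^sup>n \<inter> P)\<close> as soon as the Fourier coefficients of \<open>S\<close> at these \<open>y\<close>
  are at least \<open>\<beta> * vol S\<close>. The choice \<open>S = K / 8\<close> yields the lower bound. For the upper bound exchange \<open>K\<close> and \<open>P\<close> and take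
  for \<open>S\<close> a multiple of the ellipsoid polar to the John ellipsoid around \<open>K\<close>: it fits into \<open>P\<close>, and
  \<open>vol K\<close> is at least the volume of the John ellipsoid divided by \<open>n\<^bsup>n/2\<^esup>\<close>.
\<close>

section \<open>Periodic functions and Bessel's inequality on the torus\<close>

text \<open>Taking P / 8 for \<open>S\<close> in the upper bound would leave a lower bound for vol K
  * vol P to be proved, an inequality of Mahler type. With the ellipsoid the volume of P never
  occurs: the determinants of the ellipsoid and of its polar cancel and leave V^2. The two
  directions have unequal slack. In the lower bound n^n easily beats V / 8^n, as V decays only like
  n^(-n/2) up to exponential factors; so the pointwise estimate of the cosines by cos (pi / 4) is
  good enough. In the upper bound one factor n^(n/2) is spent on the John ellipsoid and the other on
  the decay of V, and only exponential factors remain: V * (s * sqrt n)^n stays away from 0 only for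
  s > 1 / sqrt (2 * pi * e), about 0.242, where s is the scaling of the ellipsoid. Its phases reach
  2 * pi * s, and their cosines turn negative at s = 1/4, so pointwise estimates leave hardly any
  room. Averaging cos t >= 1 - t^2 / 2 over the ball costs only a term of order s^2 / n and admits s
  = 3/10.\<close>

definition int_vecs :: "(real ^ 'n) set" where
  "int_vecs = {x. \<forall>i. x $ i \<in> \<int>}"

lemma int_vecs_diff: "x \<in> int_vecs \<Longrightarrow> y \<in> int_vecs \<Longrightarrow> x - y \<in> int_vecs"
  by (simp add: int_vecs_def)

lemma int_vecs_add: "x \<in> int_vecs \<Longrightarrow> y \<in> int_vecs \<Longrightarrow> x + y \<in> int_vecs"
  by (simp add: int_vecs_def)

lemma int_vecs_uminus: "x \<in> int_vecs \<Longrightarrow> - x \<in> int_vecs"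
  by (simp add: int_vecs_def)

lemma int_vecs_inner: "x \<in> int_vecs \<Longrightarrow> y \<in> int_vecs \<Longrightarrow> x \<bullet> y \<in> \<int>"
  by (auto simp: int_vecs_def inner_vec_def intro!: Ints_sum Ints_mult)

lemma finite_int_vecs_bounded:
  fixes K :: "(real ^ 'n) set"
  assumes "bounded K"
  shows "finite (int_vecs \<inter> K)"
proof -
  obtain B where B: "\<And>x. x \<in> K \<Longrightarrow> norm x \<le> B"
    using assms by (auto simp: bounded_iff)
  let ?g = "\<lambda>f :: 'n \<Rightarrow> int. \<chi> i. real_of_int (f i)"
  have "int_vecs \<inter> K \<subseteq> ?g ` (PiE UNIV (\<lambda>_. {- \<lceil>B\<rceil> .. \<lceil>B\<rceil>}))"
  proof
    fix x assume x: "x \<in> int_vecs \<inter> K"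
    have "x = ?g (\<lambda>i. \<lfloor>x $ i\<rfloor>)"
      using x by (auto simp: vec_eq_iff int_vecs_def elim!: Ints_cases)
    moreover have "\<lfloor>x $ i\<rfloor> \<in> {- \<lceil>B\<rceil> .. \<lceil>B\<rceil>}" for i
    proof -
      have "\<bar>x $ i\<bar> \<le> B"
        using B[of x] x component_le_norm_cart[of x i] by auto
      then show ?thesis
        using x by (auto simp: int_vecs_def) linarith+
    qed
    ultimately show "x \<in> ?g ` (PiE UNIV (\<lambda>_. {- \<lceil>B\<rceil> .. \<lceil>B\<rceil>}))"
      by (intro image_eqI[of _ _ "\<lambda>i. \<lfloor>x $ i\<rfloor>"]) auto
  qed
  then show ?thesis
    by (rule finite_subset) (auto intro!: finite_imageI finite_PiE)
qed

lemma countable_int_vecs: "countable (int_vecs :: (real ^ 'n) set)"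
proof -
  have "int_vecs = (\<Union>k. int_vecs \<inter> cball (0 :: real ^ 'n) (real k))"
    using real_arch_simple by auto
  then show ?thesis
    by (metis (lifting) countable_UN countableI_type bounded_cball countable_finite
        finite_int_vecs_bounded)
qed

section \<open>Fundamental domains of the integer lattice and unfolding of integrals\<close>

definition torus_domain :: "(real ^ 'n) set \<Rightarrow> bool" where
  "torus_domain D \<longleftrightarrow> D \<in> sets borel \<and> (\<forall>x. \<exists>!l. l \<in> int_vecs \<and> x + l \<in> D)"

definition unit_cube :: "(real ^ 'n) set" where
  "unit_cube = {x. \<forall>i. 0 \<le> x $ i \<and> x $ i < 1}"

lemma unit_cube_borel [measurable]: "unit_cube \<in> sets borel"
  unfolding unit_cube_def by measurable

lemma torus_domain_unit_cube: "torus_domain (unit_cube :: (real ^ 'n) set)"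
  unfolding torus_domain_def
proof (intro conjI allI unit_cube_borel)
  fix x :: "real ^ 'n"
  show "\<exists>!l. l \<in> int_vecs \<and> x + l \<in> unit_cube"
  proof (rule ex1I[of _ "\<chi> i. - real_of_int \<lfloor>x $ i\<rfloor>"])
    show "(\<chi> i. - real_of_int \<lfloor>x $ i\<rfloor>) \<in> int_vecs \<and> x + (\<chi> i. - real_of_int \<lfloor>x $ i\<rfloor>) \<in> unit_cube"
      by (auto simp: int_vecs_def unit_cube_def) linarith
  next
    fix l assume l: "l \<in> int_vecs \<and> x + l \<in> unit_cube"
    show "l = (\<chi> i. - real_of_int \<lfloor>x $ i\<rfloor>)"
      unfolding vec_eq_iff
    proof
      fix i
      obtain z where z: "l $ i = of_int z"
        using l by (auto simp: int_vecs_def elim: Ints_cases)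
      have "0 \<le> x $ i + l $ i \<and> x $ i + l $ i < 1"
        using l by (auto simp: unit_cube_def)
      then have "\<lfloor>x $ i\<rfloor> = - z"
        unfolding z by linarith
      then show "l $ i = (\<chi> i. - real_of_int \<lfloor>x $ i\<rfloor>) $ i"
        by (simp add: z)
    qed
  qed
qed

lemma torus_domain_translate:
  assumes "torus_domain D"
  shows "torus_domain ((\<lambda>x. x + a) -` D)"
proof -
  have "(\<lambda>x. x + a) -` D \<in> sets borel"
    using assms by (intro measurable_sets_borel[where M = borel]) (auto simp: torus_domain_def)
  moreover have "\<exists>!l. l \<in> int_vecs \<and> x + l \<in> (\<lambda>x. x + a) -` D" for x
    using assms[unfolded torus_domain_def, THEN conjunct2, rule_format, of "x + a"]
    by (simp add: ac_simps)
  ultimately show ?thesis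
    by (simp add: torus_domain_def)
qed

lemma nn_integral_lborel_translate:
  fixes f :: "'a::euclidean_space \<Rightarrow> ennreal"
  assumes [measurable]: "f \<in> borel_measurable borel"
  shows "(\<integral>\<^sup>+x. f (x + a) \<partial>lborel) = (\<integral>\<^sup>+x. f x \<partial>lborel)"
proof -
  have "(\<integral>\<^sup>+x. f x \<partial>lborel) = (\<integral>\<^sup>+x. f x \<partial>distr lborel borel ((+) a))"
    by (simp add: lborel_distr_plus)
  also have "\<dots> = (\<integral>\<^sup>+x. f (x + a) \<partial>lborel)"
    by (subst nn_integral_distr) (auto simp: ac_simps)
  finally show ?thesis ..
qed

lemma nn_integral_count_torus_domain:
  assumes "torus_domain D"
  shows "(\<integral>\<^sup>+l. indicator D (x + l) \<partial>count_space int_vecs) = 1"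
proof -
  have "\<exists>!l. l \<in> int_vecs \<and> x + l \<in> D"
    using assms by (simp add: torus_domain_def)
  then obtain l where l: "l \<in> int_vecs \<and> x + l \<in> D"
    and u: "\<forall>l'. l' \<in> int_vecs \<and> x + l' \<in> D \<longrightarrow> l' = l"
    by (rule ex1E)
  have "l \<in> int_vecs" using l by (rule conjunct1)
  have "indicator D (x + l') = (indicator {l} l' :: ennreal)" if "l' \<in> int_vecs" for l'
  proof (cases "l' = l")
    case True
    then show ?thesis using l by simp
  next
    case False
    then have "x + l' \<notin> D" using u that by blast
    then show ?thesis using False by simp
  qed
  then have "(\<integral>\<^sup>+l. indicator D (x + l) \<partial>count_space int_vecs) =
      (\<integral>\<^sup>+l'. indicator {l} l' \<partial>count_space int_vecs)"
    by (intro nn_integral_cong) simp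
  also have "\<dots> = 1"
    using \<open>l \<in> int_vecs\<close> by (subst nn_integral_indicator) auto
  finally show ?thesis .
qed

text \<open>Every point has exactly one lattice translate in \<open>D\<close>, so the factor 1,
  written as the sum of \<open>indicator D (x + l)\<close> over \<open>l\<close>, may be inserted.
  After exchanging sum and integral, the shift by \<open>l\<close> moves the translation from
  \<open>D\<close> to \<open>S\<close> and leaves the periodic \<open>h\<close> unchanged. For
  nonnegative functions the exchange needs no integrability.\<close>

lemma nn_integral_torus_unfold:
  fixes h :: "real ^ 'n \<Rightarrow> ennreal"
  assumes D: "torus_domain D" and S[measurable]: "S \<in> sets borel"
    and h[measurable]: "h \<in> borel_measurable borel"
    and per: "\<And>x l. l \<in> int_vecs \<Longrightarrow> h (x + l) = h x"
  shows "(\<integral>\<^sup>+x. h x * indicator S x \<partial>lborel) =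
    (\<integral>\<^sup>+x. h x * indicator D x * (\<integral>\<^sup>+l. indicator S (x - l) \<partial>count_space int_vecs) \<partial>lborel)"
proof -
  have [measurable]: "D \<in> sets borel"
    using D by (simp add: torus_domain_def)
  note one = nn_integral_count_torus_domain[OF D]
  have "(\<integral>\<^sup>+x. h x * indicator S x \<partial>lborel) =
      (\<integral>\<^sup>+x. (\<integral>\<^sup>+l. h x * indicator S x * indicator D (x + l) \<partial>count_space int_vecs) \<partial>lborel)"
    by (simp add: nn_integral_cmult one)
  also have "\<dots> = (\<integral>\<^sup>+l. (\<integral>\<^sup>+x. h x * indicator S x * indicator D (x + l) \<partial>lborel) \<partial>count_space int_vecs)"
    by (rule nn_integral_count_space_nn_integral) (auto intro: countable_int_vecs)
  also have "\<dots> = (\<integral>\<^sup>+l. (\<integral>\<^sup>+x. h x * indicator S (x - l) * indicator D x \<partial>lborel) \<partial>count_space int_vecs)"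
  proof (rule nn_integral_cong)
    fix l :: "real ^ 'n" assume "l \<in> space (count_space int_vecs)"
    then have l: "l \<in> int_vecs" by simp
    have "(\<integral>\<^sup>+x. h x * indicator S (x - l) * indicator D x \<partial>lborel) =
        (\<integral>\<^sup>+x. h (x + l) * indicator S (x + l - l) * indicator D (x + l) \<partial>lborel)"
      by (rule nn_integral_lborel_translate[symmetric]) measurable
    then show "(\<integral>\<^sup>+x. h x * indicator S x * indicator D (x + l) \<partial>lborel) =
        (\<integral>\<^sup>+x. h x * indicator S (x - l) * indicator D x \<partial>lborel)"
      using l by (simp add: per)
  qed
  also have "\<dots> = (\<integral>\<^sup>+x. (\<integral>\<^sup>+l. h x * indicator S (x - l) * indicator D x \<partial>count_space int_vecs) \<partial>lborel)"
    by (rule nn_integral_count_space_nn_integral[symmetric]) (auto intro: countable_int_vecs)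
  also have "\<dots> = (\<integral>\<^sup>+x. h x * indicator D x * (\<integral>\<^sup>+l. indicator S (x - l) \<partial>count_space int_vecs) \<partial>lborel)"
    by (intro nn_integral_cong, subst nn_integral_cmult[symmetric]) (auto simp: ac_simps)
  finally show ?thesis .
qed

text \<open>This is the unfolding with \<open>D'\<close> in place of \<open>S\<close>: its
  periodisation is constantly 1. The sign in \<open>x - l\<close> is absorbed by the symmetry of the
  lattice.\<close>

lemma nn_integral_torus_domain_cong:
  fixes h :: "real ^ 'n \<Rightarrow> ennreal"
  assumes D: "torus_domain D" and D': "torus_domain D'"
    and h: "h \<in> borel_measurable borel"
    and per: "\<And>x l. l \<in> int_vecs \<Longrightarrow> h (x + l) = h x"
  shows "(\<integral>\<^sup>+x. h x * indicator D' x \<partial>lborel) = (\<integral>\<^sup>+x. h x * indicator D x \<partial>lborel)"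
proof -
  have "(\<integral>\<^sup>+l. indicator D' (x - l) \<partial>count_space int_vecs) = 1" for x :: "real ^ 'n"
  proof -
    have "bij_betw uminus int_vecs (int_vecs :: (real ^ 'n) set)"
      by (rule bij_betwI[of _ _ _ uminus]) (auto intro: int_vecs_uminus)
    from nn_integral_bij_count_space[OF this, of "\<lambda>l. indicator D' (x + l)"]
    show ?thesis
      by (simp add: nn_integral_count_torus_domain[OF D'])
  qed
  moreover have "D' \<in> sets borel"
    using D' by (simp add: torus_domain_def)
  ultimately show ?thesis
    using nn_integral_torus_unfold[OF D _ h per, of D'] by simp
qed

text \<open>All domains are compared with the half-open cube, which lies between the open and the
  closed box. Arbitrary domains are covered because \<open>covolume\<close> chooses an unspecified
  one.\<close>

lemma emeasure_torus_domain:
  fixes D :: "(real ^ 'b) set"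
  assumes "torus_domain D"
  shows "emeasure lborel D = 1"
proof -
  have "emeasure lborel D = emeasure lborel (unit_cube :: (real ^ 'b) set)"
    using nn_integral_torus_domain_cong[OF torus_domain_unit_cube assms, of "\<lambda>_. 1"] assms
    by (simp add: torus_domain_def)
  also have "\<dots> = 1"
  proof (rule antisym)
    have "unit_cube \<subseteq> cbox 0 (1 :: real ^ 'b)"
      by (auto simp: unit_cube_def mem_box_cart less_imp_le)
    then have "emeasure lborel (unit_cube :: (real ^ 'b) set) \<le> emeasure lborel (cbox 0 (1 :: real ^ 'b))"
      by (rule emeasure_mono) simp
    also have "\<dots> = 1"
      by (subst emeasure_lborel_cbox) (auto simp: Basis_vec_def inner_axis intro!: prod.neutral)
    finally show "emeasure lborel (unit_cube :: (real ^ 'b) set) \<le> 1" .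
  next
    have "box 0 (1 :: real ^ 'b) \<subseteq> unit_cube"
      by (auto simp: unit_cube_def mem_box_cart less_imp_le)
    then have "emeasure lborel (box 0 (1 :: real ^ 'b)) \<le> emeasure lborel (unit_cube :: (real ^ 'b) set)"
      by (rule emeasure_mono) simp
    moreover have "emeasure lborel (box 0 (1 :: real ^ 'b)) = 1"
      by (subst emeasure_lborel_box) (auto simp: Basis_vec_def inner_axis intro!: prod.neutral)
    ultimately show "1 \<le> emeasure lborel (unit_cube :: (real ^ 'b) set)"
      by simp
  qed
  finally show ?thesis .
qed

text \<open>The periodisation at \<open>x\<close> counts the lattice vectors \<open>l\<close> with
  \<open>x - l\<close> in \<open>S\<close>. Subtracting them from a fixed one of them injects them
  into the lattice points of \<open>K\<close>, since the difference of two such vectors is a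
  difference of two points of \<open>S\<close>.\<close>

lemma nn_integral_torus_le:
  fixes h :: "real ^ 'n \<Rightarrow> ennreal"
  assumes D: "torus_domain D" and S: "S \<in> sets borel" and h: "h \<in> borel_measurable borel"
    and per: "\<And>x l. l \<in> int_vecs \<Longrightarrow> h (x + l) = h x"
    and K: "bounded K" and SK: "\<And>x y. x \<in> S \<Longrightarrow> y \<in> S \<Longrightarrow> x - y \<in> K"
  shows "(\<integral>\<^sup>+x. h x * indicator S x \<partial>lborel) \<le>
    of_nat (card (int_vecs \<inter> K)) * (\<integral>\<^sup>+x. h x * indicator D x \<partial>lborel)"
proof -
  have bd: "(\<integral>\<^sup>+l. indicator S (x - l) \<partial>count_space int_vecs) \<le> of_nat (card (int_vecs \<inter> K))"
    for x :: "real ^ 'n"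
  proof -
    let ?A = "{l \<in> int_vecs. x - l \<in> S}"
    have A: "finite ?A \<and> card ?A \<le> card (int_vecs \<inter> K)"
    proof (cases "?A = {}")
      case False
      then obtain l0 where l0: "l0 \<in> int_vecs" "x - l0 \<in> S" by blast
      have inj: "inj_on (\<lambda>l. l0 - l) ?A"
        by (auto simp: inj_on_def)
      have sub: "(\<lambda>l. l0 - l) ` ?A \<subseteq> int_vecs \<inter> K"
      proof
        fix y assume "y \<in> (\<lambda>l. l0 - l) ` ?A"
        then obtain l where l: "y = l0 - l" "l \<in> int_vecs" "x - l \<in> S" by blast
        have "(x - l) - (x - l0) \<in> K" using SK l(3) l0(2) .
        then show "y \<in> int_vecs \<inter> K" using l l0 int_vecs_diff by simp
      qed
      show ?thesis
        using inj_on_finite[OF inj sub] card_inj_on_le[OF inj sub] finite_int_vecs_bounded[OF K]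
        by blast
    next
      case True
      then show ?thesis by (metis card.empty finite.emptyI le0)
    qed
    have "(\<integral>\<^sup>+l. indicator S (x - l) \<partial>count_space int_vecs) =
        (\<integral>\<^sup>+l. indicator ?A l \<partial>count_space int_vecs)"
      by (intro nn_integral_cong) (auto simp: indicator_def)
    also have "\<dots> = of_nat (card ?A)"
      using A by (subst nn_integral_indicator) auto
    also have "\<dots> \<le> of_nat (card (int_vecs \<inter> K))"
      using A by (simp add: of_nat_mono)
    finally show ?thesis .
  qed
  have [measurable]: "D \<in> sets borel" "h \<in> borel_measurable borel"
    using D h by (simp_all add: torus_domain_def)
  have "(\<integral>\<^sup>+x. h x * indicator S x \<partial>lborel) =
      (\<integral>\<^sup>+x. h x * indicator D x * (\<integral>\<^sup>+l. indicator S (x - l) \<partial>count_space int_vecs) \<partial>lborel)"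
    by (rule nn_integral_torus_unfold) (use assms in auto)
  also have "\<dots> \<le> (\<integral>\<^sup>+x. of_nat (card (int_vecs \<inter> K)) * (h x * indicator D x) \<partial>lborel)"
  proof (rule nn_integral_mono)
    fix x
    show "h x * indicator D x * (\<integral>\<^sup>+l. indicator S (x - l) \<partial>count_space int_vecs) \<le>
        of_nat (card (int_vecs \<inter> K)) * (h x * indicator D x)"
      using mult_left_mono[OF bd[of x], of "h x * indicator D x"] by (simp add: mult.commute)
  qed
  also have "\<dots> = of_nat (card (int_vecs \<inter> K)) * (\<integral>\<^sup>+x. h x * indicator D x \<partial>lborel)"
    by (rule nn_integral_cmult) measurable
  finally show ?thesis .
qed

section \<open>Orthogonality of the cosines on the torus\<close>

lemma integrable_indicator_bounded:
  fixes f :: "'a::euclidean_space \<Rightarrow> real"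
  assumes S: "S \<in> sets borel" "bounded S" and f: "f \<in> borel_measurable borel"
    and le: "\<And>x. x \<in> S \<Longrightarrow> \<bar>f x\<bar> \<le> B"
  shows "integrable lborel (\<lambda>x. indicator S x * f x)"
  using integrableI_bounded_set_indicator[of S lborel f B] assms emeasure_bounded_finite[of S]
  by (auto simp: less_top)

lemma bounded_unit_cube: "bounded (unit_cube :: (real ^ 'n) set)"
  by (rule bounded_subset[of "cbox 0 1"]) (auto simp: unit_cube_def mem_box_cart less_imp_le)

lemma cos_int_vecs_periodic:
  assumes "y \<in> int_vecs" "l \<in> int_vecs"
  shows "cos (2 * pi * (y \<bullet> (x + l))) = cos (2 * pi * (y \<bullet> x))"
proof -
  obtain k where k: "y \<bullet> l = of_int k"
    using int_vecs_inner[OF assms] by (auto elim: Ints_cases)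
  have "2 * pi * (y \<bullet> (x + l)) = 2 * pi * (y \<bullet> x) + 2 * pi * of_int k"
    by (simp add: inner_add_right k distrib_left)
  then show ?thesis
    by (simp add: cos_add)
qed

lemma integral_cos_unit_cube:
  fixes y :: "real ^ 'n"
  assumes y: "y \<in> int_vecs"
  shows "(LINT x|lborel. indicator unit_cube x * cos (2 * pi * (y \<bullet> x))) = (if y = 0 then 1 else 0)"
proof (cases "y = 0")
  case True
  then show ?thesis
    using emeasure_torus_domain[OF torus_domain_unit_cube] by (simp add: measure_def)
next
  case False
  \<comment> \<open>Translation by \<open>a\<close> shifts the phase by half a period, so the integral equals its negative.\<close>
  define a where "a = (1 / (2 * (y \<bullet> y))) *\<^sub>R y"
  have ya: "y \<bullet> a = 1 / 2"
    using False by (simp add: a_def)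
  let ?c = "\<lambda>x. cos (2 * pi * (y \<bullet> x))"
  \<comment> \<open>The functions 1 + cos and 1 - cos are nonnegative, so the invariance of
    \<open>nn_integral\<close> under a change of the fundamental domain applies to them; comparing s
    = 1 with s = -1 then isolates the cosine.\<close>
  have int: "integrable lborel (\<lambda>x. indicator unit_cube x * (1 + s * ?c x))" if "\<bar>s\<bar> \<le> 1" for s
  proof (rule integrable_indicator_bounded[where B = 2])
    fix x
    have "\<bar>s * ?c x\<bar> \<le> 1 * 1"
      unfolding abs_mult by (rule mult_mono) (use that in auto)
    then show "\<bar>1 + s * ?c x\<bar> \<le> 2" by linarith
  qed (auto intro: bounded_unit_cube)
  have nn: "(\<integral>\<^sup>+x. ennreal (1 + s * ?c x) * indicator unit_cube x \<partial>lborel) =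
      ennreal (LINT x|lborel. indicator unit_cube x * (1 + s * ?c x))" if "\<bar>s\<bar> \<le> 1" for s
  proof -
    have pos: "0 \<le> 1 + s * ?c x" for x
    proof -
      have "\<bar>s * ?c x\<bar> \<le> 1 * 1"
        unfolding abs_mult by (rule mult_mono) (use that in auto)
      then show ?thesis by linarith
    qed
    have "(\<integral>\<^sup>+x. ennreal (1 + s * ?c x) * indicator unit_cube x \<partial>lborel) =
        (\<integral>\<^sup>+x. ennreal (indicator unit_cube x * (1 + s * ?c x)) \<partial>lborel)"
      by (intro nn_integral_cong) (simp add: indicator_def)
    also have "\<dots> = ennreal (LINT x|lborel. indicator unit_cube x * (1 + s * ?c x))"
      by (rule nn_integral_eq_integral[OF int[OF that]]) (intro AE_I2 mult_nonneg_nonneg pos, simp)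
    finally show ?thesis .
  qed
  have "(\<integral>\<^sup>+x. ennreal (1 + ?c x) * indicator unit_cube x \<partial>lborel) =
      (\<integral>\<^sup>+x. ennreal (1 + ?c x) * indicator ((\<lambda>x. x + a) -` unit_cube) x \<partial>lborel)"
    by (rule nn_integral_torus_domain_cong)
      (auto intro!: torus_domain_translate torus_domain_unit_cube simp: cos_int_vecs_periodic[OF y])
  also have "\<dots> = (\<integral>\<^sup>+x. ennreal (1 + ?c (x + a - a)) * indicator unit_cube (x + a) \<partial>lborel)"
    by (intro nn_integral_cong) (auto simp: indicator_def)
  also have "\<dots> = (\<integral>\<^sup>+x. ennreal (1 + ?c (x - a)) * indicator unit_cube x \<partial>lborel)"
    by (rule nn_integral_lborel_translate) measurable
  also have "\<dots> = (\<integral>\<^sup>+x. ennreal (1 + (- 1) * ?c x) * indicator unit_cube x \<partial>lborel)"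
  proof -
    have "?c (x - a) = - ?c x" for x
    proof -
      have "2 * pi * (y \<bullet> (x - a)) = 2 * pi * (y \<bullet> x) - pi"
        by (simp add: inner_diff_right ya algebra_simps)
      then show ?thesis by (simp add: cos_diff)
    qed
    then show ?thesis by simp
  qed
  finally have "ennreal (LINT x|lborel. indicator unit_cube x * (1 + 1 * ?c x)) =
      ennreal (LINT x|lborel. indicator unit_cube x * (1 + (- 1) * ?c x))"
    using nn[of 1] nn[of "- 1"] by simp
  moreover have nonneg: "0 \<le> (LINT x|lborel. indicator unit_cube x * (1 + s * ?c x))" if "\<bar>s\<bar> \<le> 1" for s
  proof (rule integral_nonneg_AE, rule AE_I2)
    fix x
    have "\<bar>s * ?c x\<bar> \<le> 1 * 1"
      unfolding abs_mult by (rule mult_mono) (use that in auto)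
    then show "0 \<le> indicator unit_cube x * (1 + s * ?c x)" by (simp add: indicator_def)
  qed
  ultimately have eq: "(LINT x|lborel. indicator unit_cube x * (1 + 1 * ?c x)) =
      (LINT x|lborel. indicator unit_cube x * (1 + (- 1) * ?c x))"
    using nonneg[of 1] nonneg[of "- 1"] by simp
  have ints: "integrable lborel (\<lambda>x. indicator unit_cube x * ?c x)"
      "integrable lborel (\<lambda>x. indicator (unit_cube :: (real ^ 'n) set) x * (1 :: real) :: real)"
    by (rule integrable_indicator_bounded[where B = 1]; simp add: bounded_unit_cube)+
  have "(LINT x|lborel. indicator unit_cube x * (1 + s * ?c x)) =
      (LINT x|lborel. indicator (unit_cube :: (real ^ 'n) set) x * 1) + s * (LINT x|lborel. indicator unit_cube x * ?c x)" for s
  proof -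
    have "(LINT x|lborel. indicator unit_cube x * (1 + s * ?c x)) =
        (LINT x|lborel. indicator unit_cube x * 1 + s * (indicator unit_cube x * ?c x))"
      by (intro Bochner_Integration.integral_cong) (auto simp: algebra_simps)
    also have "\<dots> = (LINT x|lborel. indicator (unit_cube :: (real ^ 'n) set) x * 1) +
        (LINT x|lborel. s * (indicator unit_cube x * ?c x))"
      by (rule Bochner_Integration.integral_add[OF ints(2) integrable_mult_right[OF ints(1)]])
    finally show ?thesis by simp
  qed
  from this[of 1] this[of "- 1"] eq
  have "(LINT x|lborel. indicator unit_cube x * ?c x) = 0"
    by simp
  then show ?thesis
    using False by simp
qed

text \<open>A single test function suffices: \<open>g\<close>, the sum of the characters exp (2 pi i
  y.x) over \<open>Y\<close>. Its integral over \<open>S\<close> is large by \<open>fourier\<close>,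
  the integral of its square over \<open>S\<close> is at most
  \<open>card (int_vecs \<inter> K) * card Y\<close> by periodicity and orthogonality, and the
  Cauchy-Schwarz inequality on \<open>S\<close> compares the two. The symmetry of \<open>Y\<close>
  makes \<open>g\<close> real, so that only cosines occur.\<close>

lemma bessel_int_vecs:
  fixes S K Y :: "(real ^ 'n) set"
  assumes S: "S \<in> sets borel" "bounded S" and K: "bounded K"
    and SK: "\<And>x y. x \<in> S \<Longrightarrow> y \<in> S \<Longrightarrow> x - y \<in> K"
    and Y: "finite Y" "Y \<subseteq> int_vecs" "\<And>y. y \<in> Y \<Longrightarrow> - y \<in> Y"
    and "0 \<le> \<beta>"
    and fourier: "\<And>y. y \<in> Y \<Longrightarrow>
      \<beta> * measure lborel S \<le> (LINT x|lborel. indicator S x * cos (2 * pi * (y \<bullet> x)))"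
  shows "measure lborel S * \<beta>\<^sup>2 * real (card Y) \<le> real (card (int_vecs \<inter> K))"
proof -
  let ?c = "\<lambda>y x. cos (2 * pi * (y \<bullet> x))"
  define g where "g x = (\<Sum>y\<in>Y. ?c y x)" for x
  define V where "V = measure lborel S"
  define M where "M = real (card (int_vecs \<inter> K))"
  define c where "c = real (card Y)"
  have [measurable]: "g \<in> borel_measurable borel"
    unfolding g_def by measurable
  have g_bound: "\<bar>g x\<bar> \<le> c" for x
  proof -
    have "\<bar>g x\<bar> \<le> (\<Sum>y\<in>Y. \<bar>?c y x\<bar>)"
      unfolding g_def by (rule sum_abs)
    also have "\<dots> \<le> (\<Sum>y\<in>Y. 1)"
      by (rule sum_mono) simp
    finally show ?thesis by (simp add: c_def)
  qed
  have g2_bound: "\<bar>(g x)\<^sup>2\<bar> \<le> c\<^sup>2" for x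
    using g_bound[of x] by (simp add: abs_le_square_iff[symmetric] c_def)
  note int_cos = integrable_indicator_bounded[where f = "?c y" and B = 1 for y]
  have int_g: "integrable lborel (\<lambda>x. indicator A x * g x)"
    and int_g2: "integrable lborel (\<lambda>x. indicator A x * (g x)\<^sup>2)"
    if "A \<in> sets borel" "bounded A" for A
    using that g_bound g2_bound
    by (auto intro: integrable_indicator_bounded[where B = c] integrable_indicator_bounded[where B = "c\<^sup>2"])
  have Q: "(LINT x|lborel. indicator unit_cube x * (g x)\<^sup>2) = c"
  proof -
    define E where "E y x = indicator unit_cube x * ?c y x" for y x :: "real ^ 'n"
    have int_E: "integrable lborel (E y)" for y
      unfolding E_def by (rule int_cos) (auto intro: bounded_unit_cube)
    have "(LINT x|lborel. indicator unit_cube x * (g x)\<^sup>2) =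
        (LINT x|lborel. (\<Sum>y\<in>Y. \<Sum>y'\<in>Y. (E (y - y') x + E (y + y') x) / 2))"
    proof (rule Bochner_Integration.integral_cong[OF refl])
      fix x
      have "(g x)\<^sup>2 = (\<Sum>y\<in>Y. \<Sum>y'\<in>Y. ?c y x * ?c y' x)"
        by (simp add: g_def power2_eq_square sum_product)
      also have "\<dots> = (\<Sum>y\<in>Y. \<Sum>y'\<in>Y. (?c (y - y') x + ?c (y + y') x) / 2)"
        by (simp add: cos_times_cos inner_diff_left inner_add_left algebra_simps)
      finally show "indicator unit_cube x * (g x)\<^sup>2 =
          (\<Sum>y\<in>Y. \<Sum>y'\<in>Y. (E (y - y') x + E (y + y') x) / 2)"
        by (simp add: E_def sum_distrib_left distrib_left)
    qed
    also have "\<dots> = (\<Sum>y\<in>Y. \<Sum>y'\<in>Y. ((LINT x|lborel. E (y - y') x) + (LINT x|lborel. E (y + y') x)) / 2)"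
      using int_E by simp
    \<comment> \<open>The product-to-sum formula gives weight 1/2 to each of y' = y and y' = -y.
      Both occur in \<open>Y\<close> by symmetry; for y = 0 they coincide and the weights add
      up.\<close>
    also have "\<dots> = (\<Sum>y\<in>Y. \<Sum>y'\<in>Y. ((if y' = y then 1 else 0) + (if y' = - y then 1 else 0)) / 2)"
    proof (intro sum.cong refl)
      fix y y' assume "y \<in> Y" "y' \<in> Y"
      then have "y - y' \<in> int_vecs" "y + y' \<in> int_vecs"
        using Y(2) by (auto intro: int_vecs_diff int_vecs_add)
      then show "((LINT x|lborel. E (y - y') x) + (LINT x|lborel. E (y + y') x)) / 2 =
          ((if y' = y then 1 else 0) + (if y' = - y then 1 else 0)) / 2"
        unfolding E_def by (auto simp: integral_cos_unit_cube add_eq_0_iff)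
    qed
    also have "\<dots> = (\<Sum>y\<in>Y. 1)"
      using Y by (intro sum.cong refl) (simp add: sum_divide_distrib[symmetric] sum.distrib sum.delta)
    finally show ?thesis by (simp add: c_def)
  qed
  have S2: "(LINT x|lborel. indicator S x * (g x)\<^sup>2) \<le> M * c"
  proof -
    have nn: "(\<integral>\<^sup>+x. ennreal ((g x)\<^sup>2) * indicator A x \<partial>lborel) =
        ennreal (LINT x|lborel. indicator A x * (g x)\<^sup>2)" if "A \<in> sets borel" "bounded A" for A
      using nn_integral_eq_integral[OF int_g2[OF that]]
      by (simp add: ennreal_mult' ennreal_indicator mult.commute)
    have "(\<integral>\<^sup>+x. ennreal ((g x)\<^sup>2) * indicator S x \<partial>lborel) \<le>
        of_nat (card (int_vecs \<inter> K)) * (\<integral>\<^sup>+x. ennreal ((g x)\<^sup>2) * indicator unit_cube x \<partial>lborel)"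
    proof (rule nn_integral_torus_le[OF torus_domain_unit_cube S(1) _ _ K SK])
      show "ennreal ((g (x + l))\<^sup>2) = ennreal ((g x)\<^sup>2)" if "l \<in> int_vecs" for x l
      proof -
        have "g (x + l) = g x"
          unfolding g_def using Y(2) that by (intro sum.cong refl cos_int_vecs_periodic) auto
        then show ?thesis by simp
      qed
    qed auto
    also have "\<dots> = ennreal (M * c)"
      by (simp add: nn bounded_unit_cube Q M_def c_def ennreal_of_nat_eq_real_of_nat ennreal_mult')
    finally show ?thesis
      by (simp add: nn S M_def c_def)
  qed
  have S1: "\<beta> * V * c \<le> (LINT x|lborel. indicator S x * g x)"
  proof -
    have "\<beta> * V * c = (\<Sum>y\<in>Y. \<beta> * V)"
      by (simp add: c_def)
    also have "\<dots> \<le> (\<Sum>y\<in>Y. LINT x|lborel. indicator S x * ?c y x)"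
      using fourier by (intro sum_mono) (simp add: V_def)
    also have "\<dots> = (LINT x|lborel. (\<Sum>y\<in>Y. indicator S x * ?c y x))"
      using int_cos[OF S] by simp
    finally show ?thesis
      by (simp add: g_def sum_distrib_left)
  qed
  have V0: "0 \<le> V" and c0: "0 \<le> c" and M0: "0 \<le> M"
    by (simp_all add: V_def c_def M_def)
  show ?thesis
  proof (cases "V = 0 \<or> c = 0")
    case True
    then show ?thesis by (auto simp: V_def c_def)
  next
    case False
    then have pos: "0 < V" "0 < c" using V0 c0 by auto
    define I where "I = (LINT x|lborel. indicator S x * g x)"
    \<comment> \<open>\<open>t\<close> is the mean of \<open>g\<close> over \<open>S\<close>; for
      it, nonnegativity of the integral of (g - t)^2 over \<open>S\<close> is the Cauchy-Schwarz
      inequality for \<open>g\<close> and the constant 1.\<close>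
    define t where "t = I / V"
    have fin: "emeasure lborel S < \<infinity>"
      using emeasure_bounded_finite[OF S(2)] .
    have "0 \<le> (LINT x|lborel. indicator S x * (g x - t)\<^sup>2)"
      by (rule integral_nonneg_AE) auto
    also have "\<dots> = (LINT x|lborel. indicator S x * (g x)\<^sup>2 - (2 * t) * (indicator S x * g x) +
        t\<^sup>2 * indicator S x)"
      by (intro Bochner_Integration.integral_cong) (auto simp: algebra_simps power2_diff)
    also have "\<dots> = (LINT x|lborel. indicator S x * (g x)\<^sup>2) - (2 * t) * I + t\<^sup>2 * V"
      using int_g[OF S] int_g2[OF S] fin S
      by (subst Bochner_Integration.integral_add Bochner_Integration.integral_diff,
          auto simp: I_def V_def)+
    also have "\<dots> = (LINT x|lborel. indicator S x * (g x)\<^sup>2) - I\<^sup>2 / V"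
      using pos by (simp add: t_def field_simps power2_eq_square)
    finally have "I\<^sup>2 \<le> V * (LINT x|lborel. indicator S x * (g x)\<^sup>2)"
      using pos by (simp add: field_simps)
    also have "\<dots> \<le> V * (M * c)"
      using S2 pos by (intro mult_left_mono) auto
    finally have "I\<^sup>2 \<le> V * M * c" by simp
    moreover have "(\<beta> * V * c)\<^sup>2 \<le> I\<^sup>2"
      using S1 \<open>0 \<le> \<beta>\<close> V0 c0 by (intro power_mono) (auto simp: I_def)
    ultimately have "(V * \<beta>\<^sup>2 * c) * (V * c) \<le> M * (V * c)"
      by (simp add: power2_eq_square algebra_simps)
    then have "V * \<beta>\<^sup>2 * c \<le> M"
      using pos by (simp add: ac_simps)
    then show ?thesis
      by (simp add: V_def c_def M_def)
  qed
qed

section \<open>Numerical estimates\<close>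

text \<open>A consequence of the functional equation of Gamma. It allows inductions in steps of two,
  in place of Stirling's formula.\<close>

lemma unit_ball_vol_add_2: "unit_ball_vol (real (n + 2)) = 2 * pi / real (n + 2) * unit_ball_vol (real n)"
proof -
  have "pi powr (real (n + 2) / 2) = pi powr (real n / 2) * pi"
    by (simp add: add_divide_distrib powr_add)
  moreover have "Gamma (real (n + 2) / 2 + 1) = (real n / 2 + 1) * Gamma (real n / 2 + 1)"
    using Gamma_plus1[of "real n / 2 + 1"] by (simp add: add_divide_distrib add_ac nonpos_Ints_def)
  ultimately have "unit_ball_vol (real (n + 2)) =
      (pi powr (real n / 2) * pi) / ((real n / 2 + 1) * Gamma (real n / 2 + 1))"
    by (simp only: unit_ball_vol_def)
  also have "\<dots> = 2 * pi / real (n + 2) * unit_ball_vol (real n)"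
  proof -
    have "real n / 2 + 1 = real (n + 2) / 2" by simp
    then show ?thesis
      unfolding unit_ball_vol_def by (simp only: times_divide_times_eq) (simp add: mult_ac)
  qed
  finally show ?thesis .
qed

lemma pi_bounds: "3 < pi" "pi\<^sup>2 < 10"
proof -
  show "3 < pi"
    by (rule pi_gt3)
  have "pi \<le> 63 / 20"
    using pi_approx(2) by simp
  then have "pi\<^sup>2 \<le> (63 / 20)\<^sup>2"
    by (intro power_mono) auto
  then show "pi\<^sup>2 < 10"
    by (simp add: power2_eq_square)
qed

text \<open>The left-hand side is the exponential of the additive constant in the theorem and is
  about 0.036. The right-hand side is what the case n >= 3 of the upper estimate yields, 1/2 *
  (2/5)^2.\<close>

lemma bound_constant_le: "(1 - 1 / (2 * pi)) * exp (- pi) \<le> 2 / 25"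
proof -
  have "5 / 2 \<le> exp (1 :: real)"
    using exp_lower_Taylor_quadratic[of 1] by simp
  then have "(5 / 2) ^ 3 \<le> exp (1 :: real) ^ 3"
    by (intro power_mono) auto
  also have "\<dots> = exp 3"
    by (simp add: exp_of_nat_mult[symmetric])
  also have "\<dots> \<le> exp pi"
    using pi_bounds by simp
  finally have "exp (- pi) \<le> 8 / 125"
    by (simp add: exp_minus field_simps power3_eq_cube)
  moreover have "(1 - 1 / (2 * pi)) * exp (- pi) \<le> 1 * exp (- pi)"
    by (intro mult_right_mono) auto
  ultimately show ?thesis by linarith
qed

lemma two_step_induct [consumes 1, case_names base1 base2 step]:
  assumes "m \<le> n" "P m" "P (Suc m)" "\<And>k. m \<le> k \<Longrightarrow> P k \<Longrightarrow> P (k + 2)"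
  shows "P (n :: nat)"
  using assms(1)
proof (induction n rule: less_induct)
  case (less n)
  consider "n = m" | "n = Suc m" | "m + 2 \<le> n"
    using less.prems by linarith
  then show ?case
  proof cases
    case 3
    then have "P ((n - 2) + 2)"
      by (intro assms(4) less.IH) auto
    moreover have "n - 2 + 2 = n" using 3 by linarith
    ultimately show ?thesis by metis
  qed (use assms in auto)
qed

text \<open>The 8 comes from shrinking the body by 8, the 1/2 from the square of cos (pi / 4). In
  steps of two the sequence \<open>unit_ball_vol n * (n / 8) ^ n\<close> does not decrease from n =
  2 on, but it drops from n = 1 to n = 3; hence the separate case.\<close>

lemma lower_bound_numeric:
  assumes "1 \<le> n"
  shows "(1 - 1 / (2 * pi)) * exp (- pi) \<le> unit_ball_vol (real n) * (real n / 8) ^ n / 2"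
proof -
  have "4 / 25 \<le> unit_ball_vol (real n) * (real n / 8) ^ n"
  proof (cases "n = 1")
    case False
    with assms have "2 \<le> n" by simp
    then show ?thesis
    proof (induction n rule: two_step_induct)
      case base1
      show ?case
        using pi_bounds by (simp add: unit_ball_vol_2 power2_eq_square)
    next
      case base2
      show ?case
        using pi_bounds by (simp add: unit_ball_vol_3 power3_eq_cube)
    next
      case (step k)
      define v where "v = unit_ball_vol (real k)"
      have v: "0 \<le> v" by (simp add: v_def)
      have k: "0 < real k" "2 \<le> real k" using step by auto
      have "3 \<le> (1 + 2 / real k) ^ k"
        using Bernoulli_inequality[of "2 / real k" k] k order_trans[of "- 1" 0 "2 / real k"] by simp
      then have "3 * real k ^ k \<le> (1 + 2 / real k) ^ k * real k ^ k"
        by (intro mult_right_mono) auto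
      also have "\<dots> = real (k + 2) ^ k"
        using k by (simp add: power_mult_distrib[symmetric] field_simps)
      finally have *: "3 * real k ^ k \<le> real (k + 2) ^ k" .
      \<comment> \<open>64 = 8^2 stems from the two additional factors 1/8; for k = 2 the right-hand
        side is 72.\<close>
      have "64 \<le> 2 * 3 * real (k + 2) * 3"
        using k by simp
      also have "\<dots> \<le> 2 * pi * real (k + 2) * 3"
        using pi_bounds by (intro mult_right_mono mult_left_mono) auto
      finally have "64 * real k ^ k \<le> 2 * pi * real (k + 2) * 3 * real k ^ k"
        by (rule mult_right_mono) simp
      also have "\<dots> = 2 * pi * real (k + 2) * (3 * real k ^ k)"
        by simp
      also have "\<dots> \<le> 2 * pi * real (k + 2) * real (k + 2) ^ k"
        using * by (intro mult_left_mono) auto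
      finally have **: "64 * real k ^ k \<le> 2 * pi * real (k + 2) * real (k + 2) ^ k" .
      have "v * (real k / 8) ^ k = v * (64 * real k ^ k) / (64 * 8 ^ k)"
        by (simp add: power_divide)
      also have "\<dots> \<le> v * (2 * pi * real (k + 2) * real (k + 2) ^ k) / (64 * 8 ^ k)"
        using ** v by (intro divide_right_mono mult_left_mono) auto
      also have "\<dots> = unit_ball_vol (real (k + 2)) * (real (k + 2) / 8) ^ (k + 2)"
      proof -
        have "v * (2 * pi * w * w ^ k) / (64 * 8 ^ k) = 2 * pi / w * v * (w / 8) ^ (k + 2)"
          if "0 < w" for w :: real
          using that by (simp add: power_divide power_add power2_eq_square)
        from this[of "real (k + 2)"] show ?thesis
          unfolding unit_ball_vol_add_2 v_def[symmetric] by simp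
      qed
      finally show ?case
        using step by (simp add: v_def)
    qed
  qed simp
  then show ?thesis
    using bound_constant_le by simp
qed

text \<open>Bernoulli's inequality with the quadratic term kept. At x = 2 / k it gives (k + 2)^k >=
  4 * k^k for k >= 3, whereas the linear term gives the factor 3 only, which is too small for the
  induction step of the next estimate.\<close>

lemma binomial_quadratic_lower:
  fixes x :: real
  assumes "0 \<le> x"
  shows "1 + real n * x + real n * (real n - 1) / 2 * x\<^sup>2 \<le> (1 + x) ^ n"
proof (induction n)
  case (Suc n)
  have "1 + real (Suc n) * x + real (Suc n) * (real (Suc n) - 1) / 2 * x\<^sup>2 \<le>
      (1 + x) * (1 + real n * x + real n * (real n - 1) / 2 * x\<^sup>2)"
  proof -
    have "0 \<le> real n * (real n - 1)"
      by (cases n) auto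
    then have "0 \<le> real n * (real n - 1) / 2 * x\<^sup>2 * x"
      using assms by simp
    then show ?thesis
      by (simp add: algebra_simps power2_eq_square add_divide_distrib diff_divide_distrib)
  qed
  also have "\<dots> \<le> (1 + x) * (1 + x) ^ n"
    using Suc assms by (intro mult_left_mono) auto
  finally show ?case by simp
qed simp

text \<open>The induction runs on the square of the right-hand side, in which sqrt n occurs only as
  n; the 1/4 there is (1/2)^2.\<close>

lemma upper_bound_numeric_aux:
  assumes "3 \<le> n"
  shows "1 / 2 \<le> unit_ball_vol (real n) * (3 / 10 * sqrt (real n)) ^ n"
proof -
  have "1 / 4 \<le> (unit_ball_vol (real n))\<^sup>2 * (9 / 100 * real n) ^ n"
    using assms
  proof (induction n rule: two_step_induct)
    case base1
    have "3\<^sup>2 \<le> pi\<^sup>2"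
      using pi_bounds by (intro power_mono) auto
    then show ?case
      by (simp add: unit_ball_vol_3 power3_eq_cube power_mult_distrib power_divide)
  next
    case base2
    have "3 ^ 4 \<le> pi ^ 4"
      using pi_bounds by (intro power_mono) auto
    then show ?case
      using pi_bounds by (simp add: unit_ball_vol_4 power_divide power_mult[symmetric])
  next
    case (step k)
    define v where "v = unit_ball_vol (real k)"
    have k: "0 < real k" "3 \<le> real k" using step by auto
    have "4 \<le> 1 + real k * (2 / real k) + real k * (real k - 1) / 2 * (2 / real k)\<^sup>2"
      using k by (simp add: field_simps power2_eq_square)
    also have "\<dots> \<le> (1 + 2 / real k) ^ k"
      using k by (intro binomial_quadratic_lower) auto
    finally have "4 * real k ^ k \<le> (1 + 2 / real k) ^ k * real k ^ k"
      by (intro mult_right_mono) auto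
    also have "\<dots> = real (k + 2) ^ k"
      using k by (simp add: power_mult_distrib[symmetric] field_simps)
    finally have *: "4 * real k ^ k \<le> real (k + 2) ^ k" .
    have "3\<^sup>2 \<le> pi\<^sup>2"
      using pi_bounds by (intro power_mono) auto
    then have "1 * real k ^ k \<le> (4 * pi\<^sup>2 * (9 / 100)\<^sup>2 * 4) * real k ^ k"
      by (intro mult_right_mono) (auto simp: power2_eq_square)
    also have "\<dots> = 4 * pi\<^sup>2 * (9 / 100)\<^sup>2 * (4 * real k ^ k)"
      by simp
    also have "\<dots> \<le> 4 * pi\<^sup>2 * (9 / 100)\<^sup>2 * real (k + 2) ^ k"
      using * by (intro mult_left_mono) auto
    finally have **: "real k ^ k \<le> 4 * pi\<^sup>2 * (9 / 100)\<^sup>2 * real (k + 2) ^ k" by simp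
    have "v\<^sup>2 * (9 / 100 * real k) ^ k = v\<^sup>2 * (9 / 100) ^ k * real k ^ k"
      by (simp only: power_mult_distrib mult.assoc)
    also have "\<dots> \<le> v\<^sup>2 * (9 / 100) ^ k * (4 * pi\<^sup>2 * (9 / 100)\<^sup>2 * real (k + 2) ^ k)"
      using ** by (intro mult_left_mono) auto
    also have "\<dots> = (unit_ball_vol (real (k + 2)))\<^sup>2 * (9 / 100 * real (k + 2)) ^ (k + 2)"
    proof -
      have "v\<^sup>2 * (9 / 100) ^ k * (4 * pi\<^sup>2 * (9 / 100)\<^sup>2 * w ^ k) =
          (2 * pi / w * v)\<^sup>2 * (9 / 100 * w) ^ (k + 2)" if "0 < w" for w :: real
      proof -
        have "(9 / 100 * w) ^ (k + 2) = (9 / 100) ^ k * w ^ k * ((9 / 100)\<^sup>2 * w\<^sup>2)"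
          by (simp only: power_add power_mult_distrib)
        moreover have "(2 * pi / w * v)\<^sup>2 * w\<^sup>2 = 4 * pi\<^sup>2 * v\<^sup>2"
          using that by (simp add: power2_eq_square)
        ultimately show ?thesis
          by (simp add: ac_simps)
      qed
      from this[of "real (k + 2)"] show ?thesis
        unfolding unit_ball_vol_add_2 v_def[symmetric] by simp
    qed
    finally show ?case
      using step by (simp add: v_def)
  qed
  also have "\<dots> = (unit_ball_vol (real n) * (3 / 10 * sqrt (real n)) ^ n)\<^sup>2"
  proof -
    have "(3 / 10 * sqrt (real n))\<^sup>2 = 9 / 100 * real n"
      by (simp add: power_mult_distrib power_divide)
    then have "(9 / 100 * real n) ^ n = ((3 / 10 * sqrt (real n)) ^ n)\<^sup>2"
      by (metis power_mult mult.commute)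
    then show ?thesis
      by (simp only: power_mult_distrib)
  qed
  finally have "(1 / 2)\<^sup>2 \<le> (unit_ball_vol (real n) * (3 / 10 * sqrt (real n)) ^ n)\<^sup>2"
    by (simp add: power2_eq_square)
  then show ?thesis
    by (rule power2_le_imp_le) simp
qed

text \<open>The radius \<open>s\<close> balances the volume factor, which wants it large, against
  the Fourier factor, which wants it small. From n = 3 on, s = 3/10 works. For this radius the
  Fourier factor would be negative at n = 1 and too small at n = 2, so these two cases take smaller
  radii.\<close>

lemma upper_bound_numeric:
  assumes "1 \<le> n"
  obtains s :: real where "0 < s" "s \<le> 1 / 2" "0 \<le> 1 - 2 * pi\<^sup>2 * s\<^sup>2 / real n"
    "(1 - 1 / (2 * pi)) * exp (- pi) \<le>
      unit_ball_vol (real n) * (s * sqrt (real n)) ^ n * (1 - 2 * pi\<^sup>2 * s\<^sup>2 / real n)\<^sup>2"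
proof -
  \<comment> \<open>Rational lower bounds \<open>a\<close> for the volume factor and
    \<open>b\<close> for the Fourier factor reduce every case to
    \<open>2 / 25 \<le> a * b\<^sup>2\<close>.\<close>
  have *: "0 < s \<and> s \<le> 1 / 2 \<and> 0 \<le> 1 - 2 * pi\<^sup>2 * s\<^sup>2 / real n \<and>
      (1 - 1 / (2 * pi)) * exp (- pi) \<le>
        unit_ball_vol (real n) * (s * sqrt (real n)) ^ n * (1 - 2 * pi\<^sup>2 * s\<^sup>2 / real n)\<^sup>2"
    if "0 < s" "s \<le> 1 / 2" and b: "0 \<le> b" "b \<le> 1 - 2 * pi\<^sup>2 * s\<^sup>2 / real n"
      and a: "0 \<le> a" "a \<le> unit_ball_vol (real n) * (s * sqrt (real n)) ^ n" "2 / 25 \<le> a * b\<^sup>2"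
    for s b a
  proof -
    have "a * b\<^sup>2 \<le> unit_ball_vol (real n) * (s * sqrt (real n)) ^ n * (1 - 2 * pi\<^sup>2 * s\<^sup>2 / real n)\<^sup>2"
      using that by (intro mult_mono power_mono) auto
    then show ?thesis
      using that bound_constant_le by linarith
  qed
  consider "n = 1" | "n = 2" | "3 \<le> n"
    using assms by linarith
  then show thesis
  proof cases
    case 1
    then show thesis
      using *[of "1 / 8" "2 / 3" "1 / 4"] pi_bounds that[of "1 / 8"] by (simp add: power2_eq_square)
  next
    case 2
    then show thesis
      using *[of "1 / 5" "3 / 5" "6 / 25"] pi_bounds that[of "1 / 5"]
      by (simp add: power2_eq_square unit_ball_vol_2)
  next
    case 3
    have "2 * pi\<^sup>2 * (3 / 10)\<^sup>2 / real n \<le> 2 * 10 * (3 / 10)\<^sup>2 / 3"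
      using 3 pi_bounds by (intro frac_le mult_right_mono) auto
    then have "2 / 5 \<le> 1 - 2 * pi\<^sup>2 * (3 / 10)\<^sup>2 / real n"
      by (simp add: power2_eq_square)
    then show thesis
      using upper_bound_numeric_aux[OF 3] *[of "3 / 10" "2 / 5" "1 / 2"] that[of "3 / 10"]
      by (simp add: power2_eq_square)
  qed
qed

section \<open>Linear images and second moments of balls\<close>

text \<open>The linear change of variables is formulated for vector-valued integrands, hence the
  detour through \<open>real ^ 1\<close>.\<close>

lemma lborel_integral_linear_image:
  fixes A :: "real ^ 'n :: {finite, wellorder} ^ 'n :: _"
    and f :: "real ^ 'n :: _ \<Rightarrow> real"
  assumes det: "det A \<noteq> 0" and T: "compact T" and f: "continuous_on UNIV f"
  shows "(LINT x|lborel. indicator ((*v) A ` T) x * f x) =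
    \<bar>det A\<bar> * (LINT x|lborel. indicator T x * f (A *v x))"
proof -
  define F :: "real ^ 'n::_ \<Rightarrow> real ^ 1" where "F x = vec (f x)" for x
  have cF: "continuous_on UNIV F"
    unfolding F_def vec_def by (intro continuous_intros f)
  have cA: "continuous_on UNIV ((*v) A)"
    by (simp add: linear_continuous_on matrix_vector_mul_bounded_linear)
  have lin: "linear ((*v) A)" by simp
  have AT: "compact ((*v) A ` T)"
    using T by (intro compact_continuous_image continuous_on_subset[OF cA]) auto
  have abs_int: "g absolutely_integrable_on U" if "compact U" "continuous_on UNIV g"
    for U :: "(real ^ 'n::_) set" and g :: "real ^ 'n::_ \<Rightarrow> real ^ 1"
  proof -
    have "integrable lborel (\<lambda>x. indicator U x *\<^sub>R g x)"
      using that by (intro borel_integrable_compact) (auto intro: continuous_on_subset)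
    then show ?thesis
      unfolding set_integrable_def
      by (intro integrable_completion[THEN iffD2] borel_measurable_integrable)
  qed
  have real: "(LINT x|lborel. indicator U x * g x) = integral U g"
    if "compact U" "continuous_on UNIV g" for U :: "(real ^ 'n::_) set" and g :: "real ^ 'n::_ \<Rightarrow> real"
  proof -
    have "set_integrable lborel U g"
      using that unfolding set_integrable_def
      by (intro borel_integrable_compact) (auto intro: continuous_on_subset)
    from set_borel_integral_eq_integral(2)[OF this] show ?thesis
      by (simp add: set_lebesgue_integral_def)
  qed
  have comp: "integral U (\<lambda>x. g x $ 1) = integral U g $ 1"
    if "compact U" "continuous_on UNIV g" for U :: "(real ^ 'n::_) set" and g :: "real ^ 'n::_ \<Rightarrow> real ^ 1"
    using abs_int[OF that] by (simp add: integral_component_eq_cart set_lebesgue_integral_eq_integral(1))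
  have "integral ((*v) A ` T) F = \<bar>det A\<bar> *\<^sub>R integral T (F \<circ> (*v) A)"
    using integral_change_of_variables_linear[OF lin, where f = F and S = T] abs_int[OF AT cF] by simp
  moreover have "integral ((*v) A ` T) f = integral ((*v) A ` T) F $ 1"
    using comp[OF AT cF] by (simp add: F_def)
  moreover have "integral T (\<lambda>x. f (A *v x)) = integral T (F \<circ> (*v) A) $ 1"
  proof -
    have "continuous_on UNIV (F \<circ> (*v) A)"
      by (rule continuous_on_compose[OF cA]) (rule continuous_on_subset[OF cF], simp)
    from comp[OF T this] show ?thesis by (simp add: F_def)
  qed
  moreover have "continuous_on UNIV (\<lambda>x. f (A *v x))"
    by (rule continuous_on_compose2[OF f cA]) simp
  ultimately show ?thesis
    using real[OF AT f] real[OF T] by simp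
qed

lemma measure_lborel_linear_image:
  fixes A :: "real ^ 'n :: {finite, wellorder} ^ 'n :: _"
  assumes det: "det A \<noteq> 0" and T: "compact T"
  shows "measure lborel ((*v) A ` T) = \<bar>det A\<bar> * measure lborel T"
  using lborel_integral_linear_image[OF assms, of "\<lambda>_. 1"] by simp

text \<open>By rotation invariance all unit directions have the same second moment. Over an
  orthonormal basis these moments add up to the integral of |x|^2, which is at most s^2 times the
  volume. The exact factor would be 1 / (n + 2).\<close>

lemma ball_second_moment:
  fixes v :: "real ^ 'n :: {finite, wellorder}"
  shows "(LINT x|lborel. indicator (cball 0 s) x * (v \<bullet> x)\<^sup>2) \<le>
    (norm v)\<^sup>2 * s\<^sup>2 / real CARD('n) * measure lborel (cball 0 s :: (real ^ 'n::_) set)"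
proof -
  let ?B = "cball 0 s :: (real ^ 'n::_) set"
  define J where "J v = (LINT x|lborel. indicator ?B x * (v \<bullet> x)\<^sup>2)" for v :: "real ^ 'n::_"
  have int: "integrable lborel (\<lambda>x. indicator ?B x * g x)" if "continuous_on UNIV g" for g :: "_ \<Rightarrow> real"
    using borel_integrable_compact[of ?B g] continuous_on_subset[OF that] by simp
  have rot: "J (axis k 1) = J e" if e: "norm e = 1" for e k
  proof -
    obtain Q where Q: "orthogonal_matrix Q" "Q *v axis k 1 = e"
      using orthogonal_matrix_exists_basis[OF e] by metis
    have det: "\<bar>det Q\<bar> = 1"
      using det_orthogonal_matrix[OF Q(1)] by auto
    have orth: "orthogonal_transformation ((*v) Q)"
      using Q(1) by (simp add: orthogonal_transformation_matrix)
    have "(*v) Q ` ?B = ?B"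
      using image_orthogonal_transformation_cball[OF orth, of 0 s] by simp
    then have "J e = (LINT x|lborel. indicator ((*v) Q ` ?B) x * (e \<bullet> x)\<^sup>2)"
      by (simp add: J_def)
    also have "\<dots> = (LINT x|lborel. indicator ?B x * (e \<bullet> (Q *v x))\<^sup>2)"
      using det by (subst lborel_integral_linear_image) (auto intro!: continuous_intros)
    also have "\<dots> = J (axis k 1)"
      using orth unfolding Q(2)[symmetric] J_def by (simp add: orthogonal_transformation_def)
    finally show ?thesis ..
  qed
  have unit: "real CARD('n) * J e \<le> s\<^sup>2 * measure lborel ?B" if "norm e = 1" for e
  proof -
    have "real CARD('n) * J e = (\<Sum>k\<in>UNIV. J (axis k 1))"
      using rot[OF that] by simp
    also have "\<dots> = (LINT x|lborel. (\<Sum>k\<in>UNIV. indicator ?B x * (axis k 1 \<bullet> x)\<^sup>2))"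
      unfolding J_def by (rule Bochner_Integration.integral_sum[symmetric], rule int) (intro continuous_intros)
    also have "\<dots> = (LINT x|lborel. indicator ?B x * (norm x)\<^sup>2)"
    proof (intro Bochner_Integration.integral_cong refl)
      fix x :: "real ^ 'n::_"
      have "(\<Sum>k\<in>UNIV. (axis k 1 \<bullet> x)\<^sup>2) = (norm x)\<^sup>2"
        unfolding power2_norm_eq_inner inner_vec_def[of x x] by (simp add: inner_axis' power2_eq_square)
      then show "(\<Sum>k\<in>UNIV. indicator ?B x * (axis k 1 \<bullet> x)\<^sup>2) = indicator ?B x * (norm x)\<^sup>2"
        by (simp add: sum_distrib_left[symmetric])
    qed
    also have "\<dots> \<le> (LINT x|lborel. indicator ?B x * s\<^sup>2)"
    proof (rule integral_mono)
      fix x :: "real ^ 'n::_"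
      show "indicator ?B x * (norm x)\<^sup>2 \<le> indicator ?B x * s\<^sup>2"
        by (auto simp: indicator_def intro: power_mono)
    qed (intro int continuous_intros)+
    finally show ?thesis by (simp add: mult.commute)
  qed
  show ?thesis
  proof (cases "v = 0")
    case False
    have "J v = (norm v)\<^sup>2 * J (v /\<^sub>R norm v)"
    proof -
      have "J v = (LINT x|lborel. (norm v)\<^sup>2 * (indicator ?B x * ((v /\<^sub>R norm v) \<bullet> x)\<^sup>2))"
        unfolding J_def using False
        by (intro Bochner_Integration.integral_cong refl) (simp add: power_mult_distrib power_divide divide_simps)
      then show ?thesis by (simp only: J_def integral_mult_right_zero)
    qed
    moreover have "real CARD('n) * J (v /\<^sub>R norm v) \<le> s\<^sup>2 * measure lborel ?B"
      using False by (intro unit) simp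
    then have "J (v /\<^sub>R norm v) \<le> s\<^sup>2 / real CARD('n) * measure lborel ?B"
      by (simp add: field_simps)
    ultimately have "J v \<le> (norm v)\<^sup>2 * (s\<^sup>2 / real CARD('n) * measure lborel ?B)"
      by (simp only: mult_left_mono zero_le_power2)
    then show ?thesis by (simp add: J_def)
  qed simp
qed

lemma cos_ge_quadratic: "1 - t\<^sup>2 / 2 \<le> cos (t :: real)"
proof -
  have "(sin (t / 2))\<^sup>2 \<le> (t / 2)\<^sup>2"
    using abs_sin_x_le_abs_x[of "t / 2"] by (simp only: abs_le_square_iff)
  moreover have "cos t = 1 - 2 * (sin (t / 2))\<^sup>2"
    using cos_double_sin[of "t / 2"] by simp
  ultimately show ?thesis
    by (simp add: power_divide)
qed

text \<open>The inequality cos t >= 1 - t^2 / 2 is integrated at t = 2 pi v.x. Averaging over the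
  ball gains the factor 1 / n over the pointwise estimate, so the bound can be positive for radii
  beyond 1/4.\<close>

lemma ball_fourier_lower:
  fixes v :: "real ^ 'n :: {finite, wellorder}"
  assumes v: "norm v \<le> 1"
  shows "(1 - 2 * pi\<^sup>2 * s\<^sup>2 / real CARD('n)) * measure lborel (cball 0 s :: (real ^ 'n::_) set) \<le>
    (LINT x|lborel. indicator (cball 0 s) x * cos (2 * pi * (v \<bullet> x)))"
proof -
  let ?B = "cball 0 s :: (real ^ 'n::_) set"
  have int: "integrable lborel (\<lambda>x. indicator ?B x * g x)" if "continuous_on UNIV g" for g :: "_ \<Rightarrow> real"
    using borel_integrable_compact[of ?B g] continuous_on_subset[OF that] by simp
  define m where "m = measure lborel ?B"
  have m: "0 \<le> m" by (simp add: m_def)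
  have "(LINT x|lborel. indicator ?B x * (v \<bullet> x)\<^sup>2) \<le> (norm v)\<^sup>2 * s\<^sup>2 / real CARD('n) * m"
    unfolding m_def by (rule ball_second_moment)
  also have "\<dots> \<le> 1 * s\<^sup>2 / real CARD('n) * m"
    using v m by (intro mult_right_mono divide_right_mono) (auto simp: power_le_one)
  finally have mom: "(LINT x|lborel. indicator ?B x * (v \<bullet> x)\<^sup>2) \<le> s\<^sup>2 / real CARD('n) * m"
    by simp
  have "(1 - 2 * pi\<^sup>2 * s\<^sup>2 / real CARD('n)) * m = m - 2 * pi\<^sup>2 * (s\<^sup>2 / real CARD('n) * m)"
    by (simp add: algebra_simps)
  also have "\<dots> \<le> m - 2 * pi\<^sup>2 * (LINT x|lborel. indicator ?B x * (v \<bullet> x)\<^sup>2)"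
    using mom by (intro diff_left_mono mult_left_mono) auto
  also have "\<dots> = (LINT x|lborel. indicator ?B x * 1) -
      (LINT x|lborel. 2 * pi\<^sup>2 * (indicator ?B x * (v \<bullet> x)\<^sup>2))"
    by (simp add: m_def)
  also have "\<dots> = (LINT x|lborel. indicator ?B x * 1 - 2 * pi\<^sup>2 * (indicator ?B x * (v \<bullet> x)\<^sup>2))"
    by (rule Bochner_Integration.integral_diff[symmetric])
      (intro int integrable_mult_right continuous_intros)+
  also have "\<dots> \<le> (LINT x|lborel. indicator ?B x * cos (2 * pi * (v \<bullet> x)))"
  proof (rule integral_mono)
    fix x
    have "1 - 2 * pi\<^sup>2 * (v \<bullet> x)\<^sup>2 \<le> cos (2 * pi * (v \<bullet> x))"
      using cos_ge_quadratic[of "2 * pi * (v \<bullet> x)"] by (simp add: power_mult_distrib)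
    then show "indicator ?B x * 1 - 2 * pi\<^sup>2 * (indicator ?B x * (v \<bullet> x)\<^sup>2) \<le>
        indicator ?B x * cos (2 * pi * (v \<bullet> x))"
      by (simp add: indicator_def)
  qed (intro int Bochner_Integration.integrable_diff integrable_mult_right continuous_intros)+
  finally show ?thesis by (simp add: m_def)
qed

section \<open>The ellipsoid of John\<close>

text \<open>
  The factors of a stretching along one axis that keeps the part \<open>\<bar>e \<bullet> y\<bar> \<le> h\<close> of the unit ball inside
  the unit ball and yet increases volumes; it exists because \<open>h < 1 / sqrt n\<close>.
\<close>

lemma john_scaling:
  fixes h :: real
  assumes h: "0 \<le> h" "real n * h\<^sup>2 < 1" and n: "1 \<le> n"
  obtains \<alpha> \<beta> :: real where "0 \<le> \<beta>" "\<beta> \<le> \<alpha>" "\<alpha>\<^sup>2 * h\<^sup>2 + \<beta>\<^sup>2 * (1 - h\<^sup>2) \<le> 1" "1 < \<alpha> * \<beta> ^ (n - 1)"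
proof -
  have "1 * h\<^sup>2 \<le> real n * h\<^sup>2"
    by (rule mult_right_mono) (use n in auto)
  then have h1: "h\<^sup>2 < 1" using h by linarith
  \<comment> \<open>Let the squared factors be 1 + \<eta> and 1 - r. The constraint holds with
    equality for r = \<eta> * h^2 / (1 - h^2), and then (n - 1) * r = q * \<eta>. So
    \<open>q\<close> is the first-order ratio of volume lost to volume gained, and
    \<open>q < 1\<close> amounts to \<open>real n * h\<^sup>2 < 1\<close>.\<close>
  define q where "q = (real n - 1) * h\<^sup>2 / (1 - h\<^sup>2)"
  have q: "0 \<le> q" "q < 1"
    using h h1 n \<open>1 * h\<^sup>2 \<le> real n * h\<^sup>2\<close> by (simp_all add: q_def divide_simps) (simp_all add: algebra_simps)
  \<comment> \<open>The squared volume factor is at least 1 + \<eta> * (1 - q - \<eta> * q), and the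
    division by 2 leaves room for the second-order term. The factor 1 - h^2 clears the denominator
    of \<open>r\<close>.\<close>
  define \<eta> where "\<eta> = (1 - q) * (1 - h\<^sup>2) / 2"
  have \<eta>: "0 < \<eta>" "\<eta> < 1 - q"
  proof -
    show "0 < \<eta>" using q h1 by (simp add: \<eta>_def)
    have "(1 - q) * (1 - h\<^sup>2) \<le> (1 - q) * 1"
      using q by (intro mult_left_mono) auto
    then have "2 * \<eta> \<le> 1 - q" by (simp add: \<eta>_def)
    then show "\<eta> < 1 - q" using q by linarith
  qed
  define r where "r = (1 - q) * h\<^sup>2 / 2"
  have r: "0 \<le> r" "r \<le> 1"
  proof -
    have "(1 - q) * h\<^sup>2 \<le> 1 * 1"
      using q h1 by (intro mult_mono) auto
    then show "r \<le> 1" by (simp add: r_def)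
    show "0 \<le> r" using q by (simp add: r_def)
  qed
  have nr: "real (n - 1) * r = \<eta> * q"
  proof -
    have "q * (1 - h\<^sup>2) = (real n - 1) * h\<^sup>2"
      using h1 by (simp add: q_def)
    then have "\<eta> * q = (1 - q) / 2 * ((real n - 1) * h\<^sup>2)"
      unfolding \<eta>_def by (metis (no_types) mult.assoc mult.commute times_divide_eq_left)
    then show ?thesis
      using n by (simp add: r_def of_nat_diff)
  qed
  define \<alpha> where "\<alpha> = sqrt (1 + \<eta>)"
  define \<beta> where "\<beta> = sqrt (1 - r)"
  have sq: "\<alpha>\<^sup>2 = 1 + \<eta>" "\<beta>\<^sup>2 = 1 - r"
    using \<eta> r by (simp_all add: \<alpha>_def \<beta>_def)
  show thesis
  proof (rule that[of \<beta> \<alpha>])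
    show "0 \<le> \<beta>" using r by (simp add: \<beta>_def)
    show "\<beta> \<le> \<alpha>" using r \<eta> by (simp add: \<alpha>_def \<beta>_def)
    have "\<eta> * h\<^sup>2 = r * (1 - h\<^sup>2)"
      by (simp add: \<eta>_def r_def)
    then show "\<alpha>\<^sup>2 * h\<^sup>2 + \<beta>\<^sup>2 * (1 - h\<^sup>2) \<le> 1"
      unfolding sq by (simp add: algebra_simps)
    have "0 < \<eta> * (1 - q - \<eta> * q)"
    proof (rule mult_pos_pos[OF \<eta>(1)])
      have "\<eta> * q \<le> \<eta> * 1"
        using q \<eta> by (intro mult_left_mono) auto
      then show "0 < 1 - q - \<eta> * q" using \<eta> by linarith
    qed
    then have "1 < (1 + \<eta>) * (1 - \<eta> * q)"
      by (simp add: algebra_simps)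
    also have "\<dots> \<le> (1 + \<eta>) * (1 - r) ^ (n - 1)"
      using Bernoulli_inequality[of "- r" "n - 1"] r \<eta> nr by (intro mult_left_mono) auto
    also have "\<dots> = (\<alpha> * \<beta> ^ (n - 1))\<^sup>2"
      unfolding power_mult_distrib sq(1) by (metis power_mult mult.commute sq(2))
    finally have "1\<^sup>2 < (\<alpha> * \<beta> ^ (n - 1))\<^sup>2" by simp
    moreover have "0 \<le> \<alpha> * \<beta> ^ (n - 1)"
      using r \<eta> by (simp add: \<alpha>_def \<beta>_def)
    ultimately show "1 < \<alpha> * \<beta> ^ (n - 1)"
      by (rule power2_less_imp_less)
  qed
qed

text \<open>\<open>Q\<close> rotates a coordinate axis to \<open>e\<close>, and \<open>D\<close>
  scales the coordinates. A final rotation back by \<open>Q\<close> is omitted, since it changes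
  neither norms nor \<open>\<bar>det W\<bar>\<close>.\<close>

lemma stretch_matrix:
  fixes e :: "real ^ 'n" and \<alpha> \<beta> :: real
  assumes e: "norm e = 1"
  obtains W :: "real ^ 'n ^ 'n" where "\<bar>det W\<bar> = \<bar>\<alpha> * \<beta> ^ (CARD('n) - 1)\<bar>"
    "\<And>y. (norm (W *v y))\<^sup>2 = \<alpha>\<^sup>2 * (e \<bullet> y)\<^sup>2 + \<beta>\<^sup>2 * ((norm y)\<^sup>2 - (e \<bullet> y)\<^sup>2)"
proof -
  obtain k :: 'n where True by simp
  obtain Q where Q: "orthogonal_matrix Q" "Q *v axis k 1 = e"
    using orthogonal_matrix_exists_basis[OF e] by metis
  define D :: "real ^ 'n ^ 'n" where "D = (\<chi> i j. if i = j then (if i = k then \<alpha> else \<beta>) else 0)"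
  have D: "D *v x = (\<chi> i. (if i = k then \<alpha> else \<beta>) * x $ i)" for x
    by (simp add: D_def matrix_vector_mult_def vec_eq_iff if_distrib[of "\<lambda>a. a * _"] cong: if_cong)
  have detD: "det D = \<alpha> * \<beta> ^ (CARD('n) - 1)"
  proof -
    have "det D = (\<Prod>i\<in>UNIV. D $ i $ i)"
      by (rule det_diagonal) (simp add: D_def)
    also have "\<dots> = (\<Prod>i\<in>UNIV. if i = k then \<alpha> else \<beta>)"
      by (simp add: D_def)
    also have "\<dots> = \<alpha> * (\<Prod>i\<in>UNIV - {k}. if i = k then \<alpha> else \<beta>)"
      by (subst prod.remove[of _ k]) auto
    also have "(\<Prod>i\<in>UNIV - {k}. if i = k then \<alpha> else \<beta>) = (\<Prod>i\<in>UNIV - {k}. \<beta>)"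
      by (rule prod.cong) auto
    finally show ?thesis by simp
  qed
  show thesis
  proof (rule that[of "D ** transpose Q"])
    have dd: "orthogonal_matrix (transpose Q)"
      using Q(1) by (simp add: orthogonal_matrix_transpose)
    show "(norm ((D ** transpose Q) *v y))\<^sup>2 = \<alpha>\<^sup>2 * (e \<bullet> y)\<^sup>2 + \<beta>\<^sup>2 * ((norm y)\<^sup>2 - (e \<bullet> y)\<^sup>2)" for y
    proof -
      define z where "z = transpose Q *v y"
      have nz: "(norm y)\<^sup>2 = (\<Sum>i\<in>UNIV. (z $ i)\<^sup>2)"
      proof -
        have "norm z = norm y"
          unfolding z_def
          by (rule orthogonal_transformation_norm)
            (simp only: orthogonal_transformation_matrix matrix_vector_mul_linear
              matrix_of_matrix_vector_mul dd simp_thms)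
        then have "(norm y)\<^sup>2 = z \<bullet> z"
          by (simp add: power2_norm_eq_inner[symmetric])
        then show ?thesis
          by (simp add: inner_vec_def power2_eq_square)
      qed
      have zk: "z $ k = e \<bullet> y"
      proof -
        have "z $ k = axis k 1 \<bullet> (transpose Q *v y)" by (simp add: z_def inner_axis')
        also have "\<dots> = (Q *v axis k 1) \<bullet> y"
          by (metis dot_lmul_matrix inner_commute transpose_matrix_vector vector_transpose_matrix transpose_transpose)
        finally show ?thesis using Q(2) by simp
      qed
      have "(norm ((D ** transpose Q) *v y))\<^sup>2 = (norm (D *v z))\<^sup>2"
        by (simp only: z_def matrix_vector_mul_assoc)
      also have "\<dots> = (\<Sum>i\<in>UNIV. ((if i = k then \<alpha> else \<beta>) * z $ i)\<^sup>2)"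
        unfolding D power2_norm_eq_inner inner_vec_def by (simp add: power2_eq_square)
      also have "\<dots> = \<alpha>\<^sup>2 * (z $ k)\<^sup>2 + (\<Sum>i\<in>UNIV - {k}. \<beta>\<^sup>2 * (z $ i)\<^sup>2)"
        by (subst sum.remove[of _ k]) (auto simp: power_mult_distrib intro!: sum.cong)
      also have "\<dots> = \<alpha>\<^sup>2 * (z $ k)\<^sup>2 + \<beta>\<^sup>2 * ((\<Sum>i\<in>UNIV. (z $ i)\<^sup>2) - (z $ k)\<^sup>2)"
        by (subst (2) sum.remove[of _ k]) (auto simp: sum_distrib_left)
      finally show ?thesis
        by (simp add: nz zk)
    qed
    have "\<bar>det Q\<bar> = 1"
      using det_orthogonal_matrix[OF Q(1)] by auto
    then show "\<bar>det (D ** transpose Q)\<bar> = \<bar>\<alpha> * \<beta> ^ (CARD('n) - 1)\<bar>"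
      by (simp add: det_mul det_transpose abs_mult detD)
  qed
qed

text \<open>\<open>M\<close> maximises the absolute determinant among the matrices that map
  \<open>K\<close> into the unit ball; the points with \<open>norm (M *v x) \<le> 1\<close> then
  form the ellipsoid of least volume, centred at 0, around \<open>K\<close>. The symmetry of
  \<open>K\<close> is what gives the radius 1 / sqrt n instead of 1 / n.\<close>

lemma john_ellipsoid:
  fixes K :: "(real ^ 'n) set"
  assumes K: "compact K" "convex K" and sym: "\<And>x. x \<in> K \<Longrightarrow> - x \<in> K" and int: "0 \<in> interior K"
  obtains M :: "real ^ 'n ^ 'n" where "det M \<noteq> 0" "\<And>x. x \<in> K \<Longrightarrow> norm (M *v x) \<le> 1"
    "\<And>x. norm (M *v x) \<le> 1 / sqrt (real CARD('n)) \<Longrightarrow> x \<in> K"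
proof -
  obtain R where R: "0 < R" "\<And>x. x \<in> K \<Longrightarrow> norm x \<le> R"
    using compact_imp_bounded[OF K(1)] by (auto simp: bounded_pos)
  obtain r where r: "0 < r" "cball 0 r \<subseteq> K"
    using int by (auto simp: mem_interior_cball)
  define \<A> :: "(real ^ 'n ^ 'n) set" where "\<A> = {A. \<forall>x\<in>K. norm (A *v x) \<le> 1}"
  have cont: "continuous_on UNIV (\<lambda>A :: real ^ 'n ^ 'n. A *v x)" for x
    unfolding matrix_vector_mult_def by (intro continuous_intros)
  have "closed \<A>"
  proof -
    have "\<A> = (\<Inter>x\<in>K. {A. norm (A *v x) \<le> 1})"
      by (auto simp: \<A>_def)
    moreover have "closed {A :: real ^ 'n ^ 'n. norm (A *v x) \<le> 1}" for x
      by (intro closed_Collect_le continuous_intros cont)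
    ultimately show ?thesis by auto
  qed
  moreover have "bounded \<A>"
  proof -
    \<comment> \<open>The entries of a column are read off from the image of a multiple of a
      coordinate vector that lies in \<open>K\<close>.\<close>
    have "\<bar>A $ i $ j\<bar> \<le> 1 / r" if A: "A \<in> \<A>" for A i j
    proof -
      have "axis j r \<in> cball 0 r" using r by (simp add: norm_eq_sqrt_inner inner_axis_axis)
      then have "norm (A *v axis j r) \<le> 1"
        using A r by (auto simp: \<A>_def)
      then have "\<bar>(A *v axis j r) $ i\<bar> \<le> 1"
        by (rule order_trans[OF component_le_norm_cart])
      moreover have "(A *v axis j r) $ i = A $ i $ j * r"
        by (simp add: matrix_vector_mult_def axis_def if_distrib[of "\<lambda>a. _ * a"] cong: if_cong)
      ultimately show ?thesis
        using r by (simp add: abs_mult field_simps)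
    qed
    then have "norm A \<le> (\<Sum>i\<in>(UNIV :: 'n set). \<Sum>j\<in>(UNIV :: 'n set). 1 / r)" if A: "A \<in> \<A>" for A
    proof -
      have "norm A \<le> (\<Sum>i\<in>UNIV. norm (A $ i))"
        by (simp add: norm_vec_def L2_set_le_sum)
      also have "\<dots> \<le> (\<Sum>i\<in>UNIV. \<Sum>j\<in>UNIV. \<bar>A $ i $ j\<bar>)"
        by (intro sum_mono norm_le_l1_cart)
      also have "\<dots> \<le> (\<Sum>i\<in>(UNIV :: 'n set). \<Sum>j\<in>(UNIV :: 'n set). 1 / r)"
        using \<open>\<And>j i A. A \<in> \<A> \<Longrightarrow> \<bar>A $ i $ j\<bar> \<le> 1 / r\<close> A by (intro sum_mono) blast
      finally show ?thesis .
    qed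
    then show ?thesis by (auto simp: bounded_iff)
  qed
  ultimately have "compact \<A>" by (simp add: compact_eq_bounded_closed)
  \<comment> \<open>This scalar matrix has positive determinant, so the maximiser will be
    invertible.\<close>
  moreover have R_in: "(1 / R) *\<^sub>R mat 1 \<in> \<A>"
    using R by (auto simp: \<A>_def scaleR_matrix_vector_assoc[symmetric])
  moreover have "continuous_on \<A> (\<lambda>A. \<bar>det A\<bar>)"
    unfolding det_def by (intro continuous_intros)
  ultimately obtain A where A: "A \<in> \<A>" and max: "\<And>B. B \<in> \<A> \<Longrightarrow> \<bar>det B\<bar> \<le> \<bar>det A\<bar>"
    using continuous_attains_sup[of \<A> "\<lambda>A. \<bar>det A\<bar>"] by blast
  have "0 < \<bar>det ((1 / R) *\<^sub>R (mat 1 :: real ^ 'n ^ 'n))\<bar>"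
    using R by (subst det_diagonal) (auto simp: mat_def)
  then have det: "det A \<noteq> 0" using max[OF R_in] by auto
  \<comment> \<open>If \<open>x0\<close> were outside \<open>K\<close>, then \<open>A ` K\<close> would lie in a slab of half width less than \<open>1 / sqrt n\<close>, and
    stretching along its normal would contradict the maximality of the determinant.\<close>
  show thesis
  proof (rule that[OF det])
    show norm: "norm (A *v x) \<le> 1" if "x \<in> K" for x
      using A that by (simp add: \<A>_def)
    fix x0 assume x0: "norm (A *v x0) \<le> 1 / sqrt (real CARD('n))"
    show "x0 \<in> K"
    proof (rule ccontr)
      assume "x0 \<notin> K"
      then obtain a b where ab: "a \<bullet> x0 < b" "\<And>x. x \<in> K \<Longrightarrow> b < a \<bullet> x"
        using separating_hyperplane_closed_point[OF K(2) compact_imp_closed[OF K(1)]] by metis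
      have "0 \<in> K" using r by auto
      then have b: "b < 0" using ab(2)[of 0] by simp
      \<comment> \<open>The symmetry of \<open>K\<close> turns the half-space into a slab.\<close>
      have abs: "\<bar>a \<bullet> x\<bar> \<le> - b" if "x \<in> K" for x
        using ab(2)[OF that] ab(2)[OF sym[OF that]] by simp
      obtain B where B: "B ** A = mat 1" "A ** B = mat 1"
        using det by (metis invertible_def invertible_det_nz)
      \<comment> \<open>\<open>d\<close> is the functional \<open>a\<close> transported to the image
        of \<open>K\<close> under \<open>A\<close>, where the slab is measured with the Euclidean
        norm.\<close>
      define d where "d = transpose B *v a"
      have d: "a \<bullet> x = d \<bullet> (A *v x)" for x
      proof -
        have "d \<bullet> (A *v x) = a \<bullet> (B *v (A *v x))"
          by (simp add: d_def dot_lmul_matrix)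
        then show ?thesis by (simp add: matrix_vector_mul_assoc B)
      qed
      have "- b < \<bar>d \<bullet> (A *v x0)\<bar>" using ab(1) b d[of x0] by linarith
      also have "\<dots> \<le> norm d * norm (A *v x0)" by (rule Cauchy_Schwarz_ineq2)
      also have "\<dots> \<le> norm d * (1 / sqrt (real CARD('n)))"
        using x0 by (intro mult_left_mono) auto
      finally have db: "- b < norm d / sqrt (real CARD('n))" by simp
      then have d0: "0 < norm d" using b by (auto simp: zero_less_divide_iff)
      define h where "h = - b / norm d"
      define e where "e = d /\<^sub>R norm d"
      have e: "norm e = 1" using d0 by (simp add: e_def)
      have h0: "0 \<le> h" using b by (simp add: h_def divide_le_0_iff)
      have "h * sqrt (real CARD('n)) < 1" using db d0 by (simp add: h_def field_simps)
      then have "(h * sqrt (real CARD('n)))\<^sup>2 < 1"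
        using h0 by (simp add: power_less_one_iff abs_square_less_1)
      then have hn: "real CARD('n) * h\<^sup>2 < 1" by (simp add: power_mult_distrib mult.commute)
      have eh: "\<bar>e \<bullet> (A *v x)\<bar> \<le> h" if "x \<in> K" for x
        using abs[OF that] d0 by (simp add: d e_def h_def abs_mult divide_simps)
      obtain \<alpha> \<beta> where \<alpha>\<beta>: "0 \<le> \<beta>" "\<beta> \<le> \<alpha>" "\<alpha>\<^sup>2 * h\<^sup>2 + \<beta>\<^sup>2 * (1 - h\<^sup>2) \<le> 1" "1 < \<alpha> * \<beta> ^ (CARD('n) - 1)"
        by (rule john_scaling[OF h0 hn]) (auto simp: Suc_le_eq)
      obtain W where W: "\<bar>det W\<bar> = \<bar>\<alpha> * \<beta> ^ (CARD('n) - 1)\<bar>"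
        "\<And>y. (norm (W *v y))\<^sup>2 = \<alpha>\<^sup>2 * (e \<bullet> y)\<^sup>2 + \<beta>\<^sup>2 * ((norm y)\<^sup>2 - (e \<bullet> y)\<^sup>2)"
        using stretch_matrix[OF e] by metis
      have "W ** A \<in> \<A>"
        unfolding \<A>_def
      proof (safe)
        fix x assume x: "x \<in> K"
        define y where "y = A *v x"
        have y: "(norm y)\<^sup>2 \<le> 1" using norm[OF x] by (simp add: y_def power_le_one)
        have ey: "(e \<bullet> y)\<^sup>2 \<le> h\<^sup>2" using eh[OF x] h0 by (simp add: y_def abs_le_square_iff[symmetric])
        have ab2: "\<beta>\<^sup>2 \<le> \<alpha>\<^sup>2" using \<alpha>\<beta> by (intro power_mono) auto
        have "(norm (W *v y))\<^sup>2 = (\<alpha>\<^sup>2 - \<beta>\<^sup>2) * (e \<bullet> y)\<^sup>2 + \<beta>\<^sup>2 * (norm y)\<^sup>2"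
          by (simp add: W(2) algebra_simps)
        also have "\<dots> \<le> (\<alpha>\<^sup>2 - \<beta>\<^sup>2) * h\<^sup>2 + \<beta>\<^sup>2 * 1"
          using ab2 ey y by (intro add_mono mult_left_mono) auto
        also have "\<dots> \<le> 1" using \<alpha>\<beta>(3) by (simp add: algebra_simps)
        finally have "norm (W *v y) \<le> 1" by (simp add: power_le_one_iff abs_square_le_1)
        then show "norm (W ** A *v x) \<le> 1" by (simp add: y_def matrix_vector_mul_assoc)
      qed
      then have "\<bar>det W\<bar> * \<bar>det A\<bar> \<le> 1 * \<bar>det A\<bar>"
        using max[of "W ** A"] by (simp add: det_mul abs_mult)
      then have "\<bar>det W\<bar> \<le> 1" using det by (simp del: mult_1)
      then show False using W(1) \<alpha>\<beta>(4) by simp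
    qed
  qed
qed

section \<open>Lattice points in a convex body and in its polar\<close>

text \<open>The norm on the vector space is kept abstract; it will be the given norm on the scalar
  extension, read in the coordinates of a basis.\<close>

locale vec_norm =
  fixes p :: "real ^ 'n :: {finite, wellorder} \<Rightarrow> real"
  assumes definite: "p x = 0 \<Longrightarrow> x = 0"
    and triangle: "p (x + y) \<le> p x + p y"
    and scale: "p (c *\<^sub>R x) = \<bar>c\<bar> * p x"
begin

definition body :: "(real ^ 'n::_) set" where "body = {x. p x \<le> 1}"

text \<open>The unit ball of the dual norm, in a homogeneous form that applies to every vector
  without rescaling it into \<open>body\<close>.\<close>

definition polar :: "(real ^ 'n::_) set" where "polar = {y. \<forall>x. \<bar>y \<bullet> x\<bar> \<le> p x}"

lemma zero [simp]: "p 0 = 0"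
  using scale[of 0 0] by simp

lemma minus [simp]: "p (- x) = p x"
  using scale[of "- 1" x] by simp

lemma nonneg: "0 \<le> p x"
  using triangle[of x "- x"] by simp

lemma diff: "p (x - y) \<le> p x + p y"
  using triangle[of x "- y"] by simp

section \<open>Equivalence with the Euclidean norm\<close>

lemma upper: "\<exists>C>0. \<forall>x. p x \<le> C * norm x"
proof -
  let ?C = "(\<Sum>i\<in>UNIV. p (axis i 1)) + 1"
  have s0: "0 \<le> (\<Sum>i\<in>UNIV. p (axis i 1))"
    by (intro sum_nonneg nonneg)
  have sum_le: "p (\<Sum>i\<in>I. f i) \<le> (\<Sum>i\<in>I. p (f i))" if "finite I" for I :: "'n set" and f
    using that
  proof induction
    case (insert i I)
    then show ?case using triangle[of "f i" "sum f I"] by simp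
  qed simp
  have "p x \<le> ?C * norm x" for x
  proof -
    have "p x = p (\<Sum>i\<in>UNIV. (x $ i) *\<^sub>R axis i 1)"
      by (simp add: basis_expansion flip: scalar_mult_eq_scaleR)
    also have "\<dots> \<le> (\<Sum>i\<in>UNIV. p ((x $ i) *\<^sub>R axis i 1))"
      by (rule sum_le) simp
    also have "\<dots> \<le> (\<Sum>i\<in>UNIV. norm x * p (axis i 1))"
      unfolding scale by (intro sum_mono mult_right_mono component_le_norm_cart nonneg)
    also have "\<dots> \<le> ?C * norm x"
      by (simp add: sum_distrib_left[symmetric] algebra_simps)
    finally show ?thesis .
  qed
  then show ?thesis using s0 by (intro exI[of _ ?C]) auto
qed

lemma lipschitz: "\<bar>p x - p y\<bar> \<le> p (x - y)"
  using triangle[of "x - y" y] triangle[of "y - x" x] minus[of "x - y"] by simp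

lemma continuous: "continuous_on A p"
proof -
  obtain C where C: "0 < C" "\<And>x. p x \<le> C * norm x" using upper by blast
  have "C-lipschitz_on A p"
  proof (rule lipschitz_onI)
    fix x y
    show "dist (p x) (p y) \<le> C * dist x y"
      using lipschitz[of x y] C(2)[of "x - y"] by (simp add: dist_norm)
  qed (use C in simp)
  then show ?thesis by (rule lipschitz_on_continuous_on)
qed

text \<open>The continuous \<open>p\<close> attains a positive minimum on the compact unit sphere;
  homogeneity does the rest.\<close>

lemma lower: "\<exists>c>0. \<forall>x. c * norm x \<le> p x"
proof -
  obtain i :: 'n where True by simp
  have "axis i 1 \<in> sphere (0 :: real ^ 'n::_) 1" by (simp add: norm_eq_sqrt_inner inner_axis_axis)
  then obtain x0 where x0: "x0 \<in> sphere 0 1" "\<And>x. x \<in> sphere 0 1 \<Longrightarrow> p x0 \<le> p x"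
    using continuous_attains_inf[of "sphere 0 1" p] continuous by fastforce
  have "x0 \<noteq> 0" using x0(1) by auto
  then have pos: "0 < p x0" using nonneg[of x0] definite[of x0] by linarith
  have "p x0 * norm x \<le> p x" for x
  proof (cases "x = 0")
    case False
    have "p x0 \<le> p (x /\<^sub>R norm x)"
      using False by (intro x0(2)) simp
    also have "\<dots> = p x / norm x" by (simp add: scale divide_inverse)
    finally show ?thesis using False by (simp add: field_simps)
  qed simp
  with pos show ?thesis by blast
qed

lemma compact_sublevel: "compact {x. p x \<le> r}"
proof -
  obtain c where c: "0 < c" "\<And>x. c * norm x \<le> p x" using lower by blast
  have "closed {x. p x \<le> r}"
    by (intro closed_Collect_le continuous continuous_on_const)
  moreover have "bounded {x. p x \<le> r}"
    using c by (intro boundedI[of _ "r / c"]) (auto simp: field_simps intro: order_trans)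
  ultimately show ?thesis by (simp add: compact_eq_bounded_closed)
qed

lemma compact_body: "compact body"
  unfolding body_def by (rule compact_sublevel)

lemma body_borel [measurable]: "body \<in> sets borel"
  using compact_body by (simp add: borel_compact)

lemma convex_body: "convex body"
  unfolding convex_def body_def
proof (safe)
  fix x y and u v :: real assume *: "p x \<le> 1" "p y \<le> 1" "0 \<le> u" "0 \<le> v" "u + v = 1"
  have "p (u *\<^sub>R x + v *\<^sub>R y) \<le> u * p x + v * p y"
    using triangle[of "u *\<^sub>R x" "v *\<^sub>R y"] * by (simp add: scale)
  also have "\<dots> \<le> u * 1 + v * 1"
    using * by (intro add_mono mult_left_mono)
  finally show "p (u *\<^sub>R x + v *\<^sub>R y) \<le> 1" using * by simp
qed

lemma interior_body: "0 \<in> interior body"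
proof -
  have "open {x. p x < 1}"
    by (intro open_Collect_less continuous continuous_on_const)
  moreover have "{x. p x < 1} \<subseteq> body" by (auto simp: body_def)
  ultimately show ?thesis by (auto simp: interior_def)
qed

lemma measure_body_pos: "0 < measure lborel body"
proof -
  obtain e where e: "0 < e" "cball 0 e \<subseteq> body"
    using interior_body by (auto simp: mem_interior_cball)
  have "0 < measure lborel (cball (0 :: real ^ 'n::_) e)" using e by simp
  also have "\<dots> \<le> measure lborel body"
    using e compact_body
    by (intro measure_mono_fmeasurable) (auto simp: fmeasurable_compact)
  finally show ?thesis .
qed

lemma bounded_polar: "bounded polar"
proof -
  obtain C where C: "0 < C" "\<And>x. p x \<le> C * norm x" using upper by blast
  have "norm y \<le> C" if "y \<in> polar" for y
  proof (cases "y = 0")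
    case False
    have "norm y * norm y = \<bar>y \<bullet> y\<bar>" by (simp add: norm_eq_sqrt_inner)
    also have "\<dots> \<le> p y" using that unfolding polar_def by blast
    also have "\<dots> \<le> C * norm y" by (rule C)
    finally show ?thesis using False by simp
  qed (use C in simp)
  then show ?thesis by (auto simp: bounded_iff)
qed

lemma polarI: "y \<in> polar" if *: "\<And>x. x \<in> body \<Longrightarrow> \<bar>y \<bullet> x\<bar> \<le> 1"
  unfolding polar_def
proof safe
  fix x
  show "\<bar>y \<bullet> x\<bar> \<le> p x"
  proof (cases "x = 0")
    case False
    then have px: "0 < p x" using nonneg[of x] definite[of x] by linarith
    have "x /\<^sub>R p x \<in> body" using px by (simp add: body_def scale)
    from *[OF this] show ?thesis using px by (simp add: abs_mult field_simps)
  qed simp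
qed

text \<open>Bessel's inequality for the body shrunk by 8. On it a vector of the polar takes values
  at most 1/8, so the phases are at most pi / 4 and each Fourier coefficient is at least sqrt 2 / 2
  times the volume. The division by 2 is the square of this ratio.\<close>

lemma lattice_points_lower:
  "measure lborel body / 8 ^ CARD('n) / 2 * real (card (int_vecs \<inter> polar)) \<le> real (card (int_vecs \<inter> body))"
proof -
  let ?A = "mat (1 / 8) :: real ^ 'n::_ ^ 'n::_"
  define S where "S = (*v) ?A ` body"
  have A: "?A *v x = (1 / 8) *\<^sub>R x" for x
    by (simp add: vec_eq_iff matrix_vector_mult_def mat_def if_distrib[of "\<lambda>a. a * _"] cong: if_cong)
  have det: "det ?A = (1 / 8) ^ CARD('n)"
    by (subst det_diagonal) (auto simp: mat_def)
  have measS: "measure lborel S = measure lborel body / 8 ^ CARD('n)"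
    unfolding S_def using compact_body
    by (subst measure_lborel_linear_image) (auto simp: det power_one_over field_simps)
  have compS: "compact S"
    unfolding S_def A using compact_body by (rule compact_scaling)
  have pS: "p x \<le> 1 / 8" if "x \<in> S" for x
    using that by (auto simp: S_def A body_def scale)
  have "measure lborel S * (sqrt 2 / 2)\<^sup>2 * real (card (int_vecs \<inter> polar)) \<le> real (card (int_vecs \<inter> body))"
  proof (rule bessel_int_vecs)
    show "S \<in> sets borel" "bounded S" "bounded body"
      using compS compact_body by (auto simp: borel_compact compact_imp_bounded)
    show "x - y \<in> body" if "x \<in> S" "y \<in> S" for x y
      using diff[of x y] pS[OF that(1)] pS[OF that(2)] by (simp add: body_def)
    show "finite (int_vecs \<inter> polar)" by (rule finite_int_vecs_bounded[OF bounded_polar])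
    show "int_vecs \<inter> polar \<subseteq> int_vecs" by simp
    show "- y \<in> int_vecs \<inter> polar" if "y \<in> int_vecs \<inter> polar" for y
      using that int_vecs_uminus by (auto simp: polar_def)
    show "(0 :: real) \<le> sqrt 2 / 2" by simp
    fix y assume y: "y \<in> int_vecs \<inter> polar"
    have int: "integrable lborel (\<lambda>x. indicator S x * g x)" if "continuous_on UNIV g" for g :: "_ \<Rightarrow> real"
      using borel_integrable_compact[OF compS, of g] continuous_on_subset[OF that] by simp
    have "sqrt 2 / 2 * measure lborel S = (LINT x|lborel. indicator S x * (sqrt 2 / 2))"
      by simp
    also have "\<dots> \<le> (LINT x|lborel. indicator S x * cos (2 * pi * (y \<bullet> x)))"
    proof (rule integral_mono)
      fix x
      show "indicator S x * (sqrt 2 / 2) \<le> indicator S x * cos (2 * pi * (y \<bullet> x))"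
      proof (cases "x \<in> S")
        case True
        have "\<bar>y \<bullet> x\<bar> \<le> p x"
          using y unfolding polar_def by blast
        then have "\<bar>y \<bullet> x\<bar> \<le> 1 / 8"
          using pS[OF True] by linarith
        then have "\<bar>2 * pi * (y \<bullet> x)\<bar> \<le> pi / 4"
          by (simp add: abs_mult)
        then have "cos (pi / 4) \<le> cos \<bar>2 * pi * (y \<bullet> x)\<bar>"
          by (intro cos_monotone_0_pi_le) auto
        then show ?thesis using True by (simp add: cos_45)
      qed simp
    qed (intro int continuous_intros)+
    finally show "sqrt 2 / 2 * measure lborel S \<le> (LINT x|lborel. indicator S x * cos (2 * pi * (y \<bullet> x)))" .
  qed
  then show ?thesis
    by (simp add: measS power_divide)
qed

text \<open>The image of the unit ball under \<open>transpose M\<close> is the polar of the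
  ellipsoid \<open>norm (M *v x) \<le> 1\<close>. Substituting \<open>x = transpose M *v u\<close>
  turns \<open>y \<bullet> x\<close> into \<open>M *v y \<bullet> u\<close>, where
  \<open>M *v y\<close> has norm at most 1 for \<open>y\<close> in \<open>body\<close>; so the
  Fourier coefficients reduce to those of a ball. One factor \<open>unit_ball_vol\<close> is due to
  this polar ellipsoid, the other to the small ellipsoid inside \<open>body\<close>.\<close>

lemma lattice_points_upper:
  assumes s: "0 < s" "s \<le> 1 / 2" and \<beta>: "\<beta> = 1 - 2 * pi\<^sup>2 * s\<^sup>2 / real CARD('n)" "0 \<le> \<beta>"
  shows "s ^ CARD('n) * (unit_ball_vol (real CARD('n)))\<^sup>2 * \<beta>\<^sup>2 * real (card (int_vecs \<inter> body)) \<le>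
    sqrt (real CARD('n)) ^ CARD('n) * measure lborel body * real (card (int_vecs \<inter> polar))"
proof -
  let ?V = "unit_ball_vol (real CARD('n))" and ?n = "CARD('n)"
  obtain M :: "real ^ 'n::_ ^ 'n::_" where M: "det M \<noteq> 0" "\<And>x. x \<in> body \<Longrightarrow> norm (M *v x) \<le> 1"
    "\<And>x. norm (M *v x) \<le> 1 / sqrt (real ?n) \<Longrightarrow> x \<in> body"
    using john_ellipsoid[OF compact_body convex_body _ interior_body] by (auto simp: body_def)
  obtain B where B: "B ** M = mat 1" "M ** B = mat 1"
    using M(1) by (metis invertible_def invertible_det_nz)
  have detB: "det B * det M = 1"
    using B(1) by (metis det_I det_mul)
  define S where "S = (*v) (transpose M) ` cball 0 s"
  have compS: "compact S"
    unfolding S_def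
    by (intro compact_continuous_image linear_continuous_on matrix_vector_mul_bounded_linear) simp
  have tr: "y \<bullet> (transpose M *v u) = (M *v y) \<bullet> u" for y u
    by (metis dot_lmul_matrix inner_commute transpose_matrix_vector vector_transpose_matrix transpose_transpose)
  have measS: "measure lborel S = \<bar>det M\<bar> * (?V * s ^ ?n)"
    unfolding S_def using s M(1)
    by (subst measure_lborel_linear_image) (simp_all add: det_transpose content_cball)
  have 1: "measure lborel S * \<beta>\<^sup>2 * real (card (int_vecs \<inter> body)) \<le> real (card (int_vecs \<inter> polar))"
  proof (rule bessel_int_vecs)
    show "S \<in> sets borel" "bounded S"
      using compS by (auto simp: borel_compact compact_imp_bounded)
    show "bounded polar" by (rule bounded_polar)
    show "x - y \<in> polar" if "x \<in> S" "y \<in> S" for x y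
    proof (rule polarI)
      fix z assume z: "z \<in> body"
      \<comment> \<open>A point of \<open>S\<close> pairs with \<open>z\<close> to at most
        \<open>s\<close>, so a difference of two points pairs to at most 2 * s; this is the origin
        of \<open>s \<le> 1 / 2\<close>.\<close>
      have half: "\<bar>x \<bullet> z\<bar> \<le> 1 / 2" if "x \<in> S" for x
      proof -
        obtain u where u: "norm u \<le> s" "x = transpose M *v u"
          using \<open>x \<in> S\<close> by (auto simp: S_def)
        have "\<bar>x \<bullet> z\<bar> = \<bar>(M *v z) \<bullet> u\<bar>"
          using tr[of z u] by (simp add: u inner_commute)
        also have "\<dots> \<le> norm (M *v z) * norm u" by (rule Cauchy_Schwarz_ineq2)
        also have "\<dots> \<le> 1 * s" using M(2)[OF z] u by (intro mult_mono) auto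
        finally show ?thesis using s by simp
      qed
      show "\<bar>(x - y) \<bullet> z\<bar> \<le> 1"
        using half[OF that(1)] half[OF that(2)] by (simp add: inner_diff_left)
    qed
    show "finite (int_vecs \<inter> body)" by (rule finite_int_vecs_bounded[OF compact_imp_bounded[OF compact_body]])
    show "int_vecs \<inter> body \<subseteq> int_vecs" by simp
    show "- y \<in> int_vecs \<inter> body" if "y \<in> int_vecs \<inter> body" for y
      using that int_vecs_uminus by (auto simp: body_def)
    show "0 \<le> \<beta>" by fact
    fix y assume y: "y \<in> int_vecs \<inter> body"
    have "\<beta> * measure lborel S = \<bar>det M\<bar> * (\<beta> * measure lborel (cball (0 :: real ^ 'n::_) s))"
      using s by (simp add: measS content_cball)
    also have "\<dots> \<le> \<bar>det M\<bar> * (LINT u|lborel. indicator (cball 0 s) u * cos (2 * pi * ((M *v y) \<bullet> u)))"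
      unfolding \<beta>(1) using y M(2)[of y] by (intro mult_left_mono ball_fourier_lower) auto
    also have "\<dots> = \<bar>det (transpose M)\<bar> *
        (LINT u|lborel. indicator (cball 0 s) u * cos (2 * pi * (y \<bullet> (transpose M *v u))))"
      by (simp only: tr det_transpose)
    also have "\<dots> = (LINT x|lborel. indicator S x * cos (2 * pi * (y \<bullet> x)))"
      unfolding S_def using M(1)
      by (intro lborel_integral_linear_image[symmetric]) (auto simp: det_transpose intro!: continuous_intros)
    finally show "\<beta> * measure lborel S \<le> (LINT x|lborel. indicator S x * cos (2 * pi * (y \<bullet> x)))" .
  qed
  define t where "t = 1 / sqrt (real ?n)"
  have t: "0 < t" by (simp add: t_def)
  \<comment> \<open>\<open>B\<close>, the inverse of \<open>M\<close>, maps the ball of radius 1 /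
    sqrt n into the body.\<close>
  have 2: "\<bar>det B\<bar> * (?V * t ^ ?n) \<le> measure lborel body"
  proof -
    have "(*v) B ` cball 0 t \<subseteq> body"
    proof safe
      fix x :: "real ^ 'n::_" assume "x \<in> cball 0 t"
      then show "B *v x \<in> body"
        by (intro M(3)) (simp add: matrix_vector_mul_assoc B t_def)
    qed
    moreover have "compact ((*v) B ` cball 0 t)"
      by (intro compact_continuous_image linear_continuous_on matrix_vector_mul_bounded_linear) simp
    ultimately have "measure lborel ((*v) B ` cball 0 t) \<le> measure lborel body"
      using compact_body by (intro measure_mono_fmeasurable) (auto simp: fmeasurable_compact borel_compact)
    moreover have "det B \<noteq> 0" using detB by auto
    ultimately show ?thesis
      using t by (simp add: measure_lborel_linear_image content_cball)
  qed
  define a where "a = real (card (int_vecs \<inter> body))"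
  define b where "b = real (card (int_vecs \<inter> polar))"
  have nt: "sqrt (real ?n) ^ ?n * t ^ ?n = 1"
    by (simp add: t_def power_mult_distrib[symmetric])
  have "s ^ ?n * ?V\<^sup>2 * \<beta>\<^sup>2 * a = (s ^ ?n * ?V\<^sup>2 * \<beta>\<^sup>2 * a) * (\<bar>det B * det M\<bar>) * (sqrt (real ?n) ^ ?n * t ^ ?n)"
    unfolding nt detB by simp
  also have "\<dots> = sqrt (real ?n) ^ ?n * (\<bar>det B\<bar> * (?V * t ^ ?n)) * (\<bar>det M\<bar> * (?V * s ^ ?n) * \<beta>\<^sup>2 * a)"
    by (simp add: abs_mult power2_eq_square ac_simps)
  also have "\<dots> \<le> sqrt (real ?n) ^ ?n * measure lborel body * b"
    using 1 2 s t unfolding measS a_def b_def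
    by (intro mult_mono mult_left_mono) (auto intro!: mult_nonneg_nonneg)
  finally show ?thesis by (simp add: a_def b_def)
qed

text \<open>The two estimates of the theorem before taking logarithms. In the first, n^n pays for
  \<open>V / 8 ^ n\<close>. In the second, one factor n^(n/2) pays for the John ellipsoid and the
  other for the decay of \<open>V\<close>.\<close>

lemma lattice_points_body_polar:
  fixes \<kappa> :: real
  defines "\<kappa> \<equiv> (1 - 1 / (2 * pi)) * exp (- pi)"
    and "n \<equiv> CARD('n)" and "V \<equiv> unit_ball_vol (real CARD('n))"
    and "a \<equiv> real (card (int_vecs \<inter> body))" and "b \<equiv> real (card (int_vecs \<inter> polar))"
    and "v \<equiv> measure lborel body"
  shows "\<kappa> * (b * v) \<le> real n ^ n * (V * a)" "\<kappa> * (V * a) \<le> real n ^ n * (b * v)"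
proof -
  have n: "1 \<le> n" by (simp add: n_def Suc_le_eq)
  have V: "0 < V" unfolding V_def by simp
  have v: "0 < v" unfolding v_def by (rule measure_body_pos)
  have ab: "0 \<le> a" "0 \<le> b" by (simp_all add: a_def b_def)
  have low: "v / 8 ^ n / 2 * b \<le> a"
    unfolding v_def n_def a_def b_def by (rule lattice_points_lower)
  have "\<kappa> * (b * v) \<le> V * (real n / 8) ^ n / 2 * (b * v)"
    using lower_bound_numeric[OF n] v ab by (intro mult_right_mono) (auto simp: \<kappa>_def V_def n_def)
  also have "\<dots> = real n ^ n * (V * (v / 8 ^ n / 2 * b))"
    by (simp add: power_divide)
  also have "\<dots> \<le> real n ^ n * (V * a)"
    using low V by (intro mult_left_mono) auto
  finally show "\<kappa> * (b * v) \<le> real n ^ n * (V * a)" .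
  obtain s where s: "0 < s" "s \<le> 1 / 2" "0 \<le> 1 - 2 * pi\<^sup>2 * s\<^sup>2 / real n"
    "\<kappa> \<le> V * (s * sqrt (real n)) ^ n * (1 - 2 * pi\<^sup>2 * s\<^sup>2 / real n)\<^sup>2"
    using upper_bound_numeric[OF n] unfolding \<kappa>_def V_def n_def by metis
  define \<beta> where "\<beta> = 1 - 2 * pi\<^sup>2 * s\<^sup>2 / real n"
  have up: "s ^ n * V\<^sup>2 * \<beta>\<^sup>2 * a \<le> sqrt (real n) ^ n * v * b"
    unfolding v_def n_def a_def b_def V_def
    by (rule lattice_points_upper) (use s in \<open>auto simp: \<beta>_def n_def\<close>)
  have sq: "sqrt (real n) ^ n * sqrt (real n) ^ n = real n ^ n"
    by (simp add: power_mult_distrib[symmetric])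
  have "\<kappa> * (V * a) \<le> V * (s * sqrt (real n)) ^ n * \<beta>\<^sup>2 * (V * a)"
    using s(4) V ab by (intro mult_right_mono) (auto simp: \<beta>_def)
  also have "\<dots> = sqrt (real n) ^ n * (s ^ n * V\<^sup>2 * \<beta>\<^sup>2 * a)"
    by (simp add: power_mult_distrib power2_eq_square ac_simps)
  also have "\<dots> \<le> sqrt (real n) ^ n * (sqrt (real n) ^ n * v * b)"
    using up by (intro mult_left_mono) auto
  also have "\<dots> = real n ^ n * (b * v)"
    unfolding sq[symmetric] by (simp add: ac_simps)
  finally show "\<kappa> * (V * a) \<le> real n ^ n * (b * v)" .
qed

end

section \<open>Bases of finitely generated abelian groups modulo torsion\<close>

text \<open>The action of the integers, built from the same constant sums as \<open>torsion\<close>;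
  at most one of the two sums is nonempty.\<close>

definition zmul :: "int \<Rightarrow> 'a::ab_group_add \<Rightarrow> 'a" where
  "zmul k x = (\<Sum>i<nat k. x) - (\<Sum>i<nat (- k). x)"

lemma sum_const_add:
  fixes x :: "'a::ab_group_add"
  shows "(\<Sum>i<m + n. x) = (\<Sum>i<m. x) + (\<Sum>i<(n :: nat). x)"
  by (induction n) (simp_all add: ac_simps)

text \<open>An integer may be represented by any difference of natural numbers, which spares
  additivity in the scalar a distinction of signs.\<close>

lemma zmul_diff_nat: "zmul (int m - int n) x = (\<Sum>i<m. x) - (\<Sum>i<n. x)"
proof (cases "n \<le> m")
  case True
  then obtain d where d: "m = n + d" using le_Suc_ex by blast
  then have "zmul (int m - int n) x = (\<Sum>i<d. x)"
    by (simp add: zmul_def)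
  then show ?thesis unfolding d sum_const_add by simp
next
  case False
  then obtain d where d: "n = m + d" using le_Suc_ex nat_le_linear by blast
  then have "zmul (int m - int n) x = - (\<Sum>i<d. x)"
    by (simp add: zmul_def)
  then show ?thesis unfolding d sum_const_add by simp
qed

interpretation zmul: module "zmul :: int \<Rightarrow> 'a::ab_group_add \<Rightarrow> 'a"
proof
  show add_left: "zmul (k + l) x = zmul k x + zmul l x" for k l and x :: 'a
  proof -
    obtain m n m' n' where k: "k = int m - int n" "l = int m' - int n'"
      by (metis int_diff_cases)
    then have "k + l = int (m + m') - int (n + n')" by simp
    then show ?thesis
      unfolding k(1,2) by (simp only: zmul_diff_nat sum_const_add) (simp add: k)
  qed
  show "zmul k (x + y) = zmul k x + zmul k y" for k and x y :: 'a
    by (simp add: zmul_def sum.distrib)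
  show "zmul 1 x = x" for x :: 'a
    by (simp add: zmul_def)
  show "zmul k (zmul l x) = zmul (k * l) x" for k l and x :: 'a
  proof -
    have zero: "zmul 0 y = 0" for y :: 'a by (simp add: zmul_def)
    have minus: "zmul (- k) y = - zmul k y" for k and y :: 'a
      by (simp add: zmul_def)
    have nat: "zmul (int n) (zmul l x) = zmul (int n * l) x" for n
    proof (induction n)
      case (Suc n)
      have "zmul (int (Suc n)) (zmul l x) = zmul (int n) (zmul l x) + zmul 1 (zmul l x)"
        by (simp add: add_left[symmetric] add.commute)
      also have "\<dots> = zmul (int n * l) x + zmul l x"
        by (simp add: Suc) (simp add: zmul_def)
      also have "\<dots> = zmul (int (Suc n) * l) x"
        by (simp add: add_left[symmetric] algebra_simps)
      finally show ?case .
    qed (simp add: zero)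
    show ?thesis
      by (cases k rule: int_cases2) (simp_all add: nat minus)
  qed
qed

lemma torsion_iff_zmul: "x \<in> torsion \<longleftrightarrow> (\<exists>k. k \<noteq> 0 \<and> zmul k x = 0)"
proof
  assume "x \<in> torsion"
  then obtain n :: nat where "n > 0" "(\<Sum>i<n. x) = 0" by (auto simp: torsion_def)
  then show "\<exists>k. k \<noteq> 0 \<and> zmul k x = 0"
    by (intro exI[of _ "int n"]) (simp add: zmul_def)
next
  assume "\<exists>k. k \<noteq> 0 \<and> zmul k x = 0"
  then obtain k where k: "k \<noteq> 0" "zmul k x = 0" by blast
  then have "zmul \<bar>k\<bar> x = 0" by (simp add: abs_if)
  then show "x \<in> torsion"
    using k(1) unfolding torsion_def zmul_def by (auto intro!: exI[of _ "nat \<bar>k\<bar>"])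
qed

lemma torsion_add:
  assumes "x \<in> torsion" "y \<in> torsion"
  shows "x + y \<in> torsion"
proof -
  obtain k l where kl: "k \<noteq> 0" "zmul k x = 0" "l \<noteq> 0" "zmul l y = 0"
    using assms unfolding torsion_iff_zmul by blast
  have "zmul (k * l) (x + y) = zmul l (zmul k x) + zmul k (zmul l y)"
    by (simp add: zmul.scale_right_distrib mult.commute)
  then show ?thesis
    unfolding torsion_iff_zmul using kl by (intro exI[of _ "k * l"]) simp
qed

lemma torsion_zmul:
  assumes "x \<in> torsion"
  shows "zmul l x \<in> torsion"
proof -
  obtain k where k: "k \<noteq> 0" "zmul k x = 0"
    using assms unfolding torsion_iff_zmul by blast
  have "zmul k (zmul l x) = zmul l (zmul k x)"
    by (simp add: mult.commute)
  then show ?thesis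
    unfolding torsion_iff_zmul using k by (intro exI[of _ k]) simp
qed

lemma torsion_zmulD:
  assumes "zmul l x \<in> torsion" "l \<noteq> 0"
  shows "x \<in> torsion"
proof -
  obtain k where k: "k \<noteq> 0" "zmul k (zmul l x) = 0"
    using assms unfolding torsion_iff_zmul by blast
  then show ?thesis
    unfolding torsion_iff_zmul using assms by (intro exI[of _ "k * l"]) simp
qed

lemma torsion_zero: "0 \<in> torsion"
  unfolding torsion_iff_zmul by (intro exI[of _ 1]) simp

lemma torsion_diff: "x - y \<in> torsion" if "x \<in> torsion" "y \<in> torsion"
  using torsion_add[OF that(1) torsion_zmul[OF that(2), of "- 1"]] by simp

text \<open>A family rather than a set: adding a multiple of one member to another preserves the
  number of generators even if members coincide.\<close>

definition generates_mod_torsion :: "'i set \<Rightarrow> ('i \<Rightarrow> 'a::ab_group_add) \<Rightarrow> bool" where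
  "generates_mod_torsion I x \<longleftrightarrow> finite I \<and> (\<forall>y. \<exists>c. y - (\<Sum>i\<in>I. zmul (c i) (x i)) \<in> torsion)"

lemma group_closure_finite:
  assumes "finite S" "y \<in> group_closure S"
  shows "\<exists>c. y = (\<Sum>s\<in>S. zmul (c s) s)"
  using assms(2)
proof induction
  case (base s)
  show ?case
  proof (cases "s = 0")
    case True
    then show ?thesis by (intro exI[of _ "\<lambda>_. 0"]) simp
  next
    case False
    with base have "s \<in> S" by simp
    have "(\<Sum>t\<in>S. zmul (if t = s then 1 else 0) t) = (\<Sum>t\<in>S. if t = s then t else 0)"
      by (intro sum.cong) auto
    also have "\<dots> = s" using assms(1) \<open>s \<in> S\<close> by simp
    finally show ?thesis by metis
  qed
next
  case (diff s t)
  then obtain c d where "s = (\<Sum>s\<in>S. zmul (c s) s)" "t = (\<Sum>s\<in>S. zmul (d s) s)" by blast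
  then have "s - t = (\<Sum>s\<in>S. zmul (c s - d s) s)"
    by (simp add: zmul.scale_left_diff_distrib sum_subtractf)
  then show ?case by (rule exI[of _ "\<lambda>s. c s - d s"])
qed

lemma exists_generates_mod_torsion:
  assumes "finitely_generated TYPE('a::ab_group_add)"
  shows "\<exists>(I :: nat set) (x :: nat \<Rightarrow> 'a). generates_mod_torsion I x"
proof -
  obtain S :: "'a set" where S: "finite S" "group_closure S = UNIV"
    using assms by (auto simp: finitely_generated_def)
  obtain f :: "nat \<Rightarrow> 'a" where f: "bij_betw f {0..<card S} S"
    using ex_bij_betw_nat_finite[OF S(1)] by blast
  have "generates_mod_torsion {0..<card S} f"
    unfolding generates_mod_torsion_def
  proof (intro conjI allI)
    fix y
    obtain c where c: "y = (\<Sum>s\<in>S. zmul (c s) s)"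
      using group_closure_finite[OF S(1)] S(2) by blast
    also have "\<dots> = (\<Sum>i\<in>{0..<card S}. zmul (c (f i)) (f i))"
      by (rule sum.reindex_bij_betw[OF f, symmetric])
    finally show "\<exists>c. y - (\<Sum>i\<in>{0..<card S}. zmul (c i) (f i)) \<in> torsion"
      by (intro exI[of _ "\<lambda>i. c (f i)"]) (simp add: torsion_zero)
  qed simp
  then show ?thesis by blast
qed

text \<open>An elementary change of the generators together with the compensating change of the
  coefficients. It is the single step of Euclid's algorithm on a relation.\<close>

lemma shear_sum:
  fixes x :: "'i \<Rightarrow> 'a::ab_group_add"
  assumes "finite I" "i \<in> I" "j \<in> I" "i \<noteq> j"
  shows "(\<Sum>l\<in>I. zmul ((c(i := c i - e * c j)) l) ((x(j := x j + zmul e (x i))) l)) =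
    (\<Sum>l\<in>I. zmul (c l) (x l))"
proof -
  have split: "sum g I = g i + g j + sum g (I - {i} - {j})" for g :: "'i \<Rightarrow> 'a"
    using assms by (subst sum.remove[of I i]) (auto simp: sum.remove[of "I - {i}" j] add.assoc)
  have "(\<Sum>l\<in>I - {i} - {j}. zmul ((c(i := c i - e * c j)) l) ((x(j := x j + zmul e (x i))) l)) =
      (\<Sum>l\<in>I - {i} - {j}. zmul (c l) (x l))"
    by (rule sum.cong) auto
  then show ?thesis
    unfolding split[of "\<lambda>l. zmul ((c(i := c i - e * c j)) l) ((x(j := x j + zmul e (x i))) l)"]
      split[of "\<lambda>l. zmul (c l) (x l)"]
    using assms(4) by (simp add: zmul.scale_left_diff_distrib zmul.scale_right_distrib mult.commute)
qed

text \<open>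
  In a relation of minimal height among the generating systems of minimal length, Euclid's algorithm
  could shrink a larger coefficient by a smaller one; so only one coefficient is left, and its
  generator is torsion, hence superfluous.
\<close>

lemma minimal_generates_independent:
  fixes x :: "'i \<Rightarrow> 'a::ab_group_add"
  assumes "generates_mod_torsion I x"
    and min: "\<And>J (z :: 'i \<Rightarrow> 'a). generates_mod_torsion J z \<Longrightarrow> card I \<le> card J"
    and "(\<Sum>i\<in>I. zmul (c i) (x i)) \<in> torsion" and "i \<in> I"
  shows "c i = 0"
  using assms(1,3,4)
proof (induction "\<Sum>i\<in>I. nat \<bar>c i\<bar>" arbitrary: c x i rule: less_induct)
  case less
  have fin: "finite I" using less.prems(1) by (simp add: generates_mod_torsion_def)
  show ?case
  proof (rule ccontr)
    assume ci: "c i \<noteq> 0"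
    show False
    proof (cases "\<exists>j\<in>I. j \<noteq> i \<and> c j \<noteq> 0")
      case True
      have False if ij: "i \<in> I" "j \<in> I" "i \<noteq> j" "c i \<noteq> 0" "c j \<noteq> 0" "\<bar>c j\<bar> \<le> \<bar>c i\<bar>" for i j
      proof -
        \<comment> \<open>With this sign, \<open>\<bar>c i - e * c j\<bar>\<close> equals
          \<open>\<bar>c i\<bar> - \<bar>c j\<bar>\<close>.\<close>
        define e where "e = sgn (c i) * sgn (c j)"
        define c' where "c' = c(i := c i - e * c j)"
        define x' where "x' = x(j := x j + zmul e (x i))"
        have "\<bar>c i - e * c j\<bar> < \<bar>c i\<bar>"
          using ij(4-6) by (auto simp: e_def sgn_if abs_if split: if_splits)
        then have lt: "(\<Sum>l\<in>I. nat \<bar>c' l\<bar>) < (\<Sum>l\<in>I. nat \<bar>c l\<bar>)"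
          using ij(1) by (intro sum_strict_mono_ex1[OF fin]) (auto simp: c'_def)
        have gen: "generates_mod_torsion I x'"
          unfolding generates_mod_torsion_def
        proof (intro conjI fin allI)
          fix y
          obtain d where "y - (\<Sum>l\<in>I. zmul (d l) (x l)) \<in> torsion"
            using less.prems(1) by (auto simp: generates_mod_torsion_def)
          then show "\<exists>d. y - (\<Sum>l\<in>I. zmul (d l) (x' l)) \<in> torsion"
            unfolding x'_def shear_sum[OF fin ij(1-3), of d e x, symmetric] by blast
        qed
        have "(\<Sum>l\<in>I. zmul (c' l) (x' l)) \<in> torsion"
          using less.prems(2) unfolding c'_def x'_def shear_sum[OF fin ij(1-3)] .
        \<comment> \<open>The coefficient at \<open>j\<close> is untouched by the shear, so the
          induction hypothesis at \<open>j\<close> would make it vanish.\<close>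
        from less.hyps[OF lt gen this ij(2)] show False
          using ij by (simp add: c'_def)
      qed
      then show False
        using True less.prems(3) ci by (metis linorder_le_cases)
    next
      case False
      have "(\<Sum>l\<in>I. zmul (c l) (x l)) = zmul (c i) (x i) + (\<Sum>l\<in>I - {i}. zmul (c l) (x l))"
        by (rule sum.remove[OF fin less.prems(3)])
      also have "(\<Sum>l\<in>I - {i}. zmul (c l) (x l)) = 0"
        using False by (intro sum.neutral) auto
      finally have "zmul (c i) (x i) \<in> torsion" using less.prems(2) by simp
      then have xi: "x i \<in> torsion" using ci by (rule torsion_zmulD)
      have "generates_mod_torsion (I - {i}) x"
        unfolding generates_mod_torsion_def
      proof (intro conjI allI)
        fix y
        obtain d where d: "y - (\<Sum>l\<in>I. zmul (d l) (x l)) \<in> torsion"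
          using less.prems(1) by (auto simp: generates_mod_torsion_def)
        have "y - (\<Sum>l\<in>I - {i}. zmul (d l) (x l)) =
            (y - (\<Sum>l\<in>I. zmul (d l) (x l))) + zmul (d i) (x i)"
          by (simp add: sum.remove[OF fin less.prems(3)])
        also have "\<dots> \<in> torsion"
          using d xi by (intro torsion_add torsion_zmul)
        finally show "\<exists>d. y - (\<Sum>l\<in>I - {i}. zmul (d l) (x l)) \<in> torsion" by blast
      qed (use fin in simp)
      from min[OF this] show False
        using fin less.prems(3) by (metis card_Diff1_less leD)
    qed
  qed
qed

text \<open>The dual functionals belong to the data: through \<open>pairing\<close> they give the
  coordinates on every scalar extension, and they generate the dual module.\<close>

definition basis_mod_torsion :: "'i set \<Rightarrow> ('i \<Rightarrow> 'a::ab_group_add) \<Rightarrow> ('i \<Rightarrow> 'a zdual) \<Rightarrow> bool" where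
  "basis_mod_torsion I x f \<longleftrightarrow> finite I \<and>
    (\<forall>y. y - (\<Sum>i\<in>I. zmul (apply_dual (f i) y) (x i)) \<in> torsion) \<and>
    (\<forall>i\<in>I. \<forall>j\<in>I. apply_dual (f i) (x j) = (if i = j then 1 else 0))"

text \<open>A generating family of least size has only trivial relations modulo torsion, so the
  coefficients of an element are unique. Uniqueness makes them additive, and thus elements of the
  dual.\<close>

lemma exists_basis_mod_torsion:
  assumes "finitely_generated TYPE('a::ab_group_add)"
  shows "\<exists>(I :: nat set) (x :: nat \<Rightarrow> 'a) f. basis_mod_torsion I x f"
proof -
  define k where "k = (LEAST k. \<exists>(I :: nat set) (x :: nat \<Rightarrow> 'a). generates_mod_torsion I x \<and> card I = k)"
  have "\<exists>k (I :: nat set) (x :: nat \<Rightarrow> 'a). generates_mod_torsion I x \<and> card I = k"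
    using exists_generates_mod_torsion[OF assms] by blast
  from LeastI_ex[OF this] obtain I :: "nat set" and x :: "nat \<Rightarrow> 'a"
    where gen: "generates_mod_torsion I x" and card: "card I = k"
    unfolding k_def by blast
  have min: "card I \<le> card J" if "generates_mod_torsion J z" for J and z :: "nat \<Rightarrow> 'a"
    unfolding card k_def by (rule Least_le) (use that in blast)
  note indep = minimal_generates_independent[OF gen min]
  have fin: "finite I" using gen by (simp add: generates_mod_torsion_def)
  obtain c where c: "\<And>y. y - (\<Sum>i\<in>I. zmul (c y i) (x i)) \<in> torsion"
    using gen unfolding generates_mod_torsion_def by metis
  have uniq: "d i = d' i" if "y - (\<Sum>i\<in>I. zmul (d i) (x i)) \<in> torsion"
    "y - (\<Sum>i\<in>I. zmul (d' i) (x i)) \<in> torsion" "i \<in> I" for y d d' i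
  proof -
    have "(\<Sum>i\<in>I. zmul (d i - d' i) (x i)) =
        (y - (\<Sum>i\<in>I. zmul (d' i) (x i))) - (y - (\<Sum>i\<in>I. zmul (d i) (x i)))"
      by (simp add: zmul.scale_left_diff_distrib sum_subtractf)
    also have "\<dots> \<in> torsion" by (rule torsion_diff[OF that(2,1)])
    finally show ?thesis using indep[where c = "\<lambda>i. d i - d' i" and i = i] that(3) by simp
  qed
  have add: "c (y + z) i = c y i + c z i" if "i \<in> I" for y z i
  proof (rule uniq[OF c _ that])
    have "y + z - (\<Sum>i\<in>I. zmul (c y i + c z i) (x i)) =
        (y - (\<Sum>i\<in>I. zmul (c y i) (x i))) + (z - (\<Sum>i\<in>I. zmul (c z i) (x i)))"
      by (simp add: zmul.scale_left_distrib sum.distrib)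
    also have "\<dots> \<in> torsion" by (rule torsion_add[OF c c])
    finally show "y + z - (\<Sum>i\<in>I. zmul (c y i + c z i) (x i)) \<in> torsion" .
  qed
  have app: "apply_dual (Abs_zdual (\<lambda>y. c y i)) y = c y i" if "i \<in> I" for i y
    by (subst Abs_zdual_inverse) (use add[OF that] in auto)
  have "basis_mod_torsion I x (\<lambda>i. Abs_zdual (\<lambda>y. c y i))"
    unfolding basis_mod_torsion_def
  proof (intro conjI fin allI ballI)
    fix y
    have "(\<Sum>i\<in>I. zmul (apply_dual (Abs_zdual (\<lambda>y. c y i)) y) (x i)) = (\<Sum>i\<in>I. zmul (c y i) (x i))"
      by (intro sum.cong refl) (simp add: app)
    then show "y - (\<Sum>i\<in>I. zmul (apply_dual (Abs_zdual (\<lambda>y. c y i)) y) (x i)) \<in> torsion"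
      using c by simp
  next
    fix i j assume ij: "i \<in> I" "j \<in> I"
    have "c (x j) i = (if i = j then 1 else 0)"
    proof (rule uniq[OF c _ ij(1)])
      have "(\<Sum>i\<in>I. zmul (if i = j then 1 else 0) (x i)) = (\<Sum>i\<in>I. if i = j then x i else 0)"
        by (intro sum.cong) auto
      also have "\<dots> = x j" using fin ij by simp
      finally show "x j - (\<Sum>i\<in>I. zmul (if i = j then 1 else 0) (x i)) \<in> torsion"
        by (simp add: torsion_zero)
    qed
    then show "apply_dual (Abs_zdual (\<lambda>y. c y i)) (x j) = (if i = j then 1 else 0)"
      using ij by (simp add: app)
  qed
  then show ?thesis by blast
qed

section \<open>Coordinates on the scalar extension\<close>

lemma additive_zmul:
  fixes g :: "'a::ab_group_add \<Rightarrow> 'b::ab_group_add"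
  assumes add: "\<And>x y. g (x + y) = g x + g y"
  shows "g (zmul k x) = zmul k (g x)"
proof -
  have zero: "g 0 = 0" using add[of 0 0] by simp
  have diff: "g (x - y) = g x - g y" for x y
    using add[of "x - y" y] by (simp add: algebra_simps)
  have "g (\<Sum>i<n. x) = (\<Sum>i<n. g x)" for n :: nat
    by (induction n) (simp_all add: add zero)
  then show ?thesis by (simp add: zmul_def diff)
qed

lemma additive_sum_zmul:
  fixes g :: "'a::ab_group_add \<Rightarrow> 'b::ab_group_add"
  assumes add: "\<And>x y. g (x + y) = g x + g y"
  shows "g (\<Sum>i\<in>I. zmul (c i) (x i)) = (\<Sum>i\<in>I. zmul (c i) (g (x i)))"
proof -
  have zero: "g 0 = 0" using add[of 0 0] by simp
  show ?thesis
    by (induction I rule: infinite_finite_induct) (simp_all add: add zero additive_zmul[of g, OF add])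
qed

lemma zmul_ring: "zmul k (a :: 'k::ring_1) = of_int k * a"
proof -
  obtain m n where "k = int m - int n" by (rule int_diff_cases)
  then show ?thesis by (simp add: zmul_diff_nat left_diff_distrib)
qed

lemma apply_dual_zmul: "apply_dual f (zmul k x) = k * apply_dual f x"
  using additive_zmul[of "apply_dual f" k x] by (simp add: apply_dual_add zmul_ring)

lemma apply_dual_torsion: "t \<in> torsion \<Longrightarrow> apply_dual f t = 0"
proof -
  assume "t \<in> torsion"
  then obtain k where k: "k \<noteq> 0" "zmul k t = 0" by (auto simp: torsion_iff_zmul)
  have "apply_dual f 0 = 0" using apply_dual_add[of f 0 0] by simp
  then show ?thesis using apply_dual_zmul[of f k t] k by simp
qed

lemma apply_dual_diff: "apply_dual f (x - y) = apply_dual f x - apply_dual f y"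
  using apply_dual_add[of f "x - y" y] by simp

lemma apply_dual_sum_zmul:
  "apply_dual f (\<Sum>i\<in>I. zmul (c i) (x i)) = (\<Sum>i\<in>I. c i * apply_dual f (x i))"
  using additive_sum_zmul[of "apply_dual f" c x I] by (simp add: apply_dual_add zmul_ring)

lemma pure_zmul: "pure (zmul k x) a = pure x (of_int k * a)"
  using additive_zmul[of "\<lambda>x. pure x a" k x] additive_zmul[of "\<lambda>a. pure x a" k a]
  by (simp add: pure_add_left pure_add_right zmul_ring)

lemma pure_zero_right [simp]: "pure x 0 = 0"
  using pure_add_right[of x 0 0] by simp

lemma pure_diff_right: "pure x (a - b) = pure x a - pure x b"
  using pure_add_right[of x "a - b" b] by simp

text \<open>If k t = 0 with k nonzero, then t \<otimes> a = (k t) \<otimes> (a / k) = 0.\<close>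

lemma pure_torsion:
  fixes a :: "'k::field_char_0"
  assumes "t \<in> torsion"
  shows "pure t a = 0"
proof -
  obtain k where k: "k \<noteq> 0" "zmul k t = 0"
    using assms by (auto simp: torsion_iff_zmul)
  have "pure t a = pure (zmul k t) (a / of_int k)"
    using k(1) by (simp add: pure_zmul)
  then show ?thesis using k(2) by simp
qed

text \<open>Subtracting the basis component is an additive projection \<open>\<pi>\<close> onto the
  torsion. Hence the torsion is generated by the images of finitely many generators, and each image
  has only finitely many multiples. Finiteness matters because \<open>card\<close> of an infinite
  set is 0, which would spoil the logarithm.\<close>

lemma finite_torsion:
  assumes "finitely_generated TYPE('a::ab_group_add)"
  shows "finite (torsion :: 'a set)"
proof -
  obtain S :: "'a set" where S: "finite S" "group_closure S = UNIV"
    using assms by (auto simp: finitely_generated_def)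
  obtain I :: "nat set" and x :: "nat \<Rightarrow> 'a" and f where "basis_mod_torsion I x f"
    using exists_basis_mod_torsion[OF assms] by blast
  then have basis: "y - (\<Sum>i\<in>I. zmul (apply_dual (f i) y) (x i)) \<in> torsion" for y
    by (simp add: basis_mod_torsion_def)
  define \<pi> where "\<pi> y = y - (\<Sum>i\<in>I. zmul (apply_dual (f i) y) (x i))" for y
  have add: "\<pi> (y + z) = \<pi> y + \<pi> z" for y z
    by (simp add: \<pi>_def apply_dual_add zmul.scale_left_distrib sum.distrib)
  have fin: "finite (range (\<lambda>k. zmul k (\<pi> y)))" for y
  proof -
    obtain k where k: "k \<noteq> 0" "zmul k (\<pi> y) = 0"
      using basis[of y] by (auto simp: \<pi>_def torsion_iff_zmul)
    have "zmul l (\<pi> y) \<in> (\<lambda>l. zmul l (\<pi> y)) ` ({- \<bar>k\<bar>..\<bar>k\<bar>})" for l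
    proof (rule image_eqI)
      have "zmul l (\<pi> y) = zmul (l div k) (zmul k (\<pi> y)) + zmul (l mod k) (\<pi> y)"
        by (simp add: zmul.scale_left_distrib[symmetric])
      then show "zmul l (\<pi> y) = zmul (l mod k) (\<pi> y)" using k(2) by simp
      have "\<bar>l mod k\<bar> < \<bar>k\<bar>" using k(1) by (rule abs_mod_less)
      then show "l mod k \<in> {- \<bar>k\<bar>..\<bar>k\<bar>}" by auto
    qed
    then have "range (\<lambda>k. zmul k (\<pi> y)) \<subseteq> (\<lambda>l. zmul l (\<pi> y)) ` ({- \<bar>k\<bar>..\<bar>k\<bar>})" by blast
    then show ?thesis by (rule finite_subset) simp
  qed
  have "torsion \<subseteq> (\<lambda>g. \<Sum>s\<in>S. g s) ` (PiE S (\<lambda>s. range (\<lambda>k. zmul k (\<pi> s))))"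
  proof
    fix t :: 'a assume t: "t \<in> torsion"
    obtain c where c: "t = (\<Sum>s\<in>S. zmul (c s) s)"
      using group_closure_finite[OF S(1)] S(2) by blast
    have "t = \<pi> t" using t by (simp add: \<pi>_def apply_dual_torsion)
    also have "\<dots> = (\<Sum>s\<in>S. zmul (c s) (\<pi> s))"
      unfolding c by (rule additive_sum_zmul[OF add])
    also have "\<dots> = (\<Sum>s\<in>S. (\<lambda>s\<in>S. zmul (c s) (\<pi> s)) s)"
      by (intro sum.cong) auto
    finally show "t \<in> (\<lambda>g. \<Sum>s\<in>S. g s) ` (PiE S (\<lambda>s. range (\<lambda>k. zmul k (\<pi> s))))"
      by (rule image_eqI[where x = "\<lambda>s\<in>S. zmul (c s) (\<pi> s)"]) auto
  qed
  then show ?thesis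
    by (rule finite_subset) (intro finite_imageI finite_PiE S(1) fin)
qed

section \<open>The pairing and the expansion of tensors in a basis\<close>

lemma pairing_zero_right [simp]: "pairing s 0 = 0"
  using pairing_diff_right[of s 0 0] by simp

lemma pairing_zero_left [simp]: "pairing 0 t = 0"
  using pairing_diff_left[of 0 0 t] by simp

lemma pairing_add_right: "pairing s (t + u) = pairing s t + pairing s u"
  using pairing_diff_right[of s "t + u" u] by simp

lemma pairing_sum_right: "pairing s (\<Sum>i\<in>I. t i) = (\<Sum>i\<in>I. pairing s (t i))"
  by (induction I rule: infinite_finite_induct) (simp_all add: pairing_add_right)

lemma pairing_scale_right: "pairing s (tensor_scale r t) = r * pairing s t"
proof (induction s rule: tensor_induct)
  case zero
  show ?case by simp
next
  case (pure g a)
  show ?case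
    by (induction t rule: tensor_induct)
      (simp_all add: tensor_scale_diff_right pairing_diff_right algebra_simps)
next
  case (diff s t)
  then show ?case by (simp add: pairing_diff_left algebra_simps)
qed

lemma tensor_scale_zero_right [simp]: "tensor_scale r 0 = 0"
  by (rule tensor_module.scale_zero_right)

lemma complexify_zero [simp]: "complexify 0 = 0"
  using complexify_diff[of 0 0] by simp

lemma complexify_scaleR: "complexify (r *\<^sub>R t) = tensor_scale (complex_of_real r) (complexify t)"
  by (induction t rule: tensor_induct)
    (simp_all add: scaleR_tensor_def tensor_scale_diff_right complexify_diff)

lemma pairing_complexify:
  "pairing (pure g 1) (complexify t) = complex_of_real (pairing (pure g 1) t)"
  by (induction t rule: tensor_induct) (simp_all add: complexify_diff pairing_diff_right)

text \<open>On a pure tensor the torsion remainder dies, and the integer coefficients move to the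
  scalar factor.\<close>

lemma basis_expansion_tensor:
  fixes t :: "('a::ab_group_add, 'k::field_char_0) tensor"
  assumes "basis_mod_torsion I x f"
  shows "(\<Sum>i\<in>I. pure (x i) (pairing (pure (f i) 1) t)) = t"
proof (induction t rule: tensor_induct)
  case zero
  show ?case by simp
next
  case (pure y a)
  have "y - (\<Sum>i\<in>I. zmul (apply_dual (f i) y) (x i)) \<in> torsion"
    using assms by (simp add: basis_mod_torsion_def)
  from pure_torsion[OF this, of a] have "pure y a = pure (\<Sum>i\<in>I. zmul (apply_dual (f i) y) (x i)) a"
    by (simp add: pure_diff_left)
  also have "\<dots> = (\<Sum>i\<in>I. pure (zmul (apply_dual (f i) y) (x i)) a)"
    by (induction I rule: infinite_finite_induct) (simp_all add: pure_add_left)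
  also have "\<dots> = (\<Sum>i\<in>I. pure (x i) (pairing (pure (f i) 1) (pure y a)))"
    by (simp add: pure_zmul mult.commute)
  finally show ?case ..
next
  case (diff s t)
  then show ?case by (simp add: pairing_diff_right pure_diff_right sum_subtractf)
qed

text \<open>Pairing with the dual functionals separates the vectors \<open>pure (x i) 1\<close> and
  extracts their coefficients, which gives injectivity and independence.\<close>

lemma module_rank_eq_card_basis:
  fixes x :: "'i \<Rightarrow> 'a::ab_group_add"
  assumes basis: "basis_mod_torsion I x f"
  shows "module_rank TYPE('a) = card I"
proof -
  let ?b = "\<lambda>i. pure (x i) (1 :: real)"
  have fin: "finite I"
    and dual: "\<And>i j. i \<in> I \<Longrightarrow> j \<in> I \<Longrightarrow> apply_dual (f i) (x j) = (if i = j then 1 else 0)"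
    using basis by (simp_all add: basis_mod_torsion_def)
  have pure_scale: "pure y r = r *\<^sub>R pure y 1" for y :: 'a and r :: real
    by (simp add: scaleR_tensor_def)
  have inj: "inj_on ?b I"
  proof (rule inj_onI)
    fix i j assume ij: "i \<in> I" "j \<in> I" "?b i = ?b j"
    have "pairing (pure (f i) 1) (?b i) = pairing (pure (f i) 1) (?b j)" by (simp only: ij(3))
    then show "i = j" using ij(1,2) by (simp add: dual split: if_splits)
  qed
  have "dim (UNIV :: ('a, real) tensor set) = card (?b ` I)"
  proof (rule dim_unique[OF _ _ _ refl])
    show "UNIV \<subseteq> span (?b ` I)"
    proof
      fix t :: "('a, real) tensor"
      have "t = (\<Sum>i\<in>I. pairing (pure (f i) 1) t *\<^sub>R ?b i)"
        unfolding pure_scale[symmetric] by (rule basis_expansion_tensor[OF basis, symmetric])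
      also have "\<dots> \<in> span (?b ` I)"
        by (intro span_sum span_scale span_base) auto
      finally show "t \<in> span (?b ` I)" .
    qed
    show "independent (?b ` I)"
    proof (rule independent_if_scalars_zero)
      show "finite (?b ` I)" using fin by simp
      fix g y assume g: "(\<Sum>y\<in>?b ` I. g y *\<^sub>R y) = 0" and "y \<in> ?b ` I"
      then obtain j where j: "j \<in> I" "y = ?b j" by blast
      have "0 = pairing (pure (f j) 1) (\<Sum>i\<in>I. pure (x i) (g (?b i)))"
        using g by (simp add: sum.reindex[OF inj] pure_scale[symmetric])
      also have "\<dots> = (\<Sum>i\<in>I. if i = j then g (?b i) else 0)"
        unfolding pairing_sum_right by (intro sum.cong) (auto simp: dual j)
      also have "\<dots> = g y" using fin j by simp
      finally show "g y = 0" ..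
    qed
  qed simp
  then show ?thesis
    using inj by (simp add: module_rank_def card_image)
qed

text \<open>
  An index type with as many elements as the rank, so that the scalar extension can be identified
  with a space of vectors; the well-order is what the change of variables formula asks for.
\<close>

typedef (overloaded) 'a idx = "{i. i < max 1 (module_rank TYPE('a::ab_group_add))}"
  by (rule exI[of _ 0]) simp

instantiation idx :: (ab_group_add) linorder
begin

definition less_eq_idx :: "'a idx \<Rightarrow> 'a idx \<Rightarrow> bool" where
  "i \<le> j \<longleftrightarrow> Rep_idx i \<le> Rep_idx j"

definition less_idx :: "'a idx \<Rightarrow> 'a idx \<Rightarrow> bool" where
  "i < j \<longleftrightarrow> Rep_idx i < Rep_idx j"

instance
  by standard (auto simp: less_eq_idx_def less_idx_def Rep_idx_inject)

end

instance idx :: (ab_group_add) wellorder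
proof
  fix P :: "'a idx \<Rightarrow> bool" and a :: "'a idx"
  assume step: "\<And>x. (\<And>y. y < x \<Longrightarrow> P y) \<Longrightarrow> P x"
  show "P a"
    by (induction a rule: measure_induct_rule[of Rep_idx]) (rule step, simp add: less_idx_def)
qed

lemma bij_betw_Rep_idx:
  "bij_betw Rep_idx (UNIV :: 'a idx set) {..<max 1 (module_rank TYPE('a::ab_group_add))}"
proof -
  have "range (Rep_idx :: 'a idx \<Rightarrow> nat) = {i. i < max 1 (module_rank TYPE('a))}"
    by (rule type_definition.Rep_range[OF type_definition_idx])
  moreover have "inj (Rep_idx :: 'a idx \<Rightarrow> nat)"
    by (rule injI) (simp only: Rep_idx_inject)
  ultimately show ?thesis
    unfolding bij_betw_def lessThan_def by blast
qed

instance idx :: (ab_group_add) finite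
  by standard (use bij_betw_finite[OF bij_betw_Rep_idx] in simp)

text \<open>The maximum with 1 keeps the type inhabited in rank 0; in positive rank the cardinality
  is the rank.\<close>

lemma card_idx: "CARD('a::ab_group_add idx) = max 1 (module_rank TYPE('a))"
  using bij_betw_same_card[OF bij_betw_Rep_idx] by simp

lemma exists_basis_idx:
  assumes fg: "finitely_generated TYPE('a::ab_group_add)"
    and "1 \<le> module_rank TYPE('a::ab_group_add)"
  shows "\<exists>(x :: 'a::ab_group_add idx \<Rightarrow> 'a) f. basis_mod_torsion UNIV x f"
proof -
  obtain I :: "nat set" and x :: "nat \<Rightarrow> 'a" and f where basis: "basis_mod_torsion I x f"
    using exists_basis_mod_torsion[OF fg] by blast
  have "card (UNIV :: 'a idx set) = card I"
    using assms(2) by (simp add: card_idx module_rank_eq_card_basis[OF basis])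
  moreover have "finite I" using basis by (simp add: basis_mod_torsion_def)
  ultimately obtain h where h: "bij_betw h (UNIV :: 'a idx set) I"
    using finite_same_card_bij[of "UNIV :: 'a idx set" I] by auto
  have "basis_mod_torsion UNIV (x \<circ> h) (f \<circ> h)"
    unfolding basis_mod_torsion_def
  proof (intro conjI ballI allI)
    fix y
    have "(\<Sum>i\<in>UNIV. zmul (apply_dual ((f \<circ> h) i) y) ((x \<circ> h) i)) =
        (\<Sum>i\<in>I. zmul (apply_dual (f i) y) (x i))"
      using sum.reindex_bij_betw[OF h, of "\<lambda>i. zmul (apply_dual (f i) y) (x i)"] by simp
    then show "y - (\<Sum>i\<in>UNIV. zmul (apply_dual ((f \<circ> h) i) y) ((x \<circ> h) i)) \<in> torsion"
      using basis by (simp add: basis_mod_torsion_def)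
  next
    fix i j
    have "h i \<in> I" "h j \<in> I" "h i = h j \<longleftrightarrow> i = j"
      using h by (auto simp: bij_betw_def inj_def)
    then show "apply_dual ((f \<circ> h) i) ((x \<circ> h) j) = (if i = j then 1 else 0)"
      using basis by (simp add: basis_mod_torsion_def)
  qed simp
  then show ?thesis by blast
qed

section \<open>Haar measures on Euclidean spaces\<close>

text \<open>Uniqueness of the Haar measure; the constant is the \<open>\<nu>\<close>-measure of a
  unit cube. Finiteness on balls makes \<open>\<nu>\<close> sigma-finite, as Fubini's theorem
  demands.\<close>

lemma translation_invariant_eq_lborel:
  fixes \<nu> :: "'a::euclidean_space measure"
  assumes sets: "sets \<nu> = sets borel"
    and inv: "\<And>v A. A \<in> sets borel \<Longrightarrow> emeasure \<nu> ((+) v ` A) = emeasure \<nu> A"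
    and fin: "\<And>K. compact K \<Longrightarrow> emeasure \<nu> K < \<infinity>"
    and pos: "\<And>U. open U \<Longrightarrow> U \<noteq> {} \<Longrightarrow> 0 < emeasure \<nu> U"
  obtains c :: real where "0 < c" "\<And>A. A \<in> sets borel \<Longrightarrow> emeasure \<nu> A = ennreal c * emeasure lborel A"
proof -
  have [measurable_cong]: "sets \<nu> = sets borel" by (rule sets)
  have space: "space \<nu> = UNIV" using sets_eq_imp_space_eq[OF sets] by simp
  interpret \<nu>: sigma_finite_measure \<nu>
  proof
    show "\<exists>A. countable A \<and> A \<subseteq> sets \<nu> \<and> \<Union> A = space \<nu> \<and> (\<forall>a\<in>A. emeasure \<nu> a \<noteq> \<infinity>)"
    proof (intro exI conjI)
      show "countable (range (\<lambda>n. cball (0 :: 'a) (real n)))" by simp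
      show "\<Union> (range (\<lambda>n. cball (0 :: 'a) (real n))) = space \<nu>"
        using real_arch_simple by (auto simp: space)
      show "\<forall>a\<in>range (\<lambda>n. cball (0 :: 'a) (real n)). emeasure \<nu> a \<noteq> \<infinity>"
        using fin by (auto simp: less_top[symmetric])
    qed (auto simp: sets)
  qed
  interpret pair: pair_sigma_finite \<nu> "lborel :: 'a measure"
    by (simp add: pair_sigma_finite_def \<nu>.sigma_finite_measure_axioms sigma_finite_lborel)
  have inv': "emeasure \<nu> ((\<lambda>x. x + y) -` A) = emeasure \<nu> A" if "A \<in> sets borel" for A y
  proof -
    have "(\<lambda>x. x + y) -` A = (+) (- y) ` A"
      by (force simp: image_iff)
    then show ?thesis by (simp only: inv[OF that])
  qed
  \<comment> \<open>\<open>B\<close> has Lebesgue measure 1. Integrating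
    \<open>indicator B (y - x)\<close> over \<open>x\<close> meets a translate of the reflected cube
    \<open>B'\<close>, whose \<open>\<nu>\<close>-measure is independent of
    \<open>y\<close>.\<close>
  define B :: "'a set" where "B = cbox 0 One"
  define B' :: "'a set" where "B' = cbox (- One) 0"
  have B': "emeasure \<nu> ((\<lambda>x. y - x) -` B) = emeasure \<nu> B'" for y
  proof -
    have "(\<lambda>x. y - x) -` B = (\<lambda>x. x + (- y)) -` B'"
      by (auto simp: B_def B'_def mem_box algebra_simps)
    then show ?thesis using inv'[of B' "- y"] by (simp add: B'_def)
  qed
  \<comment> \<open>Integrate \<open>indicator A (x + y) * indicator B y\<close> over both variables in either order.\<close>
  have eq: "emeasure \<nu> A = emeasure \<nu> B' * emeasure lborel A" if A[measurable]: "A \<in> sets borel" for A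
  proof -
    have [measurable]: "B \<in> sets borel" by (simp add: B_def)
    have B1: "emeasure lborel B = 1"
      unfolding B_def by (subst emeasure_lborel_cbox) auto
    have "emeasure \<nu> A = (\<integral>\<^sup>+y. emeasure \<nu> A * indicator B y \<partial>lborel)"
      by (simp add: nn_integral_cmult_indicator B1)
    also have "\<dots> = (\<integral>\<^sup>+y. (\<integral>\<^sup>+x. indicator A (x + y) * indicator B y \<partial>\<nu>) \<partial>lborel)"
    proof (rule nn_integral_cong)
      fix y :: 'a
      have "(\<integral>\<^sup>+x. indicator A (x + y) * indicator B y \<partial>\<nu>) =
          (\<integral>\<^sup>+x. indicator B y * indicator ((\<lambda>x. x + y) -` A) x \<partial>\<nu>)"
        by (intro nn_integral_cong) (auto simp: indicator_def)
      also have "\<dots> = indicator B y * emeasure \<nu> ((\<lambda>x. x + y) -` A)"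
        by (rule nn_integral_cmult_indicator) (simp add: sets measurable_sets_borel[where M = borel])
      finally show "emeasure \<nu> A * indicator B y = (\<integral>\<^sup>+x. indicator A (x + y) * indicator B y \<partial>\<nu>)"
        using inv'[OF A] by (simp add: mult.commute)
    qed
    also have "\<dots> = (\<integral>\<^sup>+x. (\<integral>\<^sup>+y. indicator A (x + y) * indicator B y \<partial>lborel) \<partial>\<nu>)"
      by (rule pair.Fubini') measurable
    also have "\<dots> = (\<integral>\<^sup>+x. (\<integral>\<^sup>+y. indicator A y * indicator B (y - x) \<partial>lborel) \<partial>\<nu>)"
    proof (rule nn_integral_cong)
      fix x :: 'a
      have "(\<integral>\<^sup>+y. indicator A (y + x) * indicator B (y + x - x) \<partial>lborel) =
          (\<integral>\<^sup>+y. indicator A y * indicator B (y - x) \<partial>lborel)"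
        by (rule nn_integral_lborel_translate) measurable
      then show "(\<integral>\<^sup>+y. indicator A (x + y) * indicator B y \<partial>lborel) =
          (\<integral>\<^sup>+y. indicator A y * indicator B (y - x) \<partial>lborel)"
        by (simp add: add.commute)
    qed
    also have "\<dots> = (\<integral>\<^sup>+y. (\<integral>\<^sup>+x. indicator A y * indicator B (y - x) \<partial>\<nu>) \<partial>lborel)"
      by (rule pair.Fubini'[symmetric]) measurable
    also have "\<dots> = (\<integral>\<^sup>+y. emeasure \<nu> B' * indicator A y \<partial>lborel)"
    proof (rule nn_integral_cong)
      fix y :: 'a
      have "(\<integral>\<^sup>+x. indicator A y * indicator B (y - x) \<partial>\<nu>) =
          (\<integral>\<^sup>+x. indicator A y * indicator ((\<lambda>x. y - x) -` B) x \<partial>\<nu>)"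
        by (intro nn_integral_cong) (auto simp: indicator_def)
      also have "\<dots> = indicator A y * emeasure \<nu> ((\<lambda>x. y - x) -` B)"
        by (rule nn_integral_cmult_indicator) (simp add: sets measurable_sets_borel[where M = borel])
      finally show "(\<integral>\<^sup>+x. indicator A y * indicator B (y - x) \<partial>\<nu>) = emeasure \<nu> B' * indicator A y"
        by (simp add: B' mult.commute)
    qed
    also have "\<dots> = emeasure \<nu> B' * emeasure lborel A"
      by (rule nn_integral_cmult_indicator) simp
    finally show ?thesis .
  qed
  have fin': "emeasure \<nu> B' < \<infinity>" by (rule fin) (simp add: B'_def)
  have "0 < emeasure \<nu> (box (- One) (0 :: 'a))"
    by (rule pos) (auto simp: box_ne_empty)
  also have "\<dots> \<le> emeasure \<nu> B'"
    by (rule emeasure_mono) (auto simp: B'_def box_subset_cbox sets)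
  finally have pos': "0 < emeasure \<nu> B'" .
  show thesis
  proof (rule that[of "enn2real (emeasure \<nu> B')"])
    show "0 < enn2real (emeasure \<nu> B')"
      using fin' pos' by (simp add: enn2real_positive_iff)
    show "emeasure \<nu> A = ennreal (enn2real (emeasure \<nu> B')) * emeasure lborel A" if "A \<in> sets borel" for A
      using eq[OF that] fin' by simp
  qed
qed

section \<open>The invariants in coordinates\<close>

locale tensor_coords =
  fixes x :: "'i::{finite,wellorder} \<Rightarrow> 'a::ab_group_add" and f :: "'i \<Rightarrow> 'a zdual"
    and N :: "('a, complex) tensor \<Rightarrow> real"
  assumes basis: "basis_mod_torsion UNIV x f" and norm: "complex_norm N"
begin

definition coord :: "('a, real) tensor \<Rightarrow> real ^ 'i::_" where
  "coord t = (\<chi> i. pairing (pure (f i) 1) t)"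

definition vect :: "real ^ 'i::_ \<Rightarrow> ('a, real) tensor" where
  "vect v = (\<Sum>i\<in>UNIV. pure (x i) (v $ i))"

lemma dual_basis: "apply_dual (f i) (x j) = (if i = j then 1 else 0)"
  using basis by (simp add: basis_mod_torsion_def)

lemma basis_torsion: "y - (\<Sum>i\<in>UNIV. zmul (apply_dual (f i) y) (x i)) \<in> torsion"
  using basis by (simp add: basis_mod_torsion_def)

lemma vect_coord [simp]: "vect (coord t) = t"
  unfolding vect_def coord_def using basis_expansion_tensor[OF basis, of t] by simp

lemma coord_vect [simp]: "coord (vect v) = v"
  by (simp add: vec_eq_iff coord_def vect_def pairing_sum_right dual_basis if_distrib[of real_of_int]
      if_distrib[of "\<lambda>a. _ * a"] cong: if_cong)

lemma coord_add: "coord (s + t) = coord s + coord t"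
  by (simp add: coord_def vec_eq_iff pairing_add_right)

lemma coord_diff: "coord (s - t) = coord s - coord t"
  by (simp add: coord_def vec_eq_iff pairing_diff_right)

lemma vect_add: "vect (v + w) = vect v + vect w"
  by (metis coord_add coord_vect vect_coord)

lemma vect_diff: "vect (v - w) = vect v - vect w"
  by (metis coord_diff coord_vect vect_coord)

lemma coord_scaleR: "coord (r *\<^sub>R t) = r *\<^sub>R coord t"
  by (simp add: coord_def vec_eq_iff scaleR_tensor_def pairing_scale_right)

lemma vect_scaleR: "vect (r *\<^sub>R v) = r *\<^sub>R vect v"
  by (metis coord_scaleR coord_vect vect_coord)

lemma vect_zero [simp]: "vect 0 = 0"
  using vect_diff[of 0 0] by simp

lemma vect_image: "vect ` A = coord -` A"
  by (auto simp: image_iff) (metis vect_coord)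

text \<open>Injectivity of the map from the real to the complex scalar extension, read off from the
  real coordinates. It is what makes the norm in coordinates definite.\<close>

lemma complexify_eq_zero:
  fixes t :: "('a, real) tensor"
  assumes "complexify t = 0"
  shows "t = 0"
proof -
  have "pairing (pure (f i) 1) t = 0" for i
  proof -
    have "complex_of_real (pairing (pure (f i) 1) t) = 0"
      using pairing_complexify[of "f i" t] by (simp add: assms)
    then show ?thesis by simp
  qed
  then have "coord t = 0" by (simp add: coord_def vec_eq_iff)
  then show ?thesis by (metis vect_coord vect_zero)
qed

definition q :: "real ^ 'i::_ \<Rightarrow> real" where "q v = N (complexify (vect v))"

lemma q_coord: "N (complexify t) = q (coord t)"
  by (simp add: q_def)

sublocale vec_norm q
proof
  fix v w :: "real ^ 'i::_" and r :: real
  show "v = 0" if "q v = 0"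
  proof -
    have "complexify (vect v) = 0"
      using that norm by (simp add: q_def complex_norm_def)
    then have "vect v = 0" by (rule complexify_eq_zero)
    then show ?thesis by (metis coord_vect vect_zero)
  qed
  show "q (v + w) \<le> q v + q w"
    using norm by (simp add: q_def vect_add complexify_add complex_norm_def)
  show "q (r *\<^sub>R v) = \<bar>r\<bar> * q v"
    using norm by (simp add: q_def vect_scaleR complexify_scaleR complex_norm_def)
qed

lemma coord_pure: "coord (pure m 1) = (\<chi> i. of_int (apply_dual (f i) m))"
  by (simp add: coord_def)

lemma coord_integral_lattice: "coord ` integral_lattice = int_vecs"
proof (intro equalityI subsetI)
  fix v assume "v \<in> coord ` integral_lattice"
  then show "v \<in> int_vecs"
    by (auto simp: integral_lattice_def coord_pure int_vecs_def)
next
  fix v :: "real ^ 'i::_" assume v: "v \<in> int_vecs"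
  have "v = coord (pure (\<Sum>i\<in>UNIV. zmul \<lfloor>v $ i\<rfloor> (x i)) 1)"
    using v by (simp add: coord_pure vec_eq_iff apply_dual_sum_zmul dual_basis int_vecs_def
        if_distrib[of "\<lambda>a. _ * a"] cong: if_cong)
  then show "v \<in> coord ` integral_lattice"
    by (auto simp: integral_lattice_def)
qed

text \<open>Every element is a torsion element plus the lift of its coordinate vector, and the norm
  sees only the latter. So each lattice point of \<open>body\<close> is counted once for every
  torsion element.\<close>

lemma card_norm_le_one:
  "card {m. N (pure m 1) \<le> 1} = card (torsion :: 'a set) * card (int_vecs \<inter> body)"
proof -
  define lift where "lift v = (\<Sum>i\<in>UNIV. zmul \<lfloor>v $ i\<rfloor> (x i))" for v :: "real ^ 'i::_"
  have norm_pure: "N (pure m 1) \<le> 1 \<longleftrightarrow> coord (pure m 1) \<in> body" for m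
    using q_coord[of "pure m 1"] by (simp add: body_def)
  have coord_lift: "coord (pure (t + lift v) 1) = v" if "t \<in> torsion" "v \<in> int_vecs" for t v
    using that by (simp add: lift_def coord_pure vec_eq_iff apply_dual_add apply_dual_torsion apply_dual_sum_zmul
        dual_basis int_vecs_def if_distrib[of "\<lambda>a. _ * a"] cong: if_cong)
  have tors: "m - lift (coord (pure m 1)) \<in> torsion" for m
    using basis_torsion[of m] by (simp add: lift_def coord_pure)
  have int: "coord (pure m 1) \<in> int_vecs" for m
    by (simp add: coord_pure int_vecs_def)
  have "bij_betw (\<lambda>m. (m - lift (coord (pure m 1)), coord (pure m 1)))
      {m. N (pure m 1) \<le> 1} (torsion \<times> (int_vecs \<inter> body))"
  proof (rule bij_betw_byWitness[where f' = "\<lambda>(t, v). t + lift v"])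
    show "\<forall>tv\<in>torsion \<times> (int_vecs \<inter> body).
        ((case tv of (t, v) \<Rightarrow> t + lift v) - lift (coord (pure (case tv of (t, v) \<Rightarrow> t + lift v) 1)),
          coord (pure (case tv of (t, v) \<Rightarrow> t + lift v) 1)) = tv"
      by (auto simp: coord_lift)
  qed (auto simp: norm_pure tors int coord_lift)
  then show ?thesis
    by (simp add: bij_betw_same_card card_cartesian_product)
qed

section \<open>The dual lattice and the dual norm\<close>

definition dual_coord :: "'a zdual \<Rightarrow> real ^ 'i::_" where
  "dual_coord g = (\<chi> i. of_int (apply_dual g (x i)))"

lemma pairing_pure_coord: "pairing (pure g 1) t = dual_coord g \<bullet> coord t"
proof -
  have "pairing (pure g 1) t = pairing (pure g 1) (vect (coord t))" by simp
  also have "\<dots> = dual_coord g \<bullet> coord t"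
    unfolding vect_def by (simp add: pairing_sum_right dual_coord_def inner_vec_def mult.commute)
  finally show ?thesis .
qed

text \<open>A real supremum can be compared with 1 term by term once the set is nonempty and bounded
  above. The index type, being inhabited, provides a nonzero vector, and the equivalence of norms
  provides the bound.\<close>

lemma dual_norm_le_one: "dual_norm N (pure g 1) \<le> 1 \<longleftrightarrow> dual_coord g \<in> polar"
proof -
  let ?y = "dual_coord g"
  let ?r = "\<lambda>t. cmod (pairing (pure g 1) (complexify t)) / N (complexify t)"
  have r: "?r t = \<bar>?y \<bullet> coord t\<bar> / q (coord t)" for t
    by (simp add: pairing_complexify pairing_pure_coord q_coord)
  have pos: "0 < q (coord t)" if "t \<noteq> 0" for t
  proof -
    have "coord t \<noteq> 0" using that by (metis vect_coord vect_zero)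
    then show ?thesis using nonneg[of "coord t"] definite[of "coord t"] by linarith
  qed
  obtain c where c: "0 < c" "\<And>v. c * norm v \<le> q v" using lower by blast
  have bdd: "bdd_above (?r ` (UNIV - {0}))"
  proof (rule bdd_aboveI2)
    fix t :: "('a, real) tensor" assume "t \<in> UNIV - {0}"
    then have t: "0 < q (coord t)" using pos by simp
    have "\<bar>?y \<bullet> coord t\<bar> \<le> norm ?y * norm (coord t)" by (rule Cauchy_Schwarz_ineq2)
    also have "\<dots> \<le> norm ?y * (q (coord t) / c)"
      using c by (intro mult_left_mono) (auto simp: field_simps)
    finally show "?r t \<le> norm ?y / c"
      unfolding r using t c(1) by (simp add: field_simps)
  qed
  obtain i :: 'i where True by simp
  have "vect (axis i 1) \<noteq> 0"
    by (metis axis_eq_0_iff coord_vect one_neq_zero vect_zero)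
  then have ne: "UNIV - {0 :: ('a, real) tensor} \<noteq> {}" by blast
  have "dual_norm N (pure g 1) \<le> 1 \<longleftrightarrow> (\<forall>t\<in>UNIV - {0}. ?r t \<le> 1)"
    unfolding dual_norm_def by (rule cSUP_le_iff[OF ne bdd])
  also have "\<dots> \<longleftrightarrow> (\<forall>t. t \<noteq> 0 \<longrightarrow> \<bar>?y \<bullet> coord t\<bar> \<le> q (coord t))"
    unfolding r using pos by (auto simp: divide_le_eq split: if_splits)
  also have "\<dots> \<longleftrightarrow> (\<forall>v. \<bar>?y \<bullet> v\<bar> \<le> q v)"
  proof safe
    fix v assume *: "\<forall>t. t \<noteq> 0 \<longrightarrow> \<bar>?y \<bullet> coord t\<bar> \<le> q (coord t)"
    show "\<bar>?y \<bullet> v\<bar> \<le> q v"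
    proof (cases "vect v = 0")
      case True
      then have "v = 0" by (metis coord_vect vect_zero)
      then show ?thesis by simp
    next
      case False
      then show ?thesis using *[rule_format, of "vect v"] by simp
    qed
  qed auto
  finally show ?thesis by (simp add: polar_def)
qed

text \<open>Functionals vanish on torsion, so they are determined by their values on the basis, and
  every integer vector occurs as such values. Hence there is no torsion factor, unlike in the count
  for the module itself.\<close>

lemma card_dual_norm_le_one: "card {g. dual_norm N (pure g 1) \<le> 1} = card (int_vecs \<inter> polar)"
proof -
  define func where "func v = Abs_zdual (\<lambda>m. \<Sum>i\<in>UNIV. \<lfloor>v $ i\<rfloor> * apply_dual (f i) m)" for v :: "real ^ 'i::_"
  have h: "apply_dual (func v) m = (\<Sum>i\<in>UNIV. \<lfloor>v $ i\<rfloor> * apply_dual (f i) m)" for v m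
    unfolding func_def by (subst Abs_zdual_inverse) (auto simp: apply_dual_add distrib_left sum.distrib)
  have hv: "dual_coord (func v) = v" if "v \<in> int_vecs" for v
    using that by (simp add: dual_coord_def vec_eq_iff h dual_basis int_vecs_def
        if_distrib[of "\<lambda>a. _ * a"] cong: if_cong)
  have hd: "func (dual_coord g) = g" for g
  proof -
    have "apply_dual (func (dual_coord g)) m = apply_dual g m" for m
    proof -
      have "apply_dual g (m - (\<Sum>i\<in>UNIV. zmul (apply_dual (f i) m) (x i))) = 0"
        by (rule apply_dual_torsion[OF basis_torsion])
      then have "apply_dual g m = (\<Sum>i\<in>UNIV. \<lfloor>dual_coord g $ i\<rfloor> * apply_dual (f i) m)"
        by (simp add: dual_coord_def apply_dual_diff apply_dual_sum_zmul mult.commute)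
      then show ?thesis by (simp only: h)
    qed
    then show ?thesis by (simp add: apply_dual_inject[symmetric] fun_eq_iff)
  qed
  have "bij_betw dual_coord {g. dual_norm N (pure g 1) \<le> 1} (int_vecs \<inter> polar)"
  proof (rule bij_betw_byWitness[where f' = func])
    have "dual_coord g \<in> int_vecs" for g
      by (simp add: dual_coord_def int_vecs_def)
    then show "dual_coord ` {g. dual_norm N (pure g 1) \<le> 1} \<subseteq> int_vecs \<inter> polar"
      by (simp add: image_subset_iff dual_norm_le_one)
    show "func ` (int_vecs \<inter> polar) \<subseteq> {g. dual_norm N (pure g 1) \<le> 1}"
      by (simp add: image_subset_iff dual_norm_le_one hv)
  qed (simp_all add: hv hd)
  then show ?thesis by (rule bij_betw_same_card)
qed

text \<open>By the equivalence of norms each \<open>q\<close>-ball contains a Euclidean ball with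
  the same centre, and conversely.\<close>

lemma openin_norm_topology: "openin (norm_topology N) U \<longleftrightarrow> open (vect -` U)"
proof -
  interpret M: Metric_space UNIV "\<lambda>s t. N (complexify (s - t))"
  proof
    fix s t u :: "('a, real) tensor"
    show "0 \<le> N (complexify (s - t))" by (simp add: q_coord nonneg)
    show "N (complexify (s - t)) = N (complexify (t - s))"
      using minus[of "coord s - coord t"] by (simp add: q_coord coord_diff)
    show "N (complexify (s - t)) = 0 \<longleftrightarrow> s = t"
    proof
      assume "N (complexify (s - t)) = 0"
      then have "coord s = coord t" using definite[of "coord s - coord t"] by (simp add: q_coord coord_diff)
      then show "s = t" by (metis vect_coord)
    qed (use norm in \<open>simp add: complex_norm_def\<close>)
    show "N (complexify (s - u)) \<le> N (complexify (s - t)) + N (complexify (t - u))"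
      using triangle[of "coord s - coord t" "coord t - coord u"] by (simp add: q_coord coord_diff)
  qed
  obtain c where c: "0 < c" "\<And>v. c * norm v \<le> q v" using lower by blast
  obtain C where C: "0 < C" "\<And>v. q v \<le> C * norm v" using upper by blast
  have "openin (norm_topology N) U \<longleftrightarrow> (\<forall>s\<in>U. \<exists>r>0. \<forall>t. q (coord s - coord t) < r \<longrightarrow> t \<in> U)"
    unfolding norm_topology_def M.openin_mtopology M.mball_def by (auto simp: subset_iff q_coord coord_diff)
  also have "\<dots> \<longleftrightarrow> (\<forall>v\<in>vect -` U. \<exists>r>0. \<forall>w. q (v - w) < r \<longrightarrow> w \<in> vect -` U)"
    by (metis coord_vect vect_coord vimage_eq)
  also have "\<dots> \<longleftrightarrow> (\<forall>v\<in>vect -` U. \<exists>r>0. \<forall>w. norm (v - w) < r \<longrightarrow> w \<in> vect -` U)"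
  proof (intro ball_cong refl iffI)
    fix v
    assume "\<exists>r>0. \<forall>w. q (v - w) < r \<longrightarrow> w \<in> vect -` U"
    then obtain r where r: "0 < r" "\<And>w. q (v - w) < r \<Longrightarrow> w \<in> vect -` U" by blast
    show "\<exists>r>0. \<forall>w. norm (v - w) < r \<longrightarrow> w \<in> vect -` U"
    proof (intro exI[of _ "r / C"] conjI allI impI)
      show "0 < r / C" using r C by simp
      fix w assume "norm (v - w) < r / C"
      then have "C * norm (v - w) < r" using C(1) by (simp add: field_simps)
      then show "w \<in> vect -` U" using C(2)[of "v - w"] by (intro r(2)) linarith
    qed
  next
    fix v
    assume "\<exists>r>0. \<forall>w. norm (v - w) < r \<longrightarrow> w \<in> vect -` U"
    then obtain r where r: "0 < r" "\<And>w. norm (v - w) < r \<Longrightarrow> w \<in> vect -` U" by blast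
    show "\<exists>r>0. \<forall>w. q (v - w) < r \<longrightarrow> w \<in> vect -` U"
    proof (intro exI[of _ "c * r"] conjI allI impI)
      show "0 < c * r" using r c by simp
      fix w assume "q (v - w) < c * r"
      then have "c * norm (v - w) < c * r" using c(2)[of "v - w"] by linarith
      then show "w \<in> vect -` U" using c(1) by (intro r(2)) simp
    qed
  qed
  also have "\<dots> \<longleftrightarrow> open (vect -` U)"
    by (simp add: open_dist dist_norm norm_minus_commute)
  finally show ?thesis .
qed

text \<open>In coordinates the topology is the Euclidean one, so the image of \<open>\<mu>\<close>
  is a translation-invariant Borel measure and therefore a multiple of Lebesgue measure.\<close>

lemma haar_measure_coord:
  assumes haar: "haar_measure N \<mu>"
  obtains c :: real where "0 < c"
    "\<And>A. A \<in> sets \<mu> \<longleftrightarrow> vect -` A \<in> sets borel"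
    "\<And>A. A \<in> sets \<mu> \<Longrightarrow> measure \<mu> A = c * measure lborel (vect -` A)"
proof -
  have space: "space \<mu> = UNIV"
    and sets: "sets \<mu> = sigma_sets UNIV {U. openin (norm_topology N) U}"
    and inv: "\<And>v A. A \<in> sets \<mu> \<Longrightarrow> emeasure \<mu> ((+) v ` A) = emeasure \<mu> A"
    and fin: "\<And>K. compactin (norm_topology N) K \<Longrightarrow> emeasure \<mu> K < \<infinity>"
    and pos: "\<And>U. openin (norm_topology N) U \<Longrightarrow> U \<noteq> {} \<Longrightarrow> 0 < emeasure \<mu> U"
    using haar by (auto simp: haar_measure_def)
  have top: "topspace (norm_topology N) = UNIV"
    using openin_norm_topology[of UNIV] openin_subset by fastforce
  have vect_meas: "vect \<in> measurable borel \<mu>"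
  proof (rule measurable_sigma_sets[OF sets])
    fix U assume "U \<in> {U. openin (norm_topology N) U}"
    then show "vect -` U \<inter> space borel \<in> sets borel"
      by (simp add: openin_norm_topology)
  qed auto
  have coord_meas: "coord \<in> borel_measurable \<mu>"
  proof (rule borel_measurableI)
    fix S :: "(real ^ 'i::_) set" assume "open S"
    moreover have "vect -` coord -` S = S" by (auto simp: vimage_def)
    ultimately have "openin (norm_topology N) (coord -` S)"
      by (simp add: openin_norm_topology)
    then show "coord -` S \<inter> space \<mu> \<in> sets \<mu>"
      unfolding sets space by (auto intro: sigma_sets.Basic)
  qed
  have cv: "coord -` vect -` A = A" for A by (auto simp: vimage_def)
  have vc: "vect -` coord -` A = A" for A by (auto simp: vimage_def)
  have sets_iff: "A \<in> sets \<mu> \<longleftrightarrow> vect -` A \<in> sets borel" for A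
  proof
    assume "A \<in> sets \<mu>"
    then show "vect -` A \<in> sets borel"
      using measurable_sets[OF vect_meas] by simp
  next
    assume "vect -` A \<in> sets borel"
    then show "A \<in> sets \<mu>"
      using measurable_sets[OF coord_meas, of "vect -` A"] by (simp add: space cv)
  qed
  define \<nu> where "\<nu> = distr \<mu> borel coord"
  have \<nu>: "emeasure \<nu> A = emeasure \<mu> (coord -` A)" if "A \<in> sets borel" for A
    unfolding \<nu>_def using that coord_meas by (simp add: emeasure_distr space)
  obtain c :: real where c: "0 < c" "\<And>A. A \<in> sets borel \<Longrightarrow> emeasure \<nu> A = ennreal c * emeasure lborel A"
  proof (rule translation_invariant_eq_lborel[of \<nu>])
    show "sets \<nu> = sets borel" by (simp add: \<nu>_def)
    show "emeasure \<nu> ((+) v ` A) = emeasure \<nu> A" if A: "A \<in> sets borel" for v A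
    proof -
      have "(+) v ` A = (\<lambda>w. - v + w) -` A" by (force simp: image_iff)
      then have vA: "(+) v ` A \<in> sets borel"
        using measurable_sets_borel[of "\<lambda>w. - v + w" borel A] A by simp
      have "coord -` ((+) v ` A) = (+) (vect v) ` (coord -` A)"
        unfolding vect_image[symmetric] by (force simp: image_iff vect_add)
      then show ?thesis
        using inv[of "coord -` A" "vect v"] A by (simp add: \<nu>[OF vA] \<nu>[OF A] sets_iff vc)
    qed
    show "emeasure \<nu> K < \<infinity>" if K: "compact K" for K
    proof -
      have "continuous_map euclidean (norm_topology N) vect"
        unfolding continuous_map_def by (auto simp: top openin_norm_topology vimage_def)
      then have "compactin (norm_topology N) (vect ` K)"
        using K by (intro image_compactin[of euclidean]) auto
      then show ?thesis
        using fin K by (simp add: \<nu> borel_compact vect_image)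
    qed
    show "0 < emeasure \<nu> U" if U: "open U" "U \<noteq> {}" for U
    proof -
      have "coord -` U \<noteq> {}" using U(2) unfolding vect_image[symmetric] by simp
      moreover have "openin (norm_topology N) (coord -` U)" using U(1) by (simp add: openin_norm_topology vc)
      ultimately show ?thesis using pos U by (simp add: \<nu>)
    qed
  qed blast
  show thesis
  proof (rule that[OF c(1) sets_iff])
    fix A assume "A \<in> sets \<mu>"
    then have "vect -` A \<in> sets borel" by (simp add: sets_iff)
    from c(2)[OF this] \<nu>[OF this] have "emeasure \<mu> A = ennreal c * emeasure lborel (vect -` A)"
      by (simp add: cv)
    then show "measure \<mu> A = c * measure lborel (vect -` A)"
      using c(1) by (simp add: measure_def enn2real_mult)
  qed
qed

lemma fundamental_domain_coord:
  assumes sets: "\<And>A. A \<in> sets \<mu> \<longleftrightarrow> vect -` A \<in> sets borel"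
  shows "fundamental_domain \<mu> D \<longleftrightarrow> torus_domain (vect -` D)"
proof -
  have lat: "vect l \<in> integral_lattice \<longleftrightarrow> l \<in> int_vecs" for l
    unfolding coord_integral_lattice[symmetric] by (metis coord_vect image_iff vect_coord)
  have "(\<exists>!l. l \<in> integral_lattice \<and> vect v + l \<in> D) \<longleftrightarrow>
      (\<exists>!l. l \<in> int_vecs \<and> v + l \<in> vect -` D)" for v
  proof -
    have "(\<exists>!l. P l) \<longleftrightarrow> (\<exists>!l. P (vect l))" for P
      by (metis coord_vect vect_coord)
    then show ?thesis by (simp add: lat vect_add)
  qed
  moreover have "(\<forall>t. P t) \<longleftrightarrow> (\<forall>v. P (vect v))" for P
    by (metis vect_coord)
  ultimately show ?thesis
    by (simp add: fundamental_domain_def torus_domain_def sets)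
qed

text \<open>The preimage of the unit cube shows that \<open>SOME\<close> selects a genuine
  fundamental domain, and in coordinates all of them have Lebesgue measure 1.\<close>

lemma covolume_coord:
  assumes sets: "\<And>A. A \<in> sets \<mu> \<longleftrightarrow> vect -` A \<in> sets borel"
    and c: "\<And>A. A \<in> sets \<mu> \<Longrightarrow> measure \<mu> A = c * measure lborel (vect -` A)"
  shows "covolume \<mu> = c"
proof -
  define D where "D = (SOME D. fundamental_domain \<mu> D)"
  have "vect -` coord -` unit_cube = unit_cube" by (auto simp: vimage_def)
  then have "fundamental_domain \<mu> (coord -` unit_cube)"
    by (simp add: fundamental_domain_coord[OF sets] torus_domain_unit_cube)
  then have D: "fundamental_domain \<mu> D"
    unfolding D_def by (rule someI)
  then have "D \<in> sets \<mu>" by (simp add: fundamental_domain_def)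
  moreover have "measure lborel (vect -` D) = 1"
    using emeasure_torus_domain[of "vect -` D"] D by (simp add: fundamental_domain_coord[OF sets] measure_def)
  ultimately show ?thesis
    unfolding covolume_def D_def[symmetric] by (simp add: c)
qed

lemma unit_ball_coord: "vect -` unit_ball N = body"
  by (auto simp: unit_ball_def body_def q_def)

end

theorem theorem1p1:
  fixes N :: "('a::ab_group_add, complex) tensor \<Rightarrow> real"
    and \<mu> :: "('a, real) tensor measure"
    and n :: nat
  assumes "normed_Z_module N"
    and "n = module_rank TYPE('a)" and "n \<ge> 1"
    and "haar_measure N \<mu>"
  shows "- real n * ln (real n) + ln (1 - 1 / (2 * pi)) - pi
           \<le> h0_hat N - h1_hat N - deg_hat \<mu> N
       \<and> h0_hat N - h1_hat N - deg_hat \<mu> N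
           \<le> real n * ln (real n) + pi - ln (1 - 1 / (2 * pi))"
proof -
  have fg: "finitely_generated TYPE('a)" and norm: "complex_norm N"
    using assms(1) by (simp_all add: normed_Z_module_def)
  obtain x :: "'a idx \<Rightarrow> 'a" and f where "basis_mod_torsion UNIV x f"
    using exists_basis_idx[OF fg] assms(2,3) by auto
  then interpret tensor_coords x f N
    using norm by unfold_locales
  have n: "CARD('a idx) = n"
    using assms(2,3) by (simp add: card_idx)
  obtain c :: real where c: "0 < c" "\<And>A. A \<in> sets \<mu> \<longleftrightarrow> vect -` A \<in> sets borel"
    "\<And>A. A \<in> sets \<mu> \<Longrightarrow> measure \<mu> A = c * measure lborel (vect -` A)"
    using haar_measure_coord[OF assms(4)] by blast
  define \<kappa> where "\<kappa> = (1 - 1 / (2 * pi)) * exp (- pi)"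
  define V where "V = unit_ball_vol (real n)"
  define a where "a = real (card (int_vecs \<inter> body))"
  define b where "b = real (card (int_vecs \<inter> polar))"
  define v where "v = measure lborel body"
  define T where "T = real (card (torsion :: 'a set))"
  have "finite (int_vecs \<inter> body)" "0 \<in> int_vecs \<inter> body"
    using finite_int_vecs_bounded[OF compact_imp_bounded[OF compact_body]] by (auto simp: body_def int_vecs_def)
  then have a: "0 < a"
    unfolding a_def by (auto simp: card_gt_0_iff)
  have "finite (int_vecs \<inter> polar)" "0 \<in> int_vecs \<inter> polar"
    using finite_int_vecs_bounded[OF bounded_polar] by (auto simp: polar_def int_vecs_def nonneg)
  then have b: "0 < b"
    unfolding b_def by (auto simp: card_gt_0_iff)
  have T: "0 < T"
    unfolding T_def using finite_torsion[OF fg] torsion_zero by (auto simp: card_gt_0_iff)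
  have v: "0 < v" unfolding v_def by (rule measure_body_pos)
  have V: "0 < V" by (simp add: V_def)
  have h0: "h0_hat N = ln T + ln a"
    using T a by (simp add: h0_hat_def card_norm_le_one T_def a_def ln_mult)
  have h1: "h1_hat N = ln b"
    by (simp add: h1_hat_def h0_hat_def card_dual_norm_le_one b_def)
  have "unit_ball N \<in> sets \<mu>"
    unfolding c(2) unit_ball_coord by (rule body_borel)
  from c(3)[OF this] have "measure \<mu> (unit_ball N) = c * v"
    by (simp only: unit_ball_coord v_def)
  moreover have "covolume \<mu> = c"
    by (rule covolume_coord[OF c(2,3)])
  \<comment> \<open>The normalisation \<open>c\<close> of the Haar measure cancels here.\<close>
  ultimately have "covolume \<mu> / measure \<mu> (unit_ball N) = 1 / v"
    using c(1) by simp
  then have chi: "chi_hat \<mu> N = ln T + ln v"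
    using v by (simp add: chi_hat_def T_def ln_div)
  have "Gamma (real n / 2 + 1) * pi powr (- (real n / 2)) = 1 / V"
    by (simp add: V_def unit_ball_vol_def powr_minus_divide)
  then have deg: "deg_hat \<mu> N = ln T + ln v - ln V"
    using V by (simp add: deg_hat_def assms(2)[symmetric] chi ln_div)
  \<comment> \<open>The torsion contributes \<open>ln T\<close> both to \<open>h0_hat\<close> and to
    the degree, and nothing to \<open>h1_hat\<close>, so it cancels.\<close>
  have \<Delta>: "h0_hat N - h1_hat N - deg_hat \<mu> N = ln (V * a) - ln (b * v)"
    using a b v V by (simp add: h0 h1 deg ln_mult)
  have k: "0 < 1 - 1 / (2 * pi)"
    using pi_gt3 by (simp add: field_simps)
  then have \<kappa>: "0 < \<kappa>" "ln \<kappa> = ln (1 - 1 / (2 * pi)) - pi"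
    by (simp_all add: \<kappa>_def ln_mult)
  have ln_n: "ln (real n ^ n) = real n * ln (real n)"
    using assms(3) by (simp add: ln_realpow)
  have nn: "0 < real n ^ n" using assms(3) by simp
  have ineq: "\<kappa> * (b * v) \<le> real n ^ n * (V * a)" "\<kappa> * (V * a) \<le> real n ^ n * (b * v)"
    using lattice_points_body_polar unfolding \<kappa>_def a_def b_def v_def V_def n by simp_all
  have "ln (\<kappa> * (b * v)) \<le> ln (real n ^ n * (V * a))"
    using ineq(1) \<kappa>(1) b v by (intro ln_mono) auto
  then have 1: "ln \<kappa> + ln (b * v) \<le> real n * ln (real n) + ln (V * a)"
    using \<kappa>(1) nn a b v V by (simp only: ln_mult_pos mult_pos_pos ln_n)
  have "ln (\<kappa> * (V * a)) \<le> ln (real n ^ n * (b * v))"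
    using ineq(2) \<kappa>(1) V a by (intro ln_mono) auto
  then have 2: "ln \<kappa> + ln (V * a) \<le> real n * ln (real n) + ln (b * v)"
    using \<kappa>(1) nn a b v V by (simp only: ln_mult_pos mult_pos_pos ln_n)
  show ?thesis
    unfolding \<Delta> using 1 2 \<kappa>(2) by linarith
qed

end
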